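(* The linear form $\mathrm{Tr}'\in U^*$ is a symmetric function on $U$ (i.e. $\mathrm{Tr}'(xy)=\mathrm{Tr}'(yx)$ for all $x,y\in U$) satisfying the following properties. (Partial trace property) For any $f\in\operatorname{End}_U(U\otimes U)$, $$\mathrm{Tr}'_2(f)=\mathrm{Tr}'\big(\operatorname{tr}_r^U(f)\big)=\mathrm{Tr}'\big(\operatorname{tr}_l^U(f)\big).$$ (Non-degeneracy) The pairing $\langle\ ,\ \rangle: Z(U)\times \mathrm{HH}_0(U)\to\mathbb C$ defined by $\langle z,u\rangle=\mathrm{Tr}'(zu)$ is non-degenerate.
   Context: Fix an integer $p\ge 2$ and $q=e^{i\pi/p}$. The restricted quantum group $U=\overline U_q(\mathfrak{sl}(2))$ is the $\mathbb C$-algebra with generators $E,F,K,K^{-1}$ and relations $E^p=F^p=0$, $K^{2p}=1$, $KK^{-1}=K^{-1}K=1$, $KEK^{-1}=q^2E$, $KFK^{-1}=q^{-2}F$, $[E,F]=\frac{K-K^{-1}}{q-q^{-1}}$. It is a Hopf algebra with $\Delta(E)=1\otimes E+E\otimes K$, $\Delta(F)=K^{-1}\otimes F+F\otimes 1$, $\Delta(K^{\pm1})=K^{\pm1}\otimes K^{\pm1}$, $\varepsilon(E)=\varepsilon(F)=0$, $\varepsilon(K^{\pm1})=1$, $S(E)=-EK^{-1}$, $S(F)=-KF$, $S(K^{\pm1})=K^{\mp1}$. Modules are left modules, and tensor products of modules carry the action through $\Delta$. $Z(U)$ is the center of $U$, and $\mathrm{HH}_0(U)=U/[U,U]$ with $[U,U]=\operatorname{Span}\{xy-yx\mid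 x,y\in U\}$; $Z(U)$ acts on it by multiplication. The balancing element is $g=K^{p+1}$. For finite-dimensional $U$-modules $V,W$ and $f\in\operatorname{End}_U(V\otimes W)$, with bases $\{v_i\}$, $\{w_i\}$ and dual bases $\{v_i^*\}$, $\{w_i^*\}$, the partial traces are $\operatorname{tr}_r^W(f)\in\operatorname{End}_U(V)$, $\operatorname{tr}_r^W(f)(v)=\sum_i(\operatorname{id}_V\otimes w_i^* )\big((1\otimes g)f(v\otimes w_i)\big)$, and $\operatorname{tr}_l^V(f)\in\operatorname{End}_U(W)$, $\operatorname{tr}_l^V(f)(w)=\sum_i(v_i^*\otimes\operatorname{id}_W)\big(f(g^{-1}v_i\otimes w)\big)$. For $V=W=U$, $\operatorname{tr}_r^U$ is the partial trace over the second factor and $\operatorname{tr}_l^U$ over the first. The modified trace is the unique family of linear functions $\{\mathsf t_V:\operatorname{End}_U(V)\to\mathbb C\}$, $V$ ranging over finite-dimensional projective $U$-modules, such that: (1) $\mathsf t_V(hf)=\mathsf t_X(fh)$ for all $U$-morphisms $f:V\to X$, $h:X\to V$ between projectives; (2) for $X$ projective, $W$ any finite-dimensional $U$-module, $\mathsf t_{X\otimes W}(f)=\mathsf t_X(\operatorname{tr}_r^W(f))$ and $\mathsf t_{W\otimes X}(h)=\mathsf t_X(\operatorname{tr}_l^W(h))$ for all $f\in\operatorname{End}_U(X\otimes W)$, $h\in\operatorname{End}_U(W\otimes X)$; (3) $\mathsf t_{\mathcal P_p^+}(\operatorname{id})=(-1)^{p-1}$, where $\mathcal P_p^+$ is the $p$-dimensional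 simple (and projective) $U$-module with highest weight vector $v$: $Ev=0$, $Kv=q^{p-1}v$. (Existence and uniqueness of this family is known.) $U$ is regarded as a free left module over itself (the regular representation). The map $x\mapsto r_x$, $r_x(y)=yx$, is an algebra isomorphism $U^{op}\cong\operatorname{End}_U(U)$, used to identify the two. For $m\ge1$, $\mathrm{Tr}'_m:\operatorname{End}_U(U^{\otimes m})\to\mathbb C$ is $\mathrm{Tr}'_m(f)=\mathsf t_{U^{\otimes m}}(f)$, and $\mathrm{Tr}'=\mathrm{Tr}'_1$, so that $\mathrm{Tr}'(x)=\mathsf t_U(r_x)$ for $x\in U$ and $\mathrm{Tr}'(f)=\mathsf t_U(f)$ for $f\in\operatorname{End}_U(U)$. *)

theory Defs
  imports
    "HOL-Library.Poly_Mapping"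
    "HOL-Algebra.QuotRing"
    "Jordan_Normal_Form.VS_Connect"
begin

text \<open>
  Associative unital complex algebras are represented by records of type
  \<open>(complex, 'a) module\<close> (ring operations together with a scalar multiplication);
  for square matrices this is \<open>module_mat TYPE(complex) n n\<close>.
\<close>

section \<open>The restricted quantum group\<close>

text \<open>
  The free algebra on the generators is the monoid algebra of the free monoid of words,
  so its product is the convolution product of \<open>Poly_Mapping\<close>.  That product is
  driven by an additive monoid; hence concatenation of words is written \<open>+\<close>.
\<close>

datatype gen = gE | gF | gK | gKinv

datatype gen_word = Word "gen list"

instantiation gen_word :: monoid_add
begin

definition zero_gen_word :: gen_word
  where "0 = Word []"

fun plus_gen_word :: "gen_word \<Rightarrow> gen_word \<Rightarrow> gen_word"
  where "Word u + Word v = Word (u @ v)"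

instance
proof
  fix a b c :: gen_word
  show "a + b + c = a + (b + c)" by (cases a; cases b; cases c) simp
  show "0 + a = a" by (cases a) (simp add: zero_gen_word_def)
  show "a + 0 = a" by (cases a) (simp add: zero_gen_word_def)
qed

end

type_synonym free_elt = "gen_word \<Rightarrow>\<^sub>0 complex"

definition free_algebra :: "(complex, free_elt) module"
  where "free_algebra =
    \<lparr>carrier = UNIV, mult = (*), one = 1, zero = 0, add = (+),
     smult = (\<lambda>c x. Poly_Mapping.single 0 c * x)\<rparr>"

definition free_gen :: "gen \<Rightarrow> free_elt"
  where "free_gen x = Poly_Mapping.single (Word [x]) 1"

definition qroot :: "nat \<Rightarrow> complex"
  where "qroot p = exp (\<i> * of_real pi / of_nat p)"

text \<open>
  The defining relations in an arbitrary algebra \<open>A\<close>, for an assignment \<open>x\<close> of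
  elements of \<open>A\<close> to the generators; each relation is written as the element that has
  to vanish.
\<close>

definition relators :: "nat \<Rightarrow> (complex, 'a) module \<Rightarrow> (gen \<Rightarrow> 'a) \<Rightarrow> 'a set"
  where "relators p A x = (let q = qroot p; E = x gE; F = x gF; K = x gK; Kinv = x gKinv in
    {E [^]\<^bsub>A\<^esub> p,
     F [^]\<^bsub>A\<^esub> p,
     K [^]\<^bsub>A\<^esub> (2 * p) \<ominus>\<^bsub>A\<^esub> \<one>\<^bsub>A\<^esub>,
     K \<otimes>\<^bsub>A\<^esub> Kinv \<ominus>\<^bsub>A\<^esub> \<one>\<^bsub>A\<^esub>,
     Kinv \<otimes>\<^bsub>A\<^esub> K \<ominus>\<^bsub>A\<^esub> \<one>\<^bsub>A\<^esub>,
     K \<otimes>\<^bsub>A\<^esub> E \<otimes>\<^bsub>A\<^esub> Kinv \<ominus>\<^bsub>A\<^esub> (q ^ 2 \<odot>\<^bsub>A\<^esub> E),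
     K \<otimes>\<^bsub>A\<^esub> F \<otimes>\<^bsub>A\<^esub> Kinv \<ominus>\<^bsub>A\<^esub> (inverse (q ^ 2) \<odot>\<^bsub>A\<^esub> F),
     (E \<otimes>\<^bsub>A\<^esub> F \<ominus>\<^bsub>A\<^esub> F \<otimes>\<^bsub>A\<^esub> E)
       \<ominus>\<^bsub>A\<^esub> (inverse (q - inverse q) \<odot>\<^bsub>A\<^esub> (K \<ominus>\<^bsub>A\<^esub> Kinv))})"

text \<open>
  \<open>ideal\<close> and \<open>Idl\<close> of HOL-Algebra are two-sided, and \<open>Quot\<close> is
  available for noncommutative rings; only the scalar multiplication has to be added.
\<close>

definition quot_algebra :: "(complex, 'a) module \<Rightarrow> 'a set \<Rightarrow> (complex, 'a set) module"
  where "quot_algebra A I =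
    \<lparr>carrier = carrier (A Quot I), mult = mult (A Quot I), one = one (A Quot I),
     zero = zero (A Quot I), add = add (A Quot I),
     smult = (\<lambda>c X. \<Union>x\<in>X. I +>\<^bsub>A\<^esub> (c \<odot>\<^bsub>A\<^esub> x))\<rparr>"

definition rel_ideal :: "nat \<Rightarrow> free_elt set"
  where "rel_ideal p = Idl\<^bsub>free_algebra\<^esub> (relators p free_algebra free_gen)"

definition Uq :: "nat \<Rightarrow> (complex, free_elt set) module"
  where "Uq p = quot_algebra free_algebra (rel_ideal p)"

definition Uq_gen :: "nat \<Rightarrow> gen \<Rightarrow> free_elt set"
  where "Uq_gen p x = rel_ideal p +>\<^bsub>free_algebra\<^esub> free_gen x"


section \<open>Finite-dimensional modules\<close>

text \<open>
  A finite-dimensional left module is given on the underlying space \<open>\<complex>\<^sup>n\<close> by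
  the matrices of the generators, subject to the defining relations.  Module homomorphisms
  are the intertwining matrices, composition is the matrix product.
\<close>

record umod =
  udim :: nat
  uact :: "gen \<Rightarrow> complex mat"

definition is_umod :: "nat \<Rightarrow> umod \<Rightarrow> bool"
  where "is_umod p V \<longleftrightarrow>
    (\<forall>x. uact V x \<in> carrier_mat (udim V) (udim V)) \<and>
    relators p (module_mat TYPE(complex) (udim V) (udim V)) (uact V)
      \<subseteq> {0\<^sub>m (udim V) (udim V)}"

definition uhom :: "umod \<Rightarrow> umod \<Rightarrow> complex mat set"
  where "uhom V W = {f \<in> carrier_mat (udim W) (udim V). \<forall>x. f * uact V x = uact W x * f}"

abbreviation uend :: "umod \<Rightarrow> complex mat set"
  where "uend V \<equiv> uhom V V"

definition surj_mat :: "complex mat \<Rightarrow> bool"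
  where "surj_mat f \<longleftrightarrow>
    (\<forall>y\<in>carrier_vec (dim_row f). \<exists>x\<in>carrier_vec (dim_col f). f *\<^sub>v x = y)"

definition uprojective :: "nat \<Rightarrow> umod \<Rightarrow> bool"
  where "uprojective p V \<longleftrightarrow> is_umod p V \<and>
    (\<forall>X Y g h. is_umod p X \<longrightarrow> is_umod p Y \<longrightarrow> g \<in> uhom X Y \<longrightarrow> surj_mat g \<longrightarrow>
       h \<in> uhom V Y \<longrightarrow> (\<exists>k\<in>uhom V X. g * k = h))"

definition usimple :: "nat \<Rightarrow> umod \<Rightarrow> bool"
  where "usimple p V \<longleftrightarrow> is_umod p V \<and> udim V > 0 \<and>
    (\<forall>S. submodule class_ring S (module_vec TYPE(complex) (udim V)) \<longrightarrow>
       (\<forall>x. \<forall>v\<in>S. uact V x *\<^sub>v v \<in> S) \<longrightarrow>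
       S = {0\<^sub>v (udim V)} \<or> S = carrier_vec (udim V))"

text \<open>
  Kronecker product: the basis vector \<open>v\<^sub>i \<otimes> w\<^sub>j\<close> of
  \<open>\<complex>\<^sup>n \<otimes> \<complex>\<^sup>m = \<complex>\<^sup>n\<^sup>m\<close> has index \<open>i * m + j\<close>.
\<close>

definition kron :: "complex mat \<Rightarrow> complex mat \<Rightarrow> complex mat"
  where "kron A B =
    mat (dim_row A * dim_row B) (dim_col A * dim_col B)
      (\<lambda>(i, j). A $$ (i div dim_row B, j div dim_col B) * B $$ (i mod dim_row B, j mod dim_col B))"

text \<open>
  The tensor product carries the action through
  \<open>\<Delta>(E) = 1 \<otimes> E + E \<otimes> K\<close>, \<open>\<Delta>(F) = K\<^sup>-\<^sup>1 \<otimes> F + F \<otimes> 1\<close>,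
  \<open>\<Delta>(K) = K \<otimes> K\<close>, \<open>\<Delta>(K\<^sup>-\<^sup>1) = K\<^sup>-\<^sup>1 \<otimes> K\<^sup>-\<^sup>1\<close>.
\<close>

definition utensor :: "umod \<Rightarrow> umod \<Rightarrow> umod"
  where "utensor V W =
    \<lparr>udim = udim V * udim W,
     uact = (\<lambda>x. case x of
         gE \<Rightarrow> kron (1\<^sub>m (udim V)) (uact W gE) + kron (uact V gE) (uact W gK)
       | gF \<Rightarrow> kron (uact V gKinv) (uact W gF) + kron (uact V gF) (1\<^sub>m (udim W))
       | gK \<Rightarrow> kron (uact V gK) (uact W gK)
       | gKinv \<Rightarrow> kron (uact V gKinv) (uact W gKinv))\<rparr>"

text \<open>\<open>utensor_power V m\<close> is \<open>V\<close> tensored with itself \<open>m\<close> times, for \<open>m \<ge> 1\<close>.\<close>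

fun utensor_power :: "umod \<Rightarrow> nat \<Rightarrow> umod"
  where
    "utensor_power V (Suc (Suc m)) = utensor (utensor_power V (Suc m)) V"
  | "utensor_power V _ = V"


section \<open>Partial traces and the modified trace\<close>

definition act_g :: "nat \<Rightarrow> umod \<Rightarrow> complex mat"
  where "act_g p V = uact V gK ^\<^sub>m (p + 1)"

definition act_g_inv :: "nat \<Rightarrow> umod \<Rightarrow> complex mat"
  where "act_g_inv p V = uact V gKinv ^\<^sub>m (p + 1)"

definition ptr_right :: "nat \<Rightarrow> umod \<Rightarrow> umod \<Rightarrow> complex mat \<Rightarrow> complex mat"
  where "ptr_right p V W f =
    (let n = udim V; m = udim W; h = kron (1\<^sub>m n) (act_g p W) * f
     in mat n n (\<lambda>(a, b). \<Sum>i<m. h $$ (a * m + i, b * m + i)))"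

definition ptr_left :: "nat \<Rightarrow> umod \<Rightarrow> umod \<Rightarrow> complex mat \<Rightarrow> complex mat"
  where "ptr_left p V W f =
    (let n = udim V; m = udim W; h = f * kron (act_g_inv p V) (1\<^sub>m m)
     in mat m m (\<lambda>(a, b). \<Sum>i<n. h $$ (i * m + a, i * m + b)))"

text \<open>
  A family of linear functions indexed by the finite-dimensional projective modules is a
  function \<open>t\<close> of the module and the endomorphism; its values elsewhere are irrelevant.
  The last clause normalizes on the \<open>p\<close>-dimensional simple module with highest weight
  vector \<open>v\<close> of weight \<open>q\<^sup>p\<^sup>-\<^sup>1\<close>, in whatever basis it is written.
\<close>

definition modified_trace :: "nat \<Rightarrow> (umod \<Rightarrow> complex mat \<Rightarrow> complex) \<Rightarrow> bool"
  where "modified_trace p t \<longleftrightarrow>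
    (\<forall>V. uprojective p V \<longrightarrow>
       (\<forall>f\<in>uend V. \<forall>h\<in>uend V. t V (f + h) = t V f + t V h) \<and>
       (\<forall>c. \<forall>f\<in>uend V. t V (c \<cdot>\<^sub>m f) = c * t V f)) \<and>
    (\<forall>V X. uprojective p V \<longrightarrow> uprojective p X \<longrightarrow>
       (\<forall>f\<in>uhom V X. \<forall>h\<in>uhom X V. t V (h * f) = t X (f * h))) \<and>
    (\<forall>X W. uprojective p X \<longrightarrow> is_umod p W \<longrightarrow>
       (\<forall>f\<in>uend (utensor X W). t (utensor X W) f = t X (ptr_right p X W f)) \<and>
       (\<forall>h\<in>uend (utensor W X). t (utensor W X) h = t X (ptr_left p W X h))) \<and>
    (\<forall>P v. usimple p P \<longrightarrow> udim P = p \<longrightarrow>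
       v \<in> carrier_vec p \<longrightarrow> v \<noteq> 0\<^sub>v p \<longrightarrow>
       uact P gE *\<^sub>v v = 0\<^sub>v p \<longrightarrow> uact P gK *\<^sub>v v = qroot p ^ (p - 1) \<cdot>\<^sub>v v \<longrightarrow>
       t P (1\<^sub>m p) = (- 1) ^ (p - 1))"


section \<open>The regular representation and the trace on the algebra\<close>

text \<open>
  To be an object of the above kind, the regular representation is written in an
  arbitrary ordered basis \<open>bs\<close> of the algebra.
\<close>

definition ordered_basis :: "(complex, 'a) module \<Rightarrow> 'a list \<Rightarrow> bool"
  where "ordered_basis A bs \<longleftrightarrow> distinct bs \<and> vectorspace.basis class_ring A (set bs)"

definition coords :: "(complex, 'a) module \<Rightarrow> 'a list \<Rightarrow> 'a \<Rightarrow> complex vec"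
  where "coords A bs x =
    (THE v. v \<in> carrier_vec (length bs) \<and>
       x = finsum A (\<lambda>i. v $ i \<odot>\<^bsub>A\<^esub> bs ! i) {..<length bs})"

definition matrix_in_basis :: "(complex, 'a) module \<Rightarrow> 'a list \<Rightarrow> ('a \<Rightarrow> 'a) \<Rightarrow> complex mat"
  where "matrix_in_basis A bs \<phi> =
    mat (length bs) (length bs) (\<lambda>(i, j). coords A bs (\<phi> (bs ! j)) $ i)"

definition regular_umod :: "nat \<Rightarrow> free_elt set list \<Rightarrow> umod"
  where "regular_umod p bs =
    \<lparr>udim = length bs,
     uact = (\<lambda>x. matrix_in_basis (Uq p) bs (\<lambda>y. Uq_gen p x \<otimes>\<^bsub>Uq p\<^esub> y))\<rparr>"

definition right_mult :: "nat \<Rightarrow> free_elt set list \<Rightarrow> free_elt set \<Rightarrow> complex mat"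
  where "right_mult p bs x = matrix_in_basis (Uq p) bs (\<lambda>y. y \<otimes>\<^bsub>Uq p\<^esub> x)"

definition Tr_End ::
    "nat \<Rightarrow> (umod \<Rightarrow> complex mat \<Rightarrow> complex) \<Rightarrow> free_elt set list \<Rightarrow> nat \<Rightarrow> complex mat \<Rightarrow> complex"
  where "Tr_End p t bs m f = t (utensor_power (regular_umod p bs) m) f"

definition Tr_U ::
    "nat \<Rightarrow> (umod \<Rightarrow> complex mat \<Rightarrow> complex) \<Rightarrow> free_elt set list \<Rightarrow> free_elt set \<Rightarrow> complex"
  where "Tr_U p t bs x = Tr_End p t bs 1 (right_mult p bs x)"


section \<open>Center, zeroth Hochschild homology, pairings\<close>

definition linear_form :: "(complex, 'a) module \<Rightarrow> ('a \<Rightarrow> complex) \<Rightarrow> bool"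
  where "linear_form A \<phi> \<longleftrightarrow>
    (\<forall>x\<in>carrier A. \<forall>y\<in>carrier A. \<phi> (x \<oplus>\<^bsub>A\<^esub> y) = \<phi> x + \<phi> y) \<and>
    (\<forall>c. \<forall>x\<in>carrier A. \<phi> (c \<odot>\<^bsub>A\<^esub> x) = c * \<phi> x)"

definition alg_center :: "(complex, 'a) module \<Rightarrow> 'a set"
  where "alg_center A = {z \<in> carrier A. \<forall>x\<in>carrier A. z \<otimes>\<^bsub>A\<^esub> x = x \<otimes>\<^bsub>A\<^esub> z}"

definition commutator_span :: "(complex, 'a) module \<Rightarrow> 'a set"
  where "commutator_span A =
    LinearCombinations.module.span class_ring A
      {x \<otimes>\<^bsub>A\<^esub> y \<ominus>\<^bsub>A\<^esub> y \<otimes>\<^bsub>A\<^esub> x | x y. x \<in> carrier A \<and> y \<in> carrier A}"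

definition HH0 :: "(complex, 'a) module \<Rightarrow> 'a set set"
  where "HH0 A = a_rcosets\<^bsub>A\<^esub> (commutator_span A)"

text \<open>
  The pairing of a central element \<open>z\<close> with a class \<open>c\<close> is the value of \<open>\<phi> (z u)\<close> at
  any representative \<open>u\<close> of \<open>c\<close>.
\<close>

definition center_HH0_pairing ::
    "(complex, 'a) module \<Rightarrow> ('a \<Rightarrow> complex) \<Rightarrow> 'a \<Rightarrow> 'a set \<Rightarrow> complex"
  where "center_HH0_pairing A \<phi> z c = (THE r. \<forall>u\<in>c. \<phi> (z \<otimes>\<^bsub>A\<^esub> u) = r)"

definition nondegenerate_pairing ::
    "'a set \<Rightarrow> 'a \<Rightarrow> 'b set \<Rightarrow> 'b \<Rightarrow> ('a \<Rightarrow> 'b \<Rightarrow> complex) \<Rightarrow> bool"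
  where "nondegenerate_pairing M zeroM N zeroN B \<longleftrightarrow>
    (\<forall>x\<in>M. (\<forall>y\<in>N. B x y = 0) \<longrightarrow> x = zeroM) \<and>
    (\<forall>y\<in>N. (\<forall>x\<in>M. B x y = 0) \<longrightarrow> y = zeroN)"

end

theory Submission
  imports Defs
begin

text \<open>
  Everything rests on one fact, \<open>modified_trace_nondegenerate\<close>: if \<open>f\<close> is a non-zero
  endomorphism of a projective module \<open>V\<close>, then \<open>t\<^sub>V(u f) \<noteq> 0\<close> for some endomorphism
  \<open>u\<close> of \<open>V\<close>.

  The witness \<open>u\<close> comes from the Steinberg module \<open>P\<close>, the \<open>p\<close>-dimensional module whose
  identity has modified trace \<open>\<plusminus>1\<close>.  This module is simple, projective and injective.  The
  endomorphism \<open>f\<close> is the same thing as an invariant vector \<open>\<phi> \<in> V \<otimes> V\<^sup>*\<close>, so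
  \<open>x \<mapsto> x \<otimes> \<phi>\<close> is an embedding of \<open>P\<close> into \<open>P \<otimes> V \<otimes> V\<^sup>*\<close>, and by injectivity it
  has a retraction \<open>k\<close> (\<open>steinberg_injective\<close>).  Moving the factor \<open>V\<^sup>*\<close> to the other side
  turns \<open>k\<close> into an endomorphism \<open>h\<close> of \<open>P \<otimes> V\<close>, and the right partial trace of
  \<open>h (1 \<otimes> f)\<close> is \<open>k\<close> applied to \<open>x \<otimes> \<phi>\<close>, which is the identity of \<open>P\<close>
  (\<open>ptr_right_bend\<close>).  The two partial trace properties now give
  \<open>\<plusminus>1 = t\<^sub>P(1) = t(h (1 \<otimes> f)) = t\<^sub>V(u f)\<close>, where \<open>u\<close> is the left partial trace of \<open>h\<close>; that \<open>u\<close> is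
  again a module endomorphism is \<open>ptr_left_uend\<close>.

  The regular module is projective and its endomorphisms are the right multiplications, so the
  form \<open>Tr'(x y)\<close> on \<open>U\<close> is non-degenerate; it is symmetric because the modified trace is
  cyclic.  The remaining assertions are linear algebra in a finite-dimensional symmetric algebra.
  Every linear form on \<open>U\<close> is \<open>Tr'(z _)\<close> for some \<open>z\<close>, and it vanishes on
  \<open>[U, U]\<close> exactly when \<open>z\<close> is central.  Hence the elements on which all forms
  \<open>Tr'(z _)\<close> with central \<open>z\<close> vanish are those of \<open>[U, U]\<close>.
\<close>

section \<open>Kronecker products\<close>

lemma sum_div_mod:
  fixes g :: "nat \<Rightarrow> nat \<Rightarrow> 'a::comm_monoid_add"
  shows "(\<Sum>k<a * b. g (k div b) (k mod b)) = (\<Sum>i<a. \<Sum>j<b. g i j)"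
proof -
  have "(\<Sum>k<a * b. g (k div b) (k mod b)) = (\<Sum>i<a. \<Sum>k\<in>{i*b..<i*b+b}. g (k div b) (k mod b))"
    by (rule sum.nat_group[symmetric])
  also have "\<dots> = (\<Sum>i<a. \<Sum>j<b. g i j)"
  proof (rule sum.cong[OF refl])
    fix i
    have "(\<Sum>k\<in>{i*b..<i*b+b}. g (k div b) (k mod b)) = (\<Sum>j\<in>{0..<b}. g ((j + i*b) div b) ((j + i*b) mod b))"
      by (subst sum.shift_bounds_nat_ivl[of _ 0 "i*b" b, simplified, symmetric]) (simp add: add.commute)
    also have "\<dots> = (\<Sum>j<b. g i j)"
      by (rule sum.cong) (auto simp: atLeast0LessThan)
    finally show "(\<Sum>k\<in>{i*b..<i*b+b}. g (k div b) (k mod b)) = (\<Sum>j<b. g i j)" .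
  qed
  finally show ?thesis .
qed

lemma sum_mult_index:
  fixes f :: "nat \<Rightarrow> 'a::comm_monoid_add"
  shows "(\<Sum>k<a * b. f k) = (\<Sum>i<a. \<Sum>j<b. f (i * b + j))"
  using sum_div_mod[of "\<lambda>i j. f (i * b + j)" b a] by simp

lemma mult_index_less: "i < a \<Longrightarrow> j < b \<Longrightarrow> i * b + j < a * (b::nat)"
proof -
  assume "i < a" "j < b"
  then have "i * b + j < Suc i * b" by simp
  also have "\<dots> \<le> a * b" using \<open>i < a\<close> by (intro mult_le_mono1) simp
  finally show ?thesis .
qed

lemma div_index_less: "k < a * b \<Longrightarrow> k div b < (a::nat)"
  by (simp add: less_mult_imp_div_less)

lemma mod_index_less: "k < a * b \<Longrightarrow> k mod b < (b::nat)"
  by (cases "b = 0") auto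

lemma kron_dim [simp]:
  "dim_row (kron A B) = dim_row A * dim_row B" "dim_col (kron A B) = dim_col A * dim_col B"
  by (simp_all add: kron_def)

lemma kron_carrier [simp, intro]:
  "A \<in> carrier_mat a b \<Longrightarrow> B \<in> carrier_mat c d \<Longrightarrow> kron A B \<in> carrier_mat (a * c) (b * d)"
  by (auto simp: kron_def)

lemma kron_index:
  "i < dim_row A * dim_row B \<Longrightarrow> j < dim_col A * dim_col B \<Longrightarrow>
   kron A B $$ (i, j) = A $$ (i div dim_row B, j div dim_col B) * B $$ (i mod dim_row B, j mod dim_col B)"
  by (simp add: kron_def)

lemma kron_mult:
  assumes "A \<in> carrier_mat a b" "C \<in> carrier_mat b c" "B \<in> carrier_mat d e" "D \<in> carrier_mat e f"
  shows "kron A B * kron C D = kron (A * C) (B * D)"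
proof (rule eq_matI)
  fix i j assume "i < dim_row (kron (A * C) (B * D))" "j < dim_col (kron (A * C) (B * D))"
  then have i: "i < a * d" and j: "j < c * f" using assms by auto
  have iq: "i div d < a" "i mod d < d" and jq: "j div f < c" "j mod f < f"
    using i j div_index_less mod_index_less by auto
  have "(kron A B * kron C D) $$ (i, j)
    = (\<Sum>k<b * e. A $$ (i div d, k div e) * B $$ (i mod d, k mod e) *
         (C $$ (k div e, j div f) * D $$ (k mod e, j mod f)))"
    using assms i j by (auto simp: scalar_prod_def kron_index atLeast0LessThan intro!: sum.cong)
  also have "\<dots> = (\<Sum>k<b. \<Sum>l<e. A $$ (i div d, k) * B $$ (i mod d, l) * (C $$ (k, j div f) * D $$ (l, j mod f)))"
    by (rule sum_div_mod)
  also have "\<dots> = (\<Sum>k<b. A $$ (i div d, k) * C $$ (k, j div f)) * (\<Sum>l<e. B $$ (i mod d, l) * D $$ (l, j mod f))"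
    by (simp add: sum_product algebra_simps)
  also have "\<dots> = kron (A * C) (B * D) $$ (i, j)"
    using assms i j iq jq by (simp add: kron_index scalar_prod_def atLeast0LessThan)
  finally show "(kron A B * kron C D) $$ (i, j) = kron (A * C) (B * D) $$ (i, j)" .
qed (use assms in auto)

lemma kron_one: "kron (1\<^sub>m a) (1\<^sub>m b) = 1\<^sub>m (a * b)"
proof (rule eq_matI)
  fix i j assume "i < dim_row (1\<^sub>m (a * b))" "j < dim_col (1\<^sub>m (a * b))"
  then have i: "i < a * b" and j: "j < a * b" by auto
  have "i = j \<longleftrightarrow> i div b = j div b \<and> i mod b = j mod b"
    by (metis div_mult_mod_eq)
  with i j show "kron (1\<^sub>m a) (1\<^sub>m b) $$ (i, j) = 1\<^sub>m (a * b) $$ (i, j)"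
    by (auto simp: kron_index div_index_less mod_index_less)
qed auto

text \<open>
  Since \<open>v\<^sub>i \<otimes> w\<^sub>j\<close> has index \<open>i * m + j\<close>, both bracketings of a triple product order
  the basis in the same way.  Tensor products of modules are therefore associative as an
  equality, and no associativity isomorphisms appear below.
\<close>

lemma kron_assoc: "kron (kron A B) C = kron A (kron B C)"
proof (rule eq_matI)
  fix i j assume "i < dim_row (kron A (kron B C))" "j < dim_col (kron A (kron B C))"
  then have i: "i < dim_row A * dim_row B * dim_row C" and j: "j < dim_col A * dim_col B * dim_col C"
    by (auto simp: mult.assoc)
  have i': "i < dim_row A * (dim_row B * dim_row C)" and j': "j < dim_col A * (dim_col B * dim_col C)"
    using i j by (auto simp: mult.assoc)
  have dm: "k div (m * n) = k div n div m" "k mod (m * n) div n = k div n mod m" "k mod (m * n) mod n = k mod n"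
    if "k < l * m * n" for k l m n :: nat
  proof -
    have "n > 0" using that by (cases n) auto
    show "k div (m * n) = k div n div m" by (metis div_mult2_eq mult.commute)
    have e: "k mod (m * n) = n * (k div n mod m) + k mod n" by (metis mod_mult2_eq mult.commute)
    then show "k mod (m * n) div n = k div n mod m" using \<open>n > 0\<close> by simp
    show "k mod (m * n) mod n = k mod n" unfolding e by simp
  qed
  show "kron (kron A B) C $$ (i, j) = kron A (kron B C) $$ (i, j)"
    using i j i' j' div_index_less[OF i] div_index_less[OF j] mod_index_less[OF i'] mod_index_less[OF j']
    by (simp add: kron_index dm[OF i] dm[OF j])
qed (auto simp: mult.assoc)

lemma kron_add_right:
  assumes "A \<in> carrier_mat a b" "B \<in> carrier_mat c d" "C \<in> carrier_mat c d"
  shows "kron A (B + C) = kron A B + kron A C"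
  using assms by (intro eq_matI) (auto simp: kron_index distrib_left mod_index_less div_index_less)

lemma kron_add_left:
  assumes "A \<in> carrier_mat a b" "B \<in> carrier_mat a b" "C \<in> carrier_mat c d"
  shows "kron (A + B) C = kron A C + kron B C"
  using assms by (intro eq_matI) (auto simp: kron_index distrib_right mod_index_less div_index_less)

lemma kron_smult_left: "kron (k \<cdot>\<^sub>m A) B = k \<cdot>\<^sub>m kron A B"
  by (intro eq_matI) (auto simp: kron_index mod_index_less div_index_less)

lemma kron_smult_right: "kron A (k \<cdot>\<^sub>m B) = k \<cdot>\<^sub>m kron A B"
  by (intro eq_matI) (auto simp: kron_index mod_index_less div_index_less)

lemma kron_zero_left: "kron (0\<^sub>m a b) B = 0\<^sub>m (a * dim_row B) (b * dim_col B)"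
  by (intro eq_matI) (auto simp: kron_index mod_index_less div_index_less)

lemma kron_zero_right: "kron A (0\<^sub>m a b) = 0\<^sub>m (dim_row A * a) (dim_col A * b)"
  by (intro eq_matI) (auto simp: kron_index mod_index_less div_index_less)

lemma kron_one_left: "kron (1\<^sub>m 1) B = B"
  by (intro eq_matI) (auto simp: kron_index)

lemma kron_one_right: "kron A (1\<^sub>m 1) = A"
  by (intro eq_matI) (auto simp: kron_index)

lemma kron_pow:
  assumes "A \<in> carrier_mat a a" "B \<in> carrier_mat b b"
  shows "kron A B ^\<^sub>m n = kron (A ^\<^sub>m n) (B ^\<^sub>m n)"
proof (induction n)
  case (Suc n)
  then show ?case
    using assms by (simp add: kron_mult[of _ a a _ a _ b b _ b])
qed (use assms in \<open>simp add: kron_one\<close>)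

section \<open>The binomial formula for q-commuting matrices\<close>

text \<open>
  The Gaussian binomial coefficients, with the recursion that multiplication of
  \<open>(A + B)\<^sup>n\<close> by \<open>A + B\<close> from the left produces when \<open>B A = w A B\<close>.
\<close>

fun gauss_binomial :: "'a::comm_ring_1 \<Rightarrow> nat \<Rightarrow> nat \<Rightarrow> 'a" where
  "gauss_binomial w n 0 = 1"
| "gauss_binomial w 0 (Suc k) = 0"
| "gauss_binomial w (Suc n) (Suc k) = gauss_binomial w n k + w ^ Suc k * gauss_binomial w n (Suc k)"

lemma gauss_binomial_eq_0: "n < k \<Longrightarrow> gauss_binomial w n k = 0"
  by (induction w n k rule: gauss_binomial.induct) auto

text \<open>
  The analogue of \<open>(k + 1) (n + 1 choose k + 1) = (n + 1) (n choose k)\<close>.  The induction step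
  also uses the other one-step relation, between \<open>(n + 1 choose k)\<close> and
  \<open>(n choose k)\<close>; it follows from the induction hypothesis and the recursion.
\<close>

lemma gauss_binomial_absorb:
  "(1 - w ^ Suc k) * gauss_binomial w (Suc n) (Suc k) = (1 - w ^ Suc n) * gauss_binomial w n k"
proof (induction n arbitrary: k)
  case 0
  then show ?case by (cases k) auto
next
  case (Suc n)
  define G where "G = gauss_binomial w (Suc n) k"
  have lower: "(w ^ k - w ^ Suc n) * G = w ^ k * ((1 - w ^ Suc n) * gauss_binomial w n k)"
  proof (cases k)
    case (Suc j)
    have G: "G = gauss_binomial w n j + w ^ k * gauss_binomial w n k"
      unfolding G_def Suc by simp
    have "(1 - w ^ k) * G = (1 - w ^ Suc n) * gauss_binomial w n j"
      unfolding G_def Suc using Suc.IH[of j] .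
    moreover have "w ^ k * ((1 - w ^ Suc n) * gauss_binomial w n k)
        = (1 - w ^ Suc n) * G - (1 - w ^ Suc n) * gauss_binomial w n j"
      unfolding G by (simp add: algebra_simps)
    ultimately show ?thesis by (simp add: algebra_simps)
  qed (simp add: G_def)
  have "(1 - w ^ Suc k) * gauss_binomial w (Suc (Suc n)) (Suc k)
      = (1 - w ^ Suc k) * G + w ^ Suc k * ((1 - w ^ Suc k) * gauss_binomial w (Suc n) (Suc k))"
    unfolding gauss_binomial.simps(3)[of w "Suc n"] G_def by (simp add: algebra_simps)
  also have "\<dots> = (1 - w ^ Suc k) * G + w * ((w ^ k - w ^ Suc n) * G)"
    using Suc.IH[of k] lower by (simp add: mult.assoc)
  also have "\<dots> = (1 - w ^ Suc (Suc n)) * G"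
    by (simp add: algebra_simps)
  finally show ?case unfolding G_def .
qed

text \<open>
  In the absorption identity \<open>w\<^sup>n = 1\<close> kills one side, and on the other side
  \<open>1 - w\<^sup>k\<close> cancels.
\<close>

lemma gauss_binomial_root_of_unity:
  fixes w :: "'a::idom"
  assumes "w ^ n = 1" "0 < k" "k < n" "w ^ k \<noteq> 1"
  shows "gauss_binomial w n k = 0"
proof -
  obtain k' n' where [simp]: "k = Suc k'" "n = Suc n'"
    using assms by (metis gr0_conv_Suc gr_implies_not0 not0_implies_Suc)
  have "(1 - w ^ k) * gauss_binomial w n k = 0"
    using gauss_binomial_absorb[of w k' n'] assms(1) by simp
  with \<open>w ^ k \<noteq> 1\<close> show ?thesis by simp
qed

lemma pow_mat_Suc_left:
  assumes "A \<in> carrier_mat n n"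
  shows "A ^\<^sub>m Suc k = A * A ^\<^sub>m k"
proof (induction k)
  case (Suc k)
  have "A * A ^\<^sub>m Suc k = A * A ^\<^sub>m k * A"
    using assms by (simp add: assoc_mult_mat[of A n n _ n A n])
  then show ?case using Suc by simp
qed (use assms in simp)

lemma q_commute_pow:
  fixes w :: "'a::comm_ring_1"
  assumes A: "A \<in> carrier_mat n n" and B: "B \<in> carrier_mat n n" and AB: "B * A = w \<cdot>\<^sub>m (A * B)"
  shows "B * (A ^\<^sub>m k) = w ^ k \<cdot>\<^sub>m ((A ^\<^sub>m k) * B)"
proof (induction k)
  case 0
  show ?case using A B by (auto intro!: eq_matI)
next
  case (Suc k)
  have Ak: "A ^\<^sub>m k \<in> carrier_mat n n" using A by simp
  have "B * (A ^\<^sub>m Suc k) = (B * A ^\<^sub>m k) * A"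
    using A B Ak by (simp add: assoc_mult_mat[of B n n _ n A n])
  also have "\<dots> = w ^ k \<cdot>\<^sub>m ((A ^\<^sub>m k * B) * A)"
    unfolding Suc.IH using A B Ak by (simp add: mult_smult_assoc_mat[of _ n n _ n] mult_carrier_mat[of _ n n _ n])
  also have "(A ^\<^sub>m k * B) * A = A ^\<^sub>m k * (w \<cdot>\<^sub>m (A * B))"
    using A B Ak by (simp add: assoc_mult_mat[of _ n n B n A n] AB)
  also have "\<dots> = w \<cdot>\<^sub>m (A ^\<^sub>m Suc k * B)"
    using A B Ak by (simp add: mult_smult_distrib[of _ n n _ n] mult_carrier_mat[of _ n n _ n] assoc_mult_mat[of _ n n A n B n])
  finally show ?case by (auto simp: mult.assoc mult.commute mult.left_commute intro!: eq_matI simp del: pow_mat.simps)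
qed

text \<open>
  Stated entry by entry, so that the sum is a sum of scalars.
\<close>

lemma q_binomial_entry:
  fixes w :: "'a::comm_ring_1"
  assumes A: "A \<in> carrier_mat n n" and B: "B \<in> carrier_mat n n" and AB: "B * A = w \<cdot>\<^sub>m (A * B)"
    and ij: "i < n" "j < n"
  shows "((A + B) ^\<^sub>m m) $$ (i, j)
    = (\<Sum>k\<le>m. gauss_binomial w m k * ((A ^\<^sub>m k) * (B ^\<^sub>m (m - k))) $$ (i, j))"
  using ij
proof (induction m arbitrary: i j)
  case 0
  then show ?case using A B by simp
next
  case (Suc m)
  define T where "T k l = (A ^\<^sub>m k) * (B ^\<^sub>m l)" for k l
  have pw: "X ^\<^sub>m k \<in> carrier_mat n n" if "X \<in> carrier_mat n n" for X :: "'a mat" and k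
    using that by simp
  have T: "T k l \<in> carrier_mat n n" for k l
    using mult_carrier_mat[OF pw[OF A] pw[OF B]] by (simp add: T_def)
  note comm = pow_mat_Suc_left[symmetric]
  have AT: "A * T k l = T (Suc k) l" for k l
    unfolding T_def using A B pw[OF A] pw[OF B]
    by (simp add: assoc_mult_mat[of A n n _ n _ n, symmetric] comm del: pow_mat.simps)
  have BT: "B * T k l = w ^ k \<cdot>\<^sub>m T k (Suc l)" for k l
  proof -
    have "B * T k l = (B * A ^\<^sub>m k) * B ^\<^sub>m l"
      unfolding T_def using A B pw[OF A] pw[OF B] by (simp add: assoc_mult_mat[of B n n _ n _ n])
    also have "\<dots> = w ^ k \<cdot>\<^sub>m (A ^\<^sub>m k * (B * B ^\<^sub>m l))"
      unfolding q_commute_pow[OF A B AB] using A B pw[OF A] pw[OF B]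
      by (simp add: mult_smult_assoc_mat[of _ n n _ n] mult_carrier_mat[of _ n n _ n] assoc_mult_mat[of _ n n B n _ n])
    finally show ?thesis unfolding T_def comm[OF B] .
  qed
  have "((A + B) ^\<^sub>m Suc m) $$ (i, j) = ((A + B) * (A + B) ^\<^sub>m m) $$ (i, j)"
    using comm[of "A + B" n m] A B by simp
  also have "\<dots> = (\<Sum>l<n. (A + B) $$ (i, l) * ((A + B) ^\<^sub>m m) $$ (l, j))"
    using Suc.prems A B pw[of "A + B" m] by (auto simp: scalar_prod_def atLeast0LessThan intro!: sum.cong)
  also have "\<dots> = (\<Sum>l<n. (A $$ (i, l) + B $$ (i, l)) *
      (\<Sum>k\<le>m. gauss_binomial w m k * T k (m - k) $$ (l, j)))"
    using Suc A B unfolding T_def by (intro sum.cong) auto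
  also have "\<dots> = (\<Sum>k\<le>m. gauss_binomial w m k *
      ((\<Sum>l<n. A $$ (i, l) * T k (m - k) $$ (l, j)) + (\<Sum>l<n. B $$ (i, l) * T k (m - k) $$ (l, j))))"
    unfolding sum_distrib_left sum.distrib[symmetric]
    by (subst sum.swap) (simp add: algebra_simps)
  also have "\<dots> = (\<Sum>k\<le>m. gauss_binomial w m k * ((A * T k (m - k)) $$ (i, j) + (B * T k (m - k)) $$ (i, j)))"
  proof -
    have "(X * T k l) $$ (i, j) = (\<Sum>l'<n. X $$ (i, l') * T k l $$ (l', j))" if "X \<in> carrier_mat n n" for X k l
      using Suc.prems that T[of k l] by (auto simp: scalar_prod_def atLeast0LessThan intro!: sum.cong)
    then show ?thesis using A B by simp
  qed
  also have "\<dots> = (\<Sum>k\<le>m. gauss_binomial w m k * T (Suc k) (m - k) $$ (i, j)) +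
      (\<Sum>k\<le>m. w ^ k * gauss_binomial w m k * T k (Suc m - k) $$ (i, j))"
    unfolding AT BT sum.distrib[symmetric]
    using Suc.prems T by (intro sum.cong) (auto simp: algebra_simps Suc_diff_le index_smult_mat(1) carrier_matD[OF T])
  also have "(\<Sum>k\<le>m. w ^ k * gauss_binomial w m k * T k (Suc m - k) $$ (i, j))
      = (\<Sum>k\<le>Suc m. w ^ k * gauss_binomial w m k * T k (Suc m - k) $$ (i, j))"
    by (simp add: gauss_binomial_eq_0)
  also have "\<dots> = T 0 (Suc m) $$ (i, j) + (\<Sum>k\<le>m. w ^ Suc k * gauss_binomial w m (Suc k) * T (Suc k) (m - k) $$ (i, j))"
    by (subst sum.atMost_Suc_shift) simp
  also have "(\<Sum>k\<le>m. gauss_binomial w m k * T (Suc k) (m - k) $$ (i, j)) + (T 0 (Suc m) $$ (i, j) +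
      (\<Sum>k\<le>m. w ^ Suc k * gauss_binomial w m (Suc k) * T (Suc k) (m - k) $$ (i, j)))
      = T 0 (Suc m) $$ (i, j) + (\<Sum>k\<le>m. gauss_binomial w (Suc m) (Suc k) * T (Suc k) (m - k) $$ (i, j))"
    by (simp add: sum.distrib algebra_simps)
  also have "\<dots> = (\<Sum>k\<le>Suc m. gauss_binomial w (Suc m) k * T k (Suc m - k) $$ (i, j))"
    unfolding sum.atMost_Suc_shift[of _ m] by simp
  finally show ?case unfolding T_def .
qed

text \<open>
  At a primitive \<open>m\<close>-th root of unity only the two extreme terms of the binomial formula
  survive.  This is why \<open>\<Delta>(E)\<close> and \<open>\<Delta>(F)\<close> are again nilpotent of order \<open>p\<close>.
\<close>

lemma q_commuting_nilpotent_add: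
  fixes w :: "'a::idom"
  assumes A: "A \<in> carrier_mat n n" and B: "B \<in> carrier_mat n n" and AB: "B * A = w \<cdot>\<^sub>m (A * B)"
    and w: "w ^ m = 1" "\<And>k. 0 < k \<Longrightarrow> k < m \<Longrightarrow> w ^ k \<noteq> 1"
    and nil: "A ^\<^sub>m m = 0\<^sub>m n n" "B ^\<^sub>m m = 0\<^sub>m n n"
  shows "(A + B) ^\<^sub>m m = 0\<^sub>m n n"
proof (rule eq_matI)
  fix i j assume "i < dim_row (0\<^sub>m n n)" "j < dim_col (0\<^sub>m n n)"
  then have ij: "i < n" "j < n" by auto
  have "((A + B) ^\<^sub>m m) $$ (i, j)
    = (\<Sum>k\<le>m. gauss_binomial w m k * ((A ^\<^sub>m k) * (B ^\<^sub>m (m - k))) $$ (i, j))"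
    using q_binomial_entry[OF A B AB ij] .
  also have "\<dots> = 0"
  proof (rule sum.neutral, rule ballI)
    fix k assume "k \<in> {..m}"
    then consider "k = 0" | "k = m" | "0 < k" "k < m" by force
    then show "gauss_binomial w m k * ((A ^\<^sub>m k) * (B ^\<^sub>m (m - k))) $$ (i, j) = 0"
      using A B ij by cases (auto simp: nil gauss_binomial_root_of_unity[OF w(1)] w(2))
  qed
  finally show "((A + B) ^\<^sub>m m) $$ (i, j) = 0\<^sub>m n n $$ (i, j)" using ij by simp
qed (use A B in auto)

section \<open>The root of unity\<close>

lemma qroot_pow: "qroot p ^ k = cis (pi * k / p)"
  unfolding qroot_def exp_of_nat_mult[symmetric] cis_conv_exp
  by (simp add: field_simps)

lemma qroot_nonzero [simp]: "qroot p \<noteq> 0"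
  by (simp add: qroot_def)

lemma qroot_pow_p: "p > 0 \<Longrightarrow> qroot p ^ p = - 1"
  by (simp add: qroot_pow)

lemma qroot_pow_2p: "p > 0 \<Longrightarrow> qroot p ^ (2 * p) = 1"
  by (simp add: mult.commute[of 2] power_mult qroot_pow_p)

lemma qroot_square_pow_neq_1:
  assumes "0 < k" "k < p"
  shows "(qroot p ^ 2) ^ k \<noteq> 1"
proof
  assume "(qroot p ^ 2) ^ k = 1"
  then have "(qroot p ^ k) ^ 2 = 1"
    by (metis mult.commute power_mult)
  then have "Im (qroot p ^ k) = 0"
    by (auto simp: power2_eq_1_iff)
  moreover have "sin (pi * k / p) > 0"
    using assms by (intro sin_gt_zero) (auto simp: field_simps)
  ultimately show False by (simp add: qroot_pow)
qed

lemma qroot_minus_inverse_nonzero: "p \<ge> 2 \<Longrightarrow> qroot p - inverse (qroot p) \<noteq> 0"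
  using qroot_square_pow_neq_1[of 1 p] by (auto simp: field_simps power2_eq_square)

definition qint :: "nat \<Rightarrow> nat \<Rightarrow> complex" where
  "qint p k = (qroot p ^ k - inverse (qroot p) ^ k) / (qroot p - inverse (qroot p))"

lemma qint_0 [simp]: "qint p 0 = 0"
  by (simp add: qint_def)

lemma qint_nonzero:
  assumes "0 < k" "k < p"
  shows "qint p k \<noteq> 0"
proof -
  have "p \<ge> 2" using assms by simp
  have "qroot p ^ k \<noteq> inverse (qroot p) ^ k"
  proof
    assume "qroot p ^ k = inverse (qroot p) ^ k"
    then have "qroot p ^ k * qroot p ^ k = 1"
      by (simp add: field_simps)
    then show False
      using qroot_square_pow_neq_1[OF assms] by (simp add: power_mult_distrib power2_eq_square)
  qed
  with qroot_minus_inverse_nonzero[OF \<open>p \<ge> 2\<close>] show ?thesis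
    by (simp add: qint_def)
qed

lemma qint_p: "p > 0 \<Longrightarrow> qint p p = 0"
  by (simp add: qint_def qroot_pow_p power_inverse)

text \<open>
  Because of \<open>q\<^sup>p = -1\<close> the quantum integers satisfy \<open>[p - i] = [i]\<close>, so the usual coefficient
  \<open>[i] [p - i]\<close> of \<open>E\<close> on the \<open>i\<close>-th vector of a highest weight module of weight
  \<open>q\<^sup>p\<^sup>-\<^sup>1\<close> is the square \<open>[i]\<^sup>2\<close>.  The identity below is the recursion for these
  coefficients that the relation for \<open>[E, F]\<close> requires.
\<close>

lemma qint_square_diff:
  assumes "p \<ge> 2"
  shows "qint p (Suc i) ^ 2 - qint p i ^ 2
    = (qroot p ^ (p - 1) * inverse (qroot p ^ 2) ^ i - inverse (qroot p ^ (p - 1) * inverse (qroot p ^ 2) ^ i))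
        / (qroot p - inverse (qroot p))"
proof -
  define q where "q = qroot p"
  define s where "s = q - inverse q"
  have s: "s \<noteq> 0" using qroot_minus_inverse_nonzero[OF assms] by (simp add: s_def q_def)
  have q: "q \<noteq> 0" by (simp add: q_def)
  have qp: "q ^ (p - 1) = - inverse q"
  proof -
    have "q * q ^ (p - 1) = -1"
      using qroot_pow_p[of p] assms by (simp add: q_def power_eq_if)
    then show ?thesis using q by (simp add: field_simps)
  qed
  define x where "x = q ^ i"
  have x: "x \<noteq> 0" using q by (simp add: x_def)
  have "qint p (Suc i) ^ 2 - qint p i ^ 2 = ((q * x - inverse (q * x)) ^ 2 - (x - inverse x) ^ 2) / s ^ 2"
    unfolding qint_def q_def s_def x_def power_divide diff_divide_distrib[symmetric]
    by (simp add: power_inverse)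
  also have "(q * x - inverse (q * x)) ^ 2 - (x - inverse x) ^ 2
      = s * (q * x ^ 2 - inverse q * inverse x ^ 2)"
    using q x by (simp add: s_def field_simps power2_eq_square)
  also have "s * (q * x ^ 2 - inverse q * inverse x ^ 2) / s ^ 2 = (q * x ^ 2 - inverse q * inverse x ^ 2) / s"
    using s by (simp add: power2_eq_square)
  also have "q * x ^ 2 - inverse q * inverse x ^ 2
      = q ^ (p - 1) * inverse (q ^ 2) ^ i - inverse (q ^ (p - 1) * inverse (q ^ 2) ^ i)"
  proof -
    have "(q ^ 2) ^ i = x ^ 2" by (simp add: x_def power_mult[symmetric] mult.commute)
    then show ?thesis using q x unfolding qp by (simp add: power_inverse)
  qed
  finally show ?thesis by (simp add: q_def s_def)
qed

section \<open>Modules over the restricted quantum group\<close>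

lemma smult_smult_mat: "a \<cdot>\<^sub>m (b \<cdot>\<^sub>m A) = (a * b) \<cdot>\<^sub>m (A :: 'a::semigroup_mult mat)"
  by (intro eq_matI) (auto simp: mult.assoc)

lemma one_smult_mat: "1 \<cdot>\<^sub>m A = (A :: 'a::monoid_mult mat)"
  by (intro eq_matI) auto

lemma module_mat_pow: "A \<in> carrier_mat n n \<Longrightarrow> A [^]\<^bsub>module_mat TYPE(complex) n n\<^esub> (k::nat) = A ^\<^sub>m k"
  by (simp add: pow_mat_ring_pow[of _ n _ "()"] nat_pow_def module_mat_simps ring_mat_simps)

lemma module_mat_minus:
  assumes "A \<in> carrier_mat n n" "B \<in> carrier_mat n n"
  shows "A \<ominus>\<^bsub>module_mat TYPE(complex) n n\<^esub> B = A - B"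
proof -
  interpret abelian_group "module_mat TYPE(complex) n n" by (rule abelian_group_mat)
  have "- B \<oplus>\<^bsub>module_mat TYPE(complex) n n\<^esub> B = \<zero>\<^bsub>module_mat TYPE(complex) n n\<^esub>"
    using assms by (simp add: module_mat_simps uminus_l_inv_mat[of _ n n])
  then have "\<ominus>\<^bsub>module_mat TYPE(complex) n n\<^esub> B = - B"
    using assms by (intro minus_equality) (auto simp: module_mat_simps)
  then show ?thesis
    using assms by (simp add: a_minus_def module_mat_simps minus_add_uminus_mat[of _ n n])
qed

lemma minus_mat_eq_0_iff:
  assumes "A \<in> carrier_mat n m" "B \<in> carrier_mat n m"
  shows "A - B = 0\<^sub>m n m \<longleftrightarrow> A = (B :: complex mat)"
proof
  assume *: "A - B = 0\<^sub>m n m"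
  show "A = B"
  proof (rule eq_matI)
    fix i j assume "i < dim_row B" "j < dim_col B"
    then show "A $$ (i, j) = B $$ (i, j)"
      using arg_cong[OF *, of "\<lambda>M. M $$ (i, j)"] assms by auto
  qed (use assms in auto)
qed (use assms in auto)

lemma is_umod_iff:
  "is_umod p V \<longleftrightarrow>
    (\<forall>x. uact V x \<in> carrier_mat (udim V) (udim V)) \<and>
    uact V gE ^\<^sub>m p = 0\<^sub>m (udim V) (udim V) \<and>
    uact V gF ^\<^sub>m p = 0\<^sub>m (udim V) (udim V) \<and>
    uact V gK ^\<^sub>m (2 * p) = 1\<^sub>m (udim V) \<and>
    uact V gK * uact V gKinv = 1\<^sub>m (udim V) \<and>
    uact V gKinv * uact V gK = 1\<^sub>m (udim V) \<and>
    uact V gK * uact V gE * uact V gKinv = qroot p ^ 2 \<cdot>\<^sub>m uact V gE \<and>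
    uact V gK * uact V gF * uact V gKinv = inverse (qroot p ^ 2) \<cdot>\<^sub>m uact V gF \<and>
    uact V gE * uact V gF - uact V gF * uact V gE
      = inverse (qroot p - inverse (qroot p)) \<cdot>\<^sub>m (uact V gK - uact V gKinv)"
proof (cases "\<forall>x. uact V x \<in> carrier_mat (udim V) (udim V)")
  case True
  then have c: "uact V x \<in> carrier_mat (udim V) (udim V)" for x by blast
  note m = mult_carrier_mat[OF c c]
  have "relators p (module_mat TYPE(complex) (udim V) (udim V)) (uact V)
     = {uact V gE ^\<^sub>m p, uact V gF ^\<^sub>m p, uact V gK ^\<^sub>m (2 * p) - 1\<^sub>m (udim V),
        uact V gK * uact V gKinv - 1\<^sub>m (udim V), uact V gKinv * uact V gK - 1\<^sub>m (udim V),
        uact V gK * uact V gE * uact V gKinv - qroot p ^ 2 \<cdot>\<^sub>m uact V gE,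
        uact V gK * uact V gF * uact V gKinv - inverse (qroot p ^ 2) \<cdot>\<^sub>m uact V gF,
        (uact V gE * uact V gF - uact V gF * uact V gE)
        - inverse (qroot p - inverse (qroot p)) \<cdot>\<^sub>m (uact V gK - uact V gKinv)}"
    using c m mult_carrier_mat[OF m c] minus_carrier_mat[OF m] minus_carrier_mat[OF c]
    unfolding relators_def Let_def
    by (simp add: module_mat_simps module_mat_pow module_mat_minus)
  then show ?thesis
    unfolding is_umod_def using c m mult_carrier_mat[OF m c] minus_carrier_mat[OF m] minus_carrier_mat[OF c]
    by (simp add: minus_mat_eq_0_iff)
qed (auto simp: is_umod_def)

lemma is_umodD:
  assumes "is_umod p V"
  shows "uact V x \<in> carrier_mat (udim V) (udim V)"
    "uact V gE ^\<^sub>m p = 0\<^sub>m (udim V) (udim V)"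
    "uact V gF ^\<^sub>m p = 0\<^sub>m (udim V) (udim V)"
    "uact V gK ^\<^sub>m (2 * p) = 1\<^sub>m (udim V)"
    "uact V gK * uact V gKinv = 1\<^sub>m (udim V)"
    "uact V gKinv * uact V gK = 1\<^sub>m (udim V)"
    "uact V gK * uact V gE * uact V gKinv = qroot p ^ 2 \<cdot>\<^sub>m uact V gE"
    "uact V gK * uact V gF * uact V gKinv = inverse (qroot p ^ 2) \<cdot>\<^sub>m uact V gF"
    "uact V gE * uact V gF - uact V gF * uact V gE
      = inverse (qroot p - inverse (qroot p)) \<cdot>\<^sub>m (uact V gK - uact V gKinv)"
  using assms unfolding is_umod_iff by blast+

lemma is_umod_K_commute:
  assumes V: "is_umod p V"
  shows "uact V gK * uact V gE = qroot p ^ 2 \<cdot>\<^sub>m (uact V gE * uact V gK)"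
    "uact V gK * uact V gF = inverse (qroot p ^ 2) \<cdot>\<^sub>m (uact V gF * uact V gK)"
    "uact V gE * uact V gKinv = qroot p ^ 2 \<cdot>\<^sub>m (uact V gKinv * uact V gE)"
    "uact V gF * uact V gKinv = inverse (qroot p ^ 2) \<cdot>\<^sub>m (uact V gKinv * uact V gF)"
proof -
  define n where "n = udim V"
  note c = is_umodD(1)[OF V, folded n_def] and r = is_umodD[OF V, folded n_def]
  note sq = mult_carrier_mat[of _ n n _ n] assoc_mult_mat[of _ n n _ n _ n]
    mult_smult_assoc_mat[of _ n n _ n] mult_smult_distrib[of _ n n _ n]
  have main: "uact V gK * X = w \<cdot>\<^sub>m (X * uact V gK)" "X * uact V gKinv = w \<cdot>\<^sub>m (uact V gKinv * X)"
    if X: "X \<in> carrier_mat n n" and e: "uact V gK * X * uact V gKinv = w \<cdot>\<^sub>m X" for X w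
  proof -
    have "uact V gK * X = (uact V gK * X * uact V gKinv) * uact V gK"
      using X c r(6) by (simp add: sq)
    then show "uact V gK * X = w \<cdot>\<^sub>m (X * uact V gK)"
      unfolding e using X c by (simp add: sq)
    have "X * uact V gKinv = (uact V gKinv * uact V gK) * (X * uact V gKinv)"
      using X c unfolding r(6) by (simp add: sq)
    also have "\<dots> = uact V gKinv * (uact V gK * X * uact V gKinv)"
      using X c by (simp add: sq)
    finally show "X * uact V gKinv = w \<cdot>\<^sub>m (uact V gKinv * X)"
      unfolding e using X c by (simp add: sq)
  qed
  show "uact V gK * uact V gE = qroot p ^ 2 \<cdot>\<^sub>m (uact V gE * uact V gK)"
    "uact V gK * uact V gF = inverse (qroot p ^ 2) \<cdot>\<^sub>m (uact V gF * uact V gK)"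
    "uact V gE * uact V gKinv = qroot p ^ 2 \<cdot>\<^sub>m (uact V gKinv * uact V gE)"
    "uact V gF * uact V gKinv = inverse (qroot p ^ 2) \<cdot>\<^sub>m (uact V gKinv * uact V gF)"
    by (rule main[OF c]; simp add: r)+
qed

lemma uhomD:
  assumes "f \<in> uhom V W"
  shows "f \<in> carrier_mat (udim W) (udim V)" "f * uact V x = uact W x * f"
  using assms by (auto simp: uhom_def)

lemma uhomI:
  assumes "f \<in> carrier_mat (udim W) (udim V)" "\<And>x. f * uact V x = uact W x * f"
  shows "f \<in> uhom V W"
  using assms by (auto simp: uhom_def)

lemma uhom_comp:
  assumes c: "\<And>x. uact U x \<in> carrier_mat (udim U) (udim U)"
    "\<And>x. uact V x \<in> carrier_mat (udim V) (udim V)"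
    "\<And>x. uact W x \<in> carrier_mat (udim W) (udim W)"
    and f: "f \<in> uhom U V" and g: "g \<in> uhom V W"
  shows "g * f \<in> uhom U W"
proof (rule uhomI)
  note F = uhomD[OF f] and G = uhomD[OF g]
  show "g * f \<in> carrier_mat (udim W) (udim U)" using F(1) G(1) by simp
  fix x
  have "g * f * uact U x = g * (uact V x * f)"
    using F G(1) c(1) by (simp add: assoc_mult_mat[of g "udim W" "udim V" f "udim U" _ "udim U"])
  also have "\<dots> = (g * uact V x) * f"
    using F(1) G(1) c(2) by (simp add: assoc_mult_mat[of g "udim W" "udim V" _ "udim V" f "udim U"])
  also have "\<dots> = uact W x * (g * f)"
    unfolding G(2) using F(1) G(1) c(3)
    by (simp add: assoc_mult_mat[of _ "udim W" "udim W" g "udim V" f "udim U"])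
  finally show "g * f * uact U x = uact W x * (g * f)" .
qed

lemma one_uhom: "(\<And>x. uact V x \<in> carrier_mat (udim V) (udim V)) \<Longrightarrow> 1\<^sub>m (udim V) \<in> uend V"
  by (auto simp: uhom_def left_mult_one_mat[of _ "udim V" "udim V"] right_mult_one_mat[of _ "udim V" "udim V"])

section \<open>Tensor products and duals of modules\<close>

lemma utensor_dim [simp]: "udim (utensor V W) = udim V * udim W"
  by (simp add: utensor_def)

lemma utensor_act:
  "uact (utensor V W) gE = kron (1\<^sub>m (udim V)) (uact W gE) + kron (uact V gE) (uact W gK)"
  "uact (utensor V W) gF = kron (uact V gKinv) (uact W gF) + kron (uact V gF) (1\<^sub>m (udim W))"
  "uact (utensor V W) gK = kron (uact V gK) (uact W gK)"
  "uact (utensor V W) gKinv = kron (uact V gKinv) (uact W gKinv)"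
  by (simp_all add: utensor_def)

lemma utensor_carrier:
  assumes "\<And>x. uact V x \<in> carrier_mat (udim V) (udim V)" "\<And>x. uact W x \<in> carrier_mat (udim W) (udim W)"
  shows "uact (utensor V W) x \<in> carrier_mat (udim V * udim W) (udim V * udim W)"
  using assms by (cases x) (auto simp: utensor_act)

lemma uhom_kron:
  assumes c: "\<And>x. uact V x \<in> carrier_mat (udim V) (udim V)" "\<And>x. uact W x \<in> carrier_mat (udim W) (udim W)"
    "\<And>x. uact V' x \<in> carrier_mat (udim V') (udim V')" "\<And>x. uact W' x \<in> carrier_mat (udim W') (udim W')"
    and f: "f \<in> uhom V V'" and g: "g \<in> uhom W W'"
  shows "kron f g \<in> uhom (utensor V W) (utensor V' W')"
proof (rule uhomI)
  define n m n' m' where d: "n = udim V" "m = udim W" "n' = udim V'" "m' = udim W'"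
  note F = uhomD[OF f, folded d] and G = uhomD[OF g, folded d]
  note cc = c[folded d]
  show "kron f g \<in> carrier_mat (udim (utensor V' W')) (udim (utensor V W))"
    using F(1) G(1) by (auto simp: d[symmetric])
  fix x
  have k1: "kron f g * kron A B = kron (f * A) (g * B)" if "A \<in> carrier_mat n n" "B \<in> carrier_mat m m" for A B
    using kron_mult[OF F(1) that(1) G(1) that(2)] .
  have k2: "kron A B * kron f g = kron (A * f) (B * g)" if "A \<in> carrier_mat n' n'" "B \<in> carrier_mat m' m'" for A B
    using kron_mult[OF that(1) F(1) that(2) G(1)] .
  show "kron f g * uact (utensor V W) x = uact (utensor V' W') x * kron f g"
    using F G cc mult_carrier_mat[OF F(1) cc(1)] mult_carrier_mat[OF G(1) cc(2)]
    by (cases x) (simp_all add: utensor_act d[symmetric] k1 k2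
      mult_add_distrib_mat[of _ "n' * m'" "n * m" _ "n * m"] add_mult_distrib_mat[of _ "n' * m'" "n' * m'" _ _ "n * m"])
qed

lemma utensor_assoc:
  assumes "\<And>x. uact U x \<in> carrier_mat (udim U) (udim U)" "\<And>x. uact V x \<in> carrier_mat (udim V) (udim V)"
    "\<And>x. uact W x \<in> carrier_mat (udim W) (udim W)"
  shows "utensor (utensor U V) W = utensor U (utensor V W)"
proof -
  define l m n where d: "l = udim U" "m = udim V" "n = udim W"
  have "uact (utensor (utensor U V) W) x = uact (utensor U (utensor V W)) x" for x
    using assms[folded d]
    by (cases x) (simp_all add: utensor_act d[symmetric] kron_assoc kron_one[symmetric]
      kron_add_left[of _ "l * m" "l * m" _ _ n n] kron_add_right[of _ l l _ "m * n" "m * n"]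
      assoc_add_mat[of _ "l * (m * n)" "l * (m * n)"])
  then have "uact (utensor (utensor U V) W) = uact (utensor U (utensor V W))" ..
  then show ?thesis by (simp add: mult.assoc)
qed

text \<open>
  The two summands of \<open>\<Delta>(E)\<close> commute up to \<open>q\<^sup>2\<close>, and so do those of
  \<open>\<Delta>(F)\<close>, which gives nilpotency.  In the commutator of \<open>\<Delta>(E)\<close> and
  \<open>\<Delta>(F)\<close> the mixed terms cancel, and the others form a telescoping sum.
\<close>

lemma is_umod_utensor:
  assumes p: "p \<ge> 2" and V: "is_umod p V" and W: "is_umod p W"
  shows "is_umod p (utensor V W)"
proof -
  define n m where d: "n = udim V" "m = udim W"
  define q where "q = qroot p"
  define e f k l where v: "e = uact V gE" "f = uact V gF" "k = uact V gK" "l = uact V gKinv"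
  define E F K L where w: "E = uact W gE" "F = uact W gF" "K = uact W gK" "L = uact W gKinv"
  note rV = is_umodD[OF V, folded d v q_def] and rW = is_umodD[OF W, folded d w q_def]
  note kV = is_umod_K_commute[OF V, folded v q_def] and kW = is_umod_K_commute[OF W, folded w q_def]
  have cV: "e \<in> carrier_mat n n" "f \<in> carrier_mat n n" "k \<in> carrier_mat n n" "l \<in> carrier_mat n n"
    unfolding v using rV(1) by blast+
  have cW: "E \<in> carrier_mat m m" "F \<in> carrier_mat m m" "K \<in> carrier_mat m m" "L \<in> carrier_mat m m"
    unfolding w using rW(1) by blast+
  note c = cV cW
  have q: "q \<noteq> 0" by (simp add: q_def)
  have q2p: "(q ^ 2) ^ p = 1"
    using qroot_pow_2p[of p] p by (simp add: q_def power_mult)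
  have root: "(q ^ 2) ^ j \<noteq> 1" if "0 < j" "j < p" for j
    unfolding q_def using qroot_square_pow_neq_1[OF that] .
  note km = kron_mult[of _ n n _ n _ m m _ m]
  note sqn = mult_carrier_mat[of _ n n _ n] left_mult_one_mat[of _ n n] right_mult_one_mat[of _ n n]
  note sqm = mult_carrier_mat[of _ m m _ m] left_mult_one_mat[of _ m m] right_mult_one_mat[of _ m m]
  note kc = kron_carrier[of _ n n _ m m]
  note dist = add_mult_distrib_mat[of _ "n * m" "n * m" _ _ "n * m"] mult_add_distrib_mat[of _ "n * m" "n * m" _ "n * m"]
  show ?thesis
    unfolding is_umod_iff utensor_act utensor_dim d[symmetric] v[symmetric] w[symmetric] q_def[symmetric]
  proof (intro conjI allI)
    show "uact (utensor V W) x \<in> carrier_mat (n * m) (n * m)" for x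
      using utensor_carrier[of V W x] rV(1) rW(1) by (simp add: d)
    show "(kron (1\<^sub>m n) E + kron e K) ^\<^sub>m p = 0\<^sub>m (n * m) (n * m)"
    proof (rule q_commuting_nilpotent_add[of _ "n * m" _ "q ^ 2"])
      show "kron e K * kron (1\<^sub>m n) E = q ^ 2 \<cdot>\<^sub>m (kron (1\<^sub>m n) E * kron e K)"
        using c by (simp add: km sqn sqm kW kron_smult_right)
      show "kron (1\<^sub>m n) E ^\<^sub>m p = 0\<^sub>m (n * m) (n * m)" "kron e K ^\<^sub>m p = 0\<^sub>m (n * m) (n * m)"
        using c by (simp_all add: kron_pow[of _ n _ m] rV rW kron_zero_left kron_zero_right)
    qed (use c q2p root in auto)
    show "(kron l F + kron f (1\<^sub>m m)) ^\<^sub>m p = 0\<^sub>m (n * m) (n * m)"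
    proof (rule q_commuting_nilpotent_add[of _ "n * m" _ "inverse (q ^ 2)"])
      show "kron f (1\<^sub>m m) * kron l F = inverse (q ^ 2) \<cdot>\<^sub>m (kron l F * kron f (1\<^sub>m m))"
        using c by (simp add: km sqn sqm kV kron_smult_left)
      show "kron l F ^\<^sub>m p = 0\<^sub>m (n * m) (n * m)" "kron f (1\<^sub>m m) ^\<^sub>m p = 0\<^sub>m (n * m) (n * m)"
        using c by (simp_all add: kron_pow[of _ n _ m] rV rW kron_zero_left kron_zero_right)
    qed (use c q2p root in \<open>auto simp: power_inverse\<close>)
    show "kron k K ^\<^sub>m (2 * p) = 1\<^sub>m (n * m)"
      using c by (simp add: kron_pow[of _ n _ m] rV rW kron_one)
    show "kron k K * kron l L = 1\<^sub>m (n * m)" "kron l L * kron k K = 1\<^sub>m (n * m)"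
      using c by (simp_all add: km rV rW kron_one)
    show "kron k K * (kron (1\<^sub>m n) E + kron e K) * kron l L = q ^ 2 \<cdot>\<^sub>m (kron (1\<^sub>m n) E + kron e K)"
    proof -
      have "K * K * L = K"
        using c by (simp add: assoc_mult_mat[of K m m K m L m] rW sqm)
      then show ?thesis
        using c by (simp add: dist km sqn sqm kc rV rW kron_smult_left kron_smult_right
            add_smult_distrib_left_mat[of _ "n * m" "n * m"])
    qed
    show "kron k K * (kron l F + kron f (1\<^sub>m m)) * kron l L = inverse (q ^ 2) \<cdot>\<^sub>m (kron l F + kron f (1\<^sub>m m))"
      using c by (simp add: dist km sqn sqm kc rV rW kron_smult_left kron_smult_right
            add_smult_distrib_left_mat[of _ "n * m" "n * m"])
    show "(kron (1\<^sub>m n) E + kron e K) * (kron l F + kron f (1\<^sub>m m))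
        - (kron l F + kron f (1\<^sub>m m)) * (kron (1\<^sub>m n) E + kron e K)
        = inverse (q - inverse q) \<cdot>\<^sub>m (kron k K - kron l L)"
    proof -
      define s where "s = inverse (q - inverse q)"
      have FK: "F * K = q ^ 2 \<cdot>\<^sub>m (K * F)"
        using kW(2) q by (simp add: smult_smult_mat one_smult_mat)
      have cross: "kron (e * l) (K * F) = kron (l * e) (F * K)"
        unfolding FK kV kron_smult_left kron_smult_right ..
      have eq1: "(kron (1\<^sub>m n) E + kron e K) * (kron l F + kron f (1\<^sub>m m))
        = (kron l (E * F) + kron (e * l) (K * F)) + (kron f E + kron (e * f) K)"
        using c by (simp add: dist km sqn sqm kc)
      have eq2: "(kron l F + kron f (1\<^sub>m m)) * (kron (1\<^sub>m n) E + kron e K)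
        = (kron l (F * E) + kron f E) + (kron (e * l) (K * F) + kron (f * e) K)"
        using c by (simp add: dist km sqn sqm kc cross)
      have ent: "(X * Y) $$ (a, b) - (Y * X) $$ (a, b) = s * (Z $$ (a, b) - Z' $$ (a, b))"
        if "X * Y - Y * X = s \<cdot>\<^sub>m (Z - Z')" "X \<in> carrier_mat r r" "Y \<in> carrier_mat r r"
          "Z \<in> carrier_mat r r" "Z' \<in> carrier_mat r r" "a < r" "b < r" for X Y Z Z' r a b
        using arg_cong[OF that(1), of "\<lambda>M. M $$ (a, b)"] that(2-) by simp
      show ?thesis
        unfolding s_def[symmetric] eq1 eq2
      proof (rule eq_matI)
        fix i j assume "i < dim_row (s \<cdot>\<^sub>m (kron k K - kron l L))" "j < dim_col (s \<cdot>\<^sub>m (kron k K - kron l L))"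
        then have ij: "i < n * m" "j < n * m" using c by auto
        note b = div_index_less[OF ij(1)] div_index_less[OF ij(2)] mod_index_less[OF ij(1)] mod_index_less[OF ij(2)]
        have 1: "(e * f) $$ (i div m, j div m) = (f * e) $$ (i div m, j div m) + s * (k $$ (i div m, j div m) - l $$ (i div m, j div m))"
          using ent[OF rV(9)[folded s_def], of n "i div m" "j div m"] c b by (simp add: algebra_simps)
        have 2: "(E * F) $$ (i mod m, j mod m) = (F * E) $$ (i mod m, j mod m) + s * (K $$ (i mod m, j mod m) - L $$ (i mod m, j mod m))"
          using ent[OF rW(9)[folded s_def], of m "i mod m" "j mod m"] c b by (simp add: algebra_simps)
        have cm: "l \<in> carrier_mat n n" "e * l \<in> carrier_mat n n" "f * e \<in> carrier_mat n n" "e * f \<in> carrier_mat n n"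
          "E * F \<in> carrier_mat m m" "F * E \<in> carrier_mat m m" "K * F \<in> carrier_mat m m"
          using c by auto
        have ki: "kron X Y $$ (i, j) = X $$ (i div m, j div m) * Y $$ (i mod m, j mod m)"
          if "X \<in> carrier_mat n n" "Y \<in> carrier_mat m m" for X Y
          using that ij by (simp add: kron_index)
        have ad: "(X + Y) $$ (i, j) = X $$ (i, j) + Y $$ (i, j)" if "Y \<in> carrier_mat (n * m) (n * m)" for X Y :: "complex mat"
          using that ij by simp
        show "(kron l (E * F) + kron (e * l) (K * F) + (kron f E + kron (e * f) K) -
           (kron l (F * E) + kron f E + (kron (e * l) (K * F) + kron (f * e) K))) $$ (i, j)
          = (s \<cdot>\<^sub>m (kron k K - kron l L)) $$ (i, j)"
        proof -
          have "kron l (E * F) $$ (i, j) = kron l (F * E) $$ (i, j)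
              + s * (l $$ (i div m, j div m) * K $$ (i mod m, j mod m) - kron l L $$ (i, j))"
            unfolding ki[OF c(4) cm(5)] ki[OF c(4) cm(6)] ki[OF c(4) c(8)] 2 by (simp add: algebra_simps)
          moreover have "kron (e * f) K $$ (i, j) = kron (f * e) K $$ (i, j)
              + s * (kron k K $$ (i, j) - l $$ (i div m, j div m) * K $$ (i mod m, j mod m))"
            unfolding ki[OF cm(4) c(7)] ki[OF cm(3) c(7)] ki[OF c(3) c(7)] 1 by (simp add: algebra_simps)
          ultimately show ?thesis
            using c ij by (simp add: ad kc) (simp add: algebra_simps)
        qed
      qed (use c in auto)
    qed
  qed
qed

lemma transpose_smult_mat: "(a \<cdot>\<^sub>m A)\<^sup>T = a \<cdot>\<^sub>m A\<^sup>T"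
  by (intro eq_matI) auto

text \<open>
  An element \<open>x\<close> acts on the dual by the transpose of \<open>S(x)\<close>, where
  \<open>S(E) = -E K\<^sup>-\<^sup>1\<close>, \<open>S(F) = -K F\<close> and \<open>S(K) = K\<^sup>-\<^sup>1\<close>.
\<close>

definition udual :: "umod \<Rightarrow> umod" where
  "udual V = \<lparr>udim = udim V, uact = (\<lambda>x. case x of
      gE \<Rightarrow> (-1) \<cdot>\<^sub>m (uact V gE * uact V gKinv)\<^sup>T
    | gF \<Rightarrow> (-1) \<cdot>\<^sub>m (uact V gK * uact V gF)\<^sup>T
    | gK \<Rightarrow> (uact V gKinv)\<^sup>T
    | gKinv \<Rightarrow> (uact V gK)\<^sup>T)\<rparr>"

lemma udual_dim [simp]: "udim (udual V) = udim V"
  by (simp add: udual_def)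

lemma udual_act:
  "uact (udual V) gE = (-1) \<cdot>\<^sub>m (uact V gE * uact V gKinv)\<^sup>T"
  "uact (udual V) gF = (-1) \<cdot>\<^sub>m (uact V gK * uact V gF)\<^sup>T"
  "uact (udual V) gK = (uact V gKinv)\<^sup>T"
  "uact (udual V) gKinv = (uact V gK)\<^sup>T"
  by (simp_all add: udual_def)

lemma mat_pow_transpose:
  assumes "A \<in> carrier_mat n n"
  shows "A\<^sup>T ^\<^sub>m k = (A ^\<^sub>m k :: complex mat)\<^sup>T"
proof (induction k)
  case (Suc k)
  show ?case
    unfolding pow_mat_Suc_left[OF assms, of k]
    using Suc assms by (simp add: transpose_mult[of A n n _ n])
qed (use assms in simp)

lemma mat_pow_smult:
  assumes "A \<in> carrier_mat n n"
  shows "(c \<cdot>\<^sub>m A) ^\<^sub>m k = (c ^ k) \<cdot>\<^sub>m (A ^\<^sub>m k :: complex mat)"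
proof (induction k)
  case (Suc k)
  then show ?case using assms
    by (simp add: mult_smult_assoc_mat[of _ n n _ n] mult_smult_distrib[of _ n n _ n] smult_smult_mat mult.commute)
qed (use assms in \<open>simp add: one_smult_mat\<close>)

text \<open>
  The scalar \<open>c\<close> is a power of \<open>w\<close>; the lemma serves to carry the nilpotency of
  \<open>E\<close> and \<open>F\<close> over to \<open>S(E)\<close> and \<open>S(F)\<close>.
\<close>

lemma q_commuting_pow_mult:
  assumes A: "A \<in> carrier_mat n n" and B: "B \<in> carrier_mat n n" and AB: "B * A = w \<cdot>\<^sub>m (A * B :: complex mat)"
  shows "\<exists>c. (A * B) ^\<^sub>m k = c \<cdot>\<^sub>m (A ^\<^sub>m k * B ^\<^sub>m k)"
proof (induction k)
  case 0
  show ?case using A B by (intro exI[of _ 1]) (simp add: one_smult_mat)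
next
  case (Suc k)
  then obtain c where c: "(A * B) ^\<^sub>m k = c \<cdot>\<^sub>m (A ^\<^sub>m k * B ^\<^sub>m k)" by blast
  have P: "A ^\<^sub>m k \<in> carrier_mat n n" "B ^\<^sub>m k \<in> carrier_mat n n" using A B by auto
  note sq = mult_carrier_mat[of _ n n _ n] mult_smult_assoc_mat[of _ n n _ n] mult_smult_distrib[of _ n n _ n]
  note as = assoc_mult_mat[of _ n n _ n _ n]
  have "(A * B) ^\<^sub>m Suc k = A * B * (c \<cdot>\<^sub>m (A ^\<^sub>m k * B ^\<^sub>m k))"
    unfolding pow_mat_Suc_left[OF mult_carrier_mat[OF A B]] c ..
  also have "\<dots> = c \<cdot>\<^sub>m (A * ((B * A ^\<^sub>m k) * B ^\<^sub>m k))"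
    using A B P by (simp add: sq as)
  also have "\<dots> = (c * w ^ k) \<cdot>\<^sub>m (A * (A ^\<^sub>m k * (B * B ^\<^sub>m k)))"
    unfolding q_commute_pow[OF A B AB] using A B P by (simp add: sq as smult_smult_mat)
  also have "A * (A ^\<^sub>m k * (B * B ^\<^sub>m k)) = (A * A ^\<^sub>m k) * (B * B ^\<^sub>m k)"
    using A B P by (simp add: sq as)
  finally show ?case unfolding pow_mat_Suc_left[OF A] pow_mat_Suc_left[OF B] by blast
qed

lemma udual_carrier:
  assumes "\<And>x. uact V x \<in> carrier_mat (udim V) (udim V)"
  shows "uact (udual V) x \<in> carrier_mat (udim V) (udim V)"
  using assms mult_carrier_mat[OF assms assms] by (cases x) (simp_all add: udual_act)

lemma is_umod_udual:
  assumes V: "is_umod p V"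
  shows "is_umod p (udual V)"
proof -
  define n where d: "n = udim V"
  define q where "q = qroot p"
  define E F K L where w: "E = uact V gE" "F = uact V gF" "K = uact V gK" "L = uact V gKinv"
  note r = is_umodD[OF V, folded d w q_def]
  note k = is_umod_K_commute[OF V, folded w q_def]
  have c: "E \<in> carrier_mat n n" "F \<in> carrier_mat n n" "K \<in> carrier_mat n n" "L \<in> carrier_mat n n"
    unfolding w using r(1) by blast+
  have q: "q \<noteq> 0" by (simp add: q_def)
  note sq = mult_carrier_mat[of _ n n _ n] left_mult_one_mat[of _ n n] right_mult_one_mat[of _ n n]
    mult_smult_assoc_mat[of _ n n _ n] mult_smult_distrib[of _ n n _ n]
  note as = assoc_mult_mat[of _ n n _ n _ n]
  note tr = transpose_mult[of _ n n _ n, symmetric]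
  have LK: "L * (K * X) = X" "K * (L * X) = X" if "X \<in> carrier_mat n n" for X
    using that c r(5,6) by (simp_all add: as[symmetric] sq)
  have LE: "L * E = inverse (q ^ 2) \<cdot>\<^sub>m (E * L)" and FK: "F * K = q ^ 2 \<cdot>\<^sub>m (K * F)"
    using k(2,3) q by (simp_all add: smult_smult_mat one_smult_mat)
  have KFL: "K * (F * L) = inverse (q ^ 2) \<cdot>\<^sub>m F"
    using r(8) c by (simp add: as)
  have KEL: "K * (E * L) = q ^ 2 \<cdot>\<^sub>m E"
    using r(7) c by (simp add: as)
  show ?thesis
    unfolding is_umod_iff udual_act udual_dim d[symmetric] w[symmetric] q_def[symmetric]
  proof (intro conjI allI)
    show "uact (udual V) x \<in> carrier_mat n n" for x
      using udual_carrier[of V x] r(1) by (simp add: d)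
    obtain a where "(E * L) ^\<^sub>m p = a \<cdot>\<^sub>m (E ^\<^sub>m p * L ^\<^sub>m p)"
      using q_commuting_pow_mult[OF c(1,4) LE] by blast
    then show "((-1) \<cdot>\<^sub>m (E * L)\<^sup>T) ^\<^sub>m p = 0\<^sub>m n n"
      using c by (simp add: mat_pow_smult[of _ n] mat_pow_transpose[of _ n] r(2) left_mult_zero_mat[of _ n n])
    obtain b where "(K * F) ^\<^sub>m p = b \<cdot>\<^sub>m (K ^\<^sub>m p * F ^\<^sub>m p)"
      using q_commuting_pow_mult[OF c(3,2) FK] by blast
    then show "((-1) \<cdot>\<^sub>m (K * F)\<^sup>T) ^\<^sub>m p = 0\<^sub>m n n"
      using c by (simp add: mat_pow_smult[of _ n] mat_pow_transpose[of _ n] r(3) right_mult_zero_mat[of _ n n])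
    have "L ^\<^sub>m (2 * p) = 1\<^sub>m n"
    proof -
      have "K * L = 1 \<cdot>\<^sub>m (L * K)" using r(5,6) by (simp add: one_smult_mat)
      from q_commute_pow[OF c(4,3) this]
      have KLk: "K * L ^\<^sub>m j = L ^\<^sub>m j * K" for j by (simp add: one_smult_mat)
      have "L ^\<^sub>m j * K ^\<^sub>m j = 1\<^sub>m n" for j
      proof (induction j)
        case (Suc j)
        have P: "L ^\<^sub>m j \<in> carrier_mat n n" "K ^\<^sub>m j \<in> carrier_mat n n" using c by auto
        have "L ^\<^sub>m Suc j * K ^\<^sub>m Suc j = L * (L ^\<^sub>m j * K ^\<^sub>m j) * K"
          unfolding pow_mat_Suc_left[OF c(4)] using c P by (simp add: as sq)
        then show ?case using c r(6) unfolding Suc by (simp add: sq)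
      qed (use c in simp)
      from this[of "2 * p"] show ?thesis using c r(4) by (simp add: sq del: pow_mat.simps)
    qed
    then show "L\<^sup>T ^\<^sub>m (2 * p) = 1\<^sub>m n"
      using c by (simp add: mat_pow_transpose[of _ n])
    show "L\<^sup>T * K\<^sup>T = 1\<^sub>m n" "K\<^sup>T * L\<^sup>T = 1\<^sub>m n"
      using c by (simp_all add: tr r)
    show "L\<^sup>T * ((-1) \<cdot>\<^sub>m (E * L)\<^sup>T) * K\<^sup>T = q ^ 2 \<cdot>\<^sub>m ((-1) \<cdot>\<^sub>m (E * L)\<^sup>T)"
    proof -
      have "L\<^sup>T * ((-1) \<cdot>\<^sub>m (E * L)\<^sup>T) * K\<^sup>T = (-1) \<cdot>\<^sub>m (K * (E * L) * L)\<^sup>T"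
        using c by (simp add: sq tr as)
      then show ?thesis
        unfolding KEL using c by (simp add: sq transpose_smult_mat smult_smult_mat)
    qed
    show "L\<^sup>T * ((-1) \<cdot>\<^sub>m (K * F)\<^sup>T) * K\<^sup>T = inverse (q ^ 2) \<cdot>\<^sub>m ((-1) \<cdot>\<^sub>m (K * F)\<^sup>T)"
    proof -
      have "L\<^sup>T * ((-1) \<cdot>\<^sub>m (K * F)\<^sup>T) * K\<^sup>T = (-1) \<cdot>\<^sub>m (K * (K * (F * L)))\<^sup>T"
        using c by (simp add: sq tr as)
      then show ?thesis
        unfolding KFL using c by (simp add: sq transpose_smult_mat smult_smult_mat)
    qed
    show "(-1) \<cdot>\<^sub>m (E * L)\<^sup>T * ((-1) \<cdot>\<^sub>m (K * F)\<^sup>T) - (-1) \<cdot>\<^sub>m (K * F)\<^sup>T * ((-1) \<cdot>\<^sub>m (E * L)\<^sup>T)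
      = inverse (q - inverse q) \<cdot>\<^sub>m (L\<^sup>T - K\<^sup>T)"
    proof -
      have KFEL: "K * F * (E * L) = F * E"
      proof -
        have "K * F * (E * L) = (inverse (q ^ 2) \<cdot>\<^sub>m (F * K)) * (E * L)"
          unfolding k(2) ..
        also have "\<dots> = inverse (q ^ 2) \<cdot>\<^sub>m (F * (K * (E * L)))"
          using c by (simp add: sq as)
        finally show ?thesis using c q by (simp add: KEL sq smult_smult_mat one_smult_mat)
      qed
      have ELKF: "E * L * (K * F) = E * F"
        using c by (simp add: as sq LK)
      have "(-1) \<cdot>\<^sub>m (E * L)\<^sup>T * ((-1) \<cdot>\<^sub>m (K * F)\<^sup>T) - (-1) \<cdot>\<^sub>m (K * F)\<^sup>T * ((-1) \<cdot>\<^sub>m (E * L)\<^sup>T)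
        = (F * E)\<^sup>T - (E * F)\<^sup>T"
        using c by (simp add: sq tr smult_smult_mat one_smult_mat KFEL ELKF)
      also have "\<dots> = (-1) \<cdot>\<^sub>m (E * F - F * E)\<^sup>T"
        using c by (intro eq_matI) (auto simp del: index_mult_mat(1))
      also have "\<dots> = inverse (q - inverse q) \<cdot>\<^sub>m (L\<^sup>T - K\<^sup>T)"
        unfolding r(9) using c by (intro eq_matI) (auto simp: algebra_simps)
      finally show ?thesis .
    qed
  qed
qed

lemma inverse_pow_mat:
  assumes "A \<in> carrier_mat n n" "B \<in> carrier_mat n n" "A * B = 1\<^sub>m n"
  shows "A ^\<^sub>m k * B ^\<^sub>m k = 1\<^sub>m n"
proof (induction k)
  case (Suc k)
  have P: "A ^\<^sub>m k \<in> carrier_mat n n" "B ^\<^sub>m k \<in> carrier_mat n n" using assms by auto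
  have "A ^\<^sub>m Suc k * B ^\<^sub>m Suc k = A ^\<^sub>m k * (A * B) * B ^\<^sub>m k"
    unfolding pow_mat_Suc_left[OF assms(2)] using assms(1,2) P
    by (simp add: assoc_mult_mat[of _ n n _ n _ n] mult_carrier_mat[of _ n n _ n])
  then show ?case using assms(3) P Suc by (simp add: right_mult_one_mat[of _ n n])
qed (use assms in simp)

section \<open>Evaluation, coevaluation and partial traces\<close>

definition utriv :: umod where
  "utriv = \<lparr>udim = 1, uact = (\<lambda>x. case x of gE \<Rightarrow> 0\<^sub>m 1 1 | gF \<Rightarrow> 0\<^sub>m 1 1 | gK \<Rightarrow> 1\<^sub>m 1 | gKinv \<Rightarrow> 1\<^sub>m 1)\<rparr>"

lemma utriv_simps [simp]: "udim utriv = 1" "uact utriv gE = 0\<^sub>m 1 1" "uact utriv gF = 0\<^sub>m 1 1"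
  "uact utriv gK = 1\<^sub>m 1" "uact utriv gKinv = 1\<^sub>m 1"
  by (simp_all add: utriv_def)

lemma utriv_carrier: "uact utriv x \<in> carrier_mat (udim utriv) (udim utriv)"
  by (cases x) auto

lemma utensor_utriv:
  assumes c: "\<And>x. uact V x \<in> carrier_mat (udim V) (udim V)"
  shows "utensor V utriv = V" "utensor utriv V = V"
proof -
  have "uact (utensor V utriv) x = uact V x" "uact (utensor utriv V) x = uact V x" for x
    using c carrier_matD[OF c] right_add_zero_mat[OF c] left_add_zero_mat[OF c]
    by (cases x; simp add: utensor_act kron_one_left[simplified] kron_one_right[simplified]
        kron_zero_left[of "Suc 0" "Suc 0", simplified] kron_zero_right[of _ "Suc 0" "Suc 0", simplified])+
  then have "uact (utensor V utriv) = uact V" "uact (utensor utriv V) = uact V" by blast+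
  then show "utensor V utriv = V" "utensor utriv V = V" by simp_all
qed

text \<open>
  The vector \<open>\<Sum> A\<^sub>i\<^sub>j v\<^sub>i \<otimes> w\<^sub>j\<close>, written as a matrix with one column because homomorphisms
  from the trivial module have this shape.
\<close>

definition vec_of_mat :: "complex mat \<Rightarrow> complex mat" where
  "vec_of_mat A = mat (dim_row A * dim_col A) 1 (\<lambda>(i, _). A $$ (i div dim_col A, i mod dim_col A))"

lemma vec_of_mat_carrier [intro]: "A \<in> carrier_mat n m \<Longrightarrow> vec_of_mat A \<in> carrier_mat (n * m) 1"
  by (auto simp: vec_of_mat_def)

lemma vec_of_mat_index:
  assumes "A \<in> carrier_mat n m" "i < n" "j < m"
  shows "vec_of_mat A $$ (i * m + j, 0) = A $$ (i, j)"
  using assms mult_index_less[of i n j m] by (auto simp: vec_of_mat_def)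

lemma kron_entry:
  assumes "A \<in> carrier_mat n m" "B \<in> carrier_mat n' m'" "a < n" "b < n'" "c < m" "d < m'"
  shows "kron A B $$ (a * n' + b, c * m' + d) = A $$ (a, c) * B $$ (b, d)"
  using assms mult_index_less[of a n b n'] mult_index_less[of c m d m'] by (auto simp: kron_index)

lemma mult_mat_entry:
  assumes "A \<in> carrier_mat n m" "B \<in> carrier_mat m k" "i < n" "j < k"
  shows "(A * B) $$ (i, j) = (\<Sum>l<m. A $$ (i, l) * B $$ (l, j))"
  using assms by (auto simp: scalar_prod_def atLeast0LessThan intro!: sum.cong)

text \<open>
  On tensors of rank two the action becomes multiplication from both sides, so that invariance
  of a tensor can be read off from commutation relations between matrices.
\<close>

lemma kron_vec_of_mat:
  assumes A: "A \<in> carrier_mat a b" and B: "B \<in> carrier_mat c d" and C: "C \<in> carrier_mat b d"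
  shows "kron A B * vec_of_mat C = vec_of_mat (A * C * B\<^sup>T)"
proof (rule eq_matI)
  fix i j assume "i < dim_row (vec_of_mat (A * C * B\<^sup>T))" "j < dim_col (vec_of_mat (A * C * B\<^sup>T))"
  then have i: "i < a * c" and j: "j = 0" using assms by (auto simp: vec_of_mat_def)
  note b = div_index_less[OF i] mod_index_less[OF i]
  have "(kron A B * vec_of_mat C) $$ (i, j) = (\<Sum>k<b * d. kron A B $$ (i, k) * vec_of_mat C $$ (k, 0))"
    unfolding j using mult_mat_entry[OF kron_carrier[OF A B] vec_of_mat_carrier[OF C] i, of 0] by simp
  also have "\<dots> = (\<Sum>k<b * d. A $$ (i div c, k div d) * B $$ (i mod c, k mod d) * C $$ (k div d, k mod d))"
    using assms i by (intro sum.cong) (auto simp: kron_index vec_of_mat_def)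
  also have "\<dots> = (\<Sum>k<b. \<Sum>l<d. A $$ (i div c, k) * B $$ (i mod c, l) * C $$ (k, l))"
    by (rule sum_div_mod)
  also have "\<dots> = (\<Sum>l<d. (\<Sum>k<b. A $$ (i div c, k) * C $$ (k, l)) * B $$ (i mod c, l))"
    unfolding sum_distrib_right by (subst sum.swap) (simp add: algebra_simps)
  also have "\<dots> = (\<Sum>l<d. (A * C) $$ (i div c, l) * B\<^sup>T $$ (l, i mod c))"
    using assms b by (intro sum.cong refl) (auto simp: mult_mat_entry[OF A C] simp del: index_mult_mat)
  also have "\<dots> = (A * C * B\<^sup>T) $$ (i div c, i mod c)"
    using assms b by (subst mult_mat_entry[of _ a d _ c]) auto
  also have "\<dots> = vec_of_mat (A * C * B\<^sup>T) $$ (i, j)"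
    using assms i j by (simp add: vec_of_mat_def del: index_mult_mat(1))
  finally show "(kron A B * vec_of_mat C) $$ (i, j) = vec_of_mat (A * C * B\<^sup>T) $$ (i, j)" .
qed (use assms in \<open>auto simp: vec_of_mat_def\<close>)

lemma vec_of_mat_cancel:
  assumes "A \<in> carrier_mat n m"
  shows "vec_of_mat A + vec_of_mat ((-1) \<cdot>\<^sub>m A) = 0\<^sub>m (n * m) 1" "vec_of_mat ((-1) \<cdot>\<^sub>m A) + vec_of_mat A = 0\<^sub>m (n * m) 1"
  using assms by (auto simp: vec_of_mat_def mod_index_less div_index_less intro!: eq_matI)

lemma uhom_utrivI:
  assumes "f \<in> carrier_mat (udim V) 1" "uact V gE * f = 0\<^sub>m (udim V) 1" "uact V gF * f = 0\<^sub>m (udim V) 1"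
    "uact V gK * f = f" "uact V gKinv * f = f"
  shows "f \<in> uhom utriv V"
proof (rule uhomI)
  fix x show "f * uact utriv x = uact V x * f"
    using assms by (cases x) (auto simp: right_mult_one_mat[of _ "udim V" "Suc 0"] right_mult_zero_mat[of _ "udim V" "Suc 0"])
qed (use assms in simp)

text \<open>
  The tensor \<open>\<Sum> f(v\<^sub>i) \<otimes> v\<^sub>i\<^sup>*\<close> is invariant because \<open>f\<close> commutes with the action; the
  coevaluation is the case \<open>f = 1\<close>.
\<close>

lemma coev_uhom:
  assumes V: "is_umod p V" and f: "f \<in> uend V"
  shows "vec_of_mat f \<in> uhom utriv (utensor V (udual V))"
proof -
  define n where d: "n = udim V"
  define E F K L where w: "E = uact V gE" "F = uact V gF" "K = uact V gK" "L = uact V gKinv"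
  note r = is_umodD[OF V, folded d w]
  note f' = uhomD[OF f, folded d]
  have fw: "f * E = E * f" "f * F = F * f" "f * K = K * f" "f * L = L * f"
    unfolding w by (rule f'(2))+
  have c: "E \<in> carrier_mat n n" "F \<in> carrier_mat n n" "K \<in> carrier_mat n n" "L \<in> carrier_mat n n" "f \<in> carrier_mat n n"
    unfolding w using r(1) f'(1) by blast+
  note sq = mult_carrier_mat[of _ n n _ n] left_mult_one_mat[of _ n n] right_mult_one_mat[of _ n n]
    mult_smult_assoc_mat[of _ n n _ n] mult_smult_distrib[of _ n n _ n] transpose_smult_mat
  note as = assoc_mult_mat[of _ n n _ n _ n]
  note kv = kron_vec_of_mat[of _ n n _ n n]
  have KL: "K * (L * X) = X" "L * (K * X) = X" if "X \<in> carrier_mat n n" for X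
    using that c r(5,6) by (simp_all add: as[symmetric] sq)
  have fY: "f * (Y * X) = Y * (f * X)" if "f * Y = Y * f" "X \<in> carrier_mat n n" "Y \<in> carrier_mat n n" for X Y
    using that(2,3) c(5) by (metis as that(1))
  note fE = fY[OF fw(1) _ c(1)] fY[OF fw(2) _ c(2)] fY[OF fw(3) _ c(3)] fY[OF fw(4) _ c(4)]
  show ?thesis
  proof (rule uhom_utrivI)
    show "vec_of_mat f \<in> carrier_mat (udim (utensor V (udual V))) 1"
      using vec_of_mat_carrier[of f n n] c by (simp add: d[symmetric])
    have "(kron (1\<^sub>m n) ((-1) \<cdot>\<^sub>m (E * L)\<^sup>T) + kron E L\<^sup>T) * vec_of_mat f
        = vec_of_mat ((-1) \<cdot>\<^sub>m (E * (f * L))) + vec_of_mat (E * (f * L))"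
      using c by (simp add: add_mult_distrib_mat[of _ "n * n" "n * n" _ _ 1] vec_of_mat_carrier[simplified] kron_carrier kv sq as fE)
    then show "uact (utensor V (udual V)) gE * vec_of_mat f = 0\<^sub>m (udim (utensor V (udual V))) 1"
      using c by (simp add: utensor_act udual_act d[symmetric] w[symmetric] vec_of_mat_cancel[of _ n n, simplified] sq)
    have "(kron L ((-1) \<cdot>\<^sub>m (K * F)\<^sup>T) + kron F (1\<^sub>m n)) * vec_of_mat f
        = vec_of_mat ((-1) \<cdot>\<^sub>m (F * f)) + vec_of_mat (F * f)"
      using c by (simp add: add_mult_distrib_mat[of _ "n * n" "n * n" _ _ 1] vec_of_mat_carrier[simplified] kron_carrier kv sq as fE KL fw)
    then show "uact (utensor V (udual V)) gF * vec_of_mat f = 0\<^sub>m (udim (utensor V (udual V))) 1"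
      using c by (simp add: utensor_act udual_act d[symmetric] w[symmetric] vec_of_mat_cancel[of _ n n, simplified] sq)
    show "uact (utensor V (udual V)) gK * vec_of_mat f = vec_of_mat f"
      "uact (utensor V (udual V)) gKinv * vec_of_mat f = vec_of_mat f"
      using c by (simp_all add: utensor_act udual_act d[symmetric] w[symmetric] kv sq as fE KL fw)
  qed
qed

lemma act_g_inverse:
  assumes V: "is_umod p V"
  shows "act_g p V \<in> carrier_mat (udim V) (udim V)" "act_g_inv p V \<in> carrier_mat (udim V) (udim V)"
    "act_g p V * act_g_inv p V = 1\<^sub>m (udim V)"
  using is_umodD(1)[OF V] is_umodD(5)[OF V]
  by (auto simp: act_g_def act_g_inv_def simp del: pow_mat.simps intro!: pow_carrier_mat inverse_pow_mat)

text \<open>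
  Conjugation by \<open>g = K\<^sup>p\<^sup>+\<^sup>1\<close> scales \<open>E\<close> and \<open>F\<close> like conjugation by \<open>K\<close>, since
  \<open>q\<^sup>2\<^sup>p = 1\<close>.
\<close>

lemma act_g_inv_commute:
  assumes p: "p > 0" and V: "is_umod p V"
  shows "uact V gE * act_g_inv p V = qroot p ^ 2 \<cdot>\<^sub>m (act_g_inv p V * uact V gE)"
    "uact V gF * act_g_inv p V = inverse (qroot p ^ 2) \<cdot>\<^sub>m (act_g_inv p V * uact V gF)"
    "uact V gKinv * act_g_inv p V = act_g_inv p V * uact V gKinv"
proof -
  have w: "(qroot p ^ 2) ^ (p + 1) = qroot p ^ 2"
    using qroot_pow_2p[OF p] by (simp add: power_mult)
  have w': "inverse (qroot p ^ 2) ^ (p + 1) = inverse (qroot p ^ 2)"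
    unfolding power_inverse w ..
  note c = is_umodD(1)[OF V]
  show "uact V gE * act_g_inv p V = qroot p ^ 2 \<cdot>\<^sub>m (act_g_inv p V * uact V gE)"
    unfolding act_g_inv_def q_commute_pow[OF c c is_umod_K_commute(3)[OF V]] w ..
  show "uact V gF * act_g_inv p V = inverse (qroot p ^ 2) \<cdot>\<^sub>m (act_g_inv p V * uact V gF)"
    unfolding act_g_inv_def q_commute_pow[OF c c is_umod_K_commute(4)[OF V]] w' ..
  show "uact V gKinv * act_g_inv p V = act_g_inv p V * uact V gKinv"
    unfolding act_g_inv_def using pow_mat_Suc_left[OF c, of gKinv "p + 1"] by simp
qed

text \<open>
  The coevaluation into \<open>V\<^sup>* \<otimes> V\<close>, with value \<open>\<Sum> v\<^sub>i\<^sup>* \<otimes> g\<^sup>-\<^sup>1 v\<^sub>i\<close>.  It is invariant because conjugation by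
  \<open>g\<close> is the square of the antipode.
\<close>

lemma coev_left_uhom:
  assumes p: "p > 0" and V: "is_umod p V"
  shows "vec_of_mat (act_g_inv p V)\<^sup>T \<in> uhom utriv (utensor (udual V) V)"
proof -
  define n where d: "n = udim V"
  define G where G: "G = act_g_inv p V"
  define q where "q = qroot p"
  define E F K L where w: "E = uact V gE" "F = uact V gF" "K = uact V gK" "L = uact V gKinv"
  note r = is_umodD[OF V, folded d w q_def]
  note k = is_umod_K_commute[OF V, folded w q_def]
  note g = act_g_inv_commute[OF p V, folded w G q_def]
  have c: "E \<in> carrier_mat n n" "F \<in> carrier_mat n n" "K \<in> carrier_mat n n" "L \<in> carrier_mat n n" "G \<in> carrier_mat n n"
    unfolding w G d using r(1) act_g_inverse(2)[OF V] by (auto simp: d)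
  have q: "q \<noteq> 0" by (simp add: q_def)
  note sq = mult_carrier_mat[of _ n n _ n] left_mult_one_mat[of _ n n] right_mult_one_mat[of _ n n]
    mult_smult_assoc_mat[of _ n n _ n] mult_smult_distrib[of _ n n _ n] transpose_smult_mat
  note as = assoc_mult_mat[of _ n n _ n _ n]
  note kv = kron_vec_of_mat[of _ n n _ n n]
  note tr = transpose_mult[of _ n n _ n, symmetric]
  have KL: "K * (L * X) = X" "L * (K * X) = X" if "X \<in> carrier_mat n n" for X
    using that c r(5,6) by (simp_all add: as[symmetric] sq)
  have GE: "G * E = inverse (q ^ 2) \<cdot>\<^sub>m (E * G)" and GF: "G * F = q ^ 2 \<cdot>\<^sub>m (F * G)"
    using g q by (simp_all add: smult_smult_mat one_smult_mat)
  have KGEL: "K * (G * (E * L)) = E * G"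
  proof -
    have "K * (G * (E * L)) = K * ((G * E) * L)" using c by (simp add: sq as)
    also have "\<dots> = inverse (q ^ 2) \<cdot>\<^sub>m (K * E * (G * L))"
      unfolding GE using c by (simp add: sq as)
    also have "\<dots> = inverse (q ^ 2) \<cdot>\<^sub>m ((K * E * L) * G)"
      unfolding g(3)[symmetric] using c by (simp add: sq as)
    also have "\<dots> = E * G"
      unfolding r(7) using c q by (simp add: sq smult_smult_mat one_smult_mat)
    finally show ?thesis .
  qed
  have GKF: "G * (K * F) = F * (G * K)"
  proof -
    have "G * (K * F) = inverse (q ^ 2) \<cdot>\<^sub>m ((G * F) * K)"
      unfolding k(2) using c by (simp add: sq as)
    also have "\<dots> = F * (G * K)"
      unfolding GF using c q by (simp add: sq as smult_smult_mat one_smult_mat)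
    finally show ?thesis .
  qed
  show ?thesis
  proof (rule uhom_utrivI)
    show "vec_of_mat (act_g_inv p V)\<^sup>T \<in> carrier_mat (udim (utensor (udual V) V)) 1"
      using vec_of_mat_carrier[of "G\<^sup>T" n n] c by (simp add: d[symmetric] G[symmetric])
    have "(kron (1\<^sub>m n) E + kron ((-1) \<cdot>\<^sub>m (E * L)\<^sup>T) K) * vec_of_mat G\<^sup>T
        = vec_of_mat (E * G)\<^sup>T + vec_of_mat ((-1) \<cdot>\<^sub>m (E * G)\<^sup>T)"
      using c by (simp add: add_mult_distrib_mat[of _ "n * n" "n * n" _ _ 1] vec_of_mat_carrier[simplified] kron_carrier kv sq tr as KGEL)
    then show "uact (utensor (udual V) V) gE * vec_of_mat (act_g_inv p V)\<^sup>T = 0\<^sub>m (udim (utensor (udual V) V)) 1"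
      using c by (simp add: utensor_act udual_act d[symmetric] w[symmetric] G[symmetric] vec_of_mat_cancel[of _ n n, simplified] sq)
    have "(kron K\<^sup>T F + kron ((-1) \<cdot>\<^sub>m (K * F)\<^sup>T) (1\<^sub>m n)) * vec_of_mat G\<^sup>T
        = vec_of_mat (F * (G * K))\<^sup>T + vec_of_mat ((-1) \<cdot>\<^sub>m (F * (G * K))\<^sup>T)"
      using c by (simp add: add_mult_distrib_mat[of _ "n * n" "n * n" _ _ 1] vec_of_mat_carrier[simplified] kron_carrier kv sq tr as GKF)
    then show "uact (utensor (udual V) V) gF * vec_of_mat (act_g_inv p V)\<^sup>T = 0\<^sub>m (udim (utensor (udual V) V)) 1"
      using c by (simp add: utensor_act udual_act d[symmetric] w[symmetric] G[symmetric] vec_of_mat_cancel[of _ n n, simplified] sq)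
    have "K * (G * L) = G" unfolding g(3)[symmetric] using c by (simp add: KL)
    moreover have "L * (G * K) = G"
    proof -
      have "L * (G * K) = (L * G) * K" using c by (simp add: as)
      also have "\<dots> = G * (L * K)" unfolding g(3) using c by (simp add: as)
      finally show ?thesis using c by (simp add: r sq)
    qed
    ultimately show "uact (utensor (udual V) V) gK * vec_of_mat (act_g_inv p V)\<^sup>T = vec_of_mat (act_g_inv p V)\<^sup>T"
      "uact (utensor (udual V) V) gKinv * vec_of_mat (act_g_inv p V)\<^sup>T = vec_of_mat (act_g_inv p V)\<^sup>T"
      using c by (simp_all add: utensor_act udual_act d[symmetric] w[symmetric] G[symmetric] kv sq tr as)
  qed
qed

text \<open>
  The evaluation \<open>V\<^sup>* \<otimes> V \<rightarrow> \<complex>\<close>; as a row it is the transpose of the vector of the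
  identity matrix.
\<close>

lemma ev_uhom:
  assumes V: "is_umod p V"
  shows "(vec_of_mat (1\<^sub>m (udim V)))\<^sup>T \<in> uhom (utensor (udual V) V) utriv"
proof -
  define n where d: "n = udim V"
  define E F K L where w: "E = uact V gE" "F = uact V gF" "K = uact V gK" "L = uact V gKinv"
  note r = is_umodD[OF V, folded d w]
  have c: "E \<in> carrier_mat n n" "F \<in> carrier_mat n n" "K \<in> carrier_mat n n" "L \<in> carrier_mat n n"
    unfolding w using r(1) by blast+
  define v where "v = vec_of_mat (1\<^sub>m n)"
  have v: "v \<in> carrier_mat (n * n) 1" unfolding v_def by (rule vec_of_mat_carrier) simp
  note sq = mult_carrier_mat[of _ n n _ n] left_mult_one_mat[of _ n n] right_mult_one_mat[of _ n n]
    mult_smult_assoc_mat[of _ n n _ n] mult_smult_distrib[of _ n n _ n] transpose_smult_mat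
  note as = assoc_mult_mat[of _ n n _ n _ n]
  have kr: "v\<^sup>T * kron A B = (vec_of_mat (A\<^sup>T * B))\<^sup>T" if "A \<in> carrier_mat n n" "B \<in> carrier_mat n n" for A B
  proof -
    have "kron A\<^sup>T B\<^sup>T = (kron A B)\<^sup>T"
      using that by (intro eq_matI) (auto simp: kron_index mod_index_less div_index_less)
    then have "(v\<^sup>T * kron A B)\<^sup>T = kron A\<^sup>T B\<^sup>T * v"
      using v that by (subst transpose_mult[of _ 1 "n * n" _ "n * n"]) auto
    also have "\<dots> = vec_of_mat (A\<^sup>T * B)"
      unfolding v_def using that by (subst kron_vec_of_mat[of _ n n _ n n]) (auto simp: sq)
    finally show ?thesis by (metis transpose_transpose)
  qed
  have KL: "K * (L * X) = X" "L * (K * X) = X" if "X \<in> carrier_mat n n" for X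
    using that c r(5,6) by (simp_all add: as[symmetric] sq)
  have cancel: "(vec_of_mat X)\<^sup>T + (vec_of_mat ((-1) \<cdot>\<^sub>m X))\<^sup>T = 0\<^sub>m 1 (n * n)" if "X \<in> carrier_mat n n" for X
    using that by (auto simp: vec_of_mat_def mod_index_less div_index_less intro!: eq_matI)
  note md = mult_add_distrib_mat[of "v\<^sup>T" 1 "n * n" _ "n * n"]
  show ?thesis unfolding d[symmetric] v_def[symmetric]
  proof (rule uhomI)
    show "v\<^sup>T \<in> carrier_mat (udim utriv) (udim (utensor (udual V) V))"
      using v by (simp add: d[symmetric])
    fix x
    have "v\<^sup>T * (kron (1\<^sub>m n) E + kron ((-1) \<cdot>\<^sub>m (E * L)\<^sup>T) K) = 0\<^sub>m 1 (n * n)"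
      using c v cancel[OF c(1)] by (subst md) (auto simp: kr sq as r)
    moreover have "v\<^sup>T * (kron K\<^sup>T F + kron ((-1) \<cdot>\<^sub>m (K * F)\<^sup>T) (1\<^sub>m n)) = 0\<^sub>m 1 (n * n)"
      using c v cancel[of "K * F"] by (subst md) (auto simp: kr sq as r)
    moreover have "v\<^sup>T * kron L\<^sup>T K = v\<^sup>T" "v\<^sup>T * kron K\<^sup>T L = v\<^sup>T"
      using c by (simp_all add: kr sq r) (simp_all add: v_def)
    ultimately show "v\<^sup>T * uact (utensor (udual V) V) x = uact utriv x * v\<^sup>T"
      using v by (cases x) (simp_all add: utensor_act udual_act d[symmetric] w[symmetric]
        left_mult_zero_mat[of _ "Suc 0" "n * n"] left_mult_one_mat[of _ "Suc 0" "n * n"])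
  qed
qed

text \<open>
  The left partial trace is the composition
  \<open>W \<rightarrow> V\<^sup>* \<otimes> V \<otimes> W \<rightarrow> V\<^sup>* \<otimes> V \<otimes> W \<rightarrow> W\<close> of a coevaluation, \<open>1 \<otimes> h\<close> and an evaluation.  This
  exhibits it as a composition of module homomorphisms whenever \<open>h\<close> is one, and also shows
  that it is linear over the endomorphisms of \<open>W\<close>.
\<close>

lemma ptr_left_eq_ev_coev:
  assumes V: "is_umod p V" and h: "h \<in> carrier_mat (udim V * m) (udim V * m)" and m: "m = udim W"
  shows "ptr_left p V W h = kron (vec_of_mat (1\<^sub>m (udim V)))\<^sup>T (1\<^sub>m m) * kron (1\<^sub>m (udim V)) h
    * kron (vec_of_mat (act_g_inv p V)\<^sup>T) (1\<^sub>m m)"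
proof -
  define n where "n = udim V"
  define g where "g = act_g_inv p V"
  have g: "g \<in> carrier_mat n n" using act_g_inverse(2)[OF V] by (simp add: n_def g_def)
  note h' = h[folded n_def]
  define e where "e = (vec_of_mat (1\<^sub>m n))\<^sup>T"
  define c where "c = vec_of_mat g\<^sup>T"
  have e: "e \<in> carrier_mat 1 (n * n)" unfolding e_def using vec_of_mat_carrier[of "1\<^sub>m n" n n] by simp
  have c: "c \<in> carrier_mat (n * n) 1" unfolding c_def using vec_of_mat_carrier[of "g\<^sup>T" n n] g by simp
  have eA: "kron e (1\<^sub>m m) \<in> carrier_mat m (n * n * m)" using kron_carrier[OF e, of "1\<^sub>m m" m m] by simp
  have hB: "kron (1\<^sub>m n) h \<in> carrier_mat (n * n * m) (n * n * m)"
    using kron_carrier[OF _ h', of "1\<^sub>m n" n n] by (simp add: mult.assoc)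
  have cC: "kron c (1\<^sub>m m) \<in> carrier_mat (n * n * m) m" using kron_carrier[OF c, of "1\<^sub>m m" m m] by simp
  let ?B = "kron (1\<^sub>m n) h * kron c (1\<^sub>m m)" and ?R = "kron e (1\<^sub>m m) * kron (1\<^sub>m n) h * kron c (1\<^sub>m m)"
  have R: "?R \<in> carrier_mat m m"
    using eA hB cC by auto
  \<comment> \<open>both sides have the entries \<open>\<Sum>\<^sub>i\<^sub>j h\<^sub>i\<^sub>a\<^sub>,\<^sub>j\<^sub>b (g\<^sup>-\<^sup>1)\<^sub>j\<^sub>i\<close>\<close>
  have "ptr_left p V W h = ?R"
  proof (rule eq_matI)
    show "dim_row (ptr_left p V W h) = dim_row (?R)"
      "dim_col (ptr_left p V W h) = dim_col (?R)"
      unfolding carrier_matD[OF R] by (simp_all add: ptr_left_def Let_def m)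
    fix a b assume "a < dim_row (?R)"
      "b < dim_col (?R)"
    then have ab: "a < m" "b < m" using carrier_matD[OF R] by (simp_all only:)
    have ee: "kron e (1\<^sub>m m) $$ (a, (i * n + j) * m + r) = (if i = j \<and> r = a then 1 else 0)"
      if "i < n" "j < n" "r < m" for i j r
    proof -
      have "kron e (1\<^sub>m m) $$ (0 * m + a, (i * n + j) * m + r) = e $$ (0, i * n + j) * 1\<^sub>m m $$ (a, r)"
        using e ab that mult_index_less[of i n j n] by (intro kron_entry) auto
      also have "e $$ (0, i * n + j) = (if i = j then 1 else 0)"
        using that mult_index_less[of i n j n] vec_of_mat_index[of "1\<^sub>m n" n n i j] vec_of_mat_carrier[of "1\<^sub>m n" n n]
        by (simp add: e_def)
      finally show ?thesis using ab that by simp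
    qed
    have cc: "kron c (1\<^sub>m m) $$ ((i * n + j) * m + r, b) = (if r = b then g $$ (j, i) else 0)"
      if "i < n" "j < n" "r < m" for i j r
    proof -
      have "kron c (1\<^sub>m m) $$ ((i * n + j) * m + r, 0 * m + b) = c $$ (i * n + j, 0) * 1\<^sub>m m $$ (r, b)"
        using c ab that mult_index_less[of i n j n] by (intro kron_entry) auto
      also have "c $$ (i * n + j, 0) = g $$ (j, i)"
        using that g vec_of_mat_index[of "g\<^sup>T" n n i j] by (simp add: c_def)
      finally show ?thesis using ab that by simp
    qed
    have hh: "?B $$ ((i * n + i) * m + a, b) = (\<Sum>j<n. h $$ (i * m + a, j * m + b) * g $$ (j, i))"
      if i: "i < n" for i
    proof -
      have idx: "(i * n + i) * m + a = i * (n * m) + (i * m + a)" by (simp add: algebra_simps)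
      have idx2: "i' * (n * m) + (j * m + r) = (i' * n + j) * m + r" for i' j r by (simp add: algebra_simps)
      have "?B $$ ((i * n + i) * m + a, b)
        = (\<Sum>l<n * (n * m). kron (1\<^sub>m n) h $$ ((i * n + i) * m + a, l) * kron c (1\<^sub>m m) $$ (l, b))"
        unfolding mult.assoc[symmetric, of n n m]
        using mult_index_less[OF mult_index_less[OF i i] ab(1)] ab
        by (intro mult_mat_entry[OF hB cC]) auto
      also have "\<dots> = (\<Sum>i'<n. \<Sum>l<n * m. (if i = i' then h $$ (i * m + a, l) * kron c (1\<^sub>m m) $$ (i' * (n * m) + l, b) else 0))"
        unfolding sum_mult_index[of _ n "n * m"] idx
        using i ab h' mult_index_less[OF i ab(1)]
        by (intro sum.cong refl) (auto simp: kron_entry[of _ n n _ "n * m" "n * m"])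
      also have "\<dots> = (\<Sum>l<n * m. h $$ (i * m + a, l) * kron c (1\<^sub>m m) $$ (i * (n * m) + l, b))"
        using i by (subst sum.swap) (simp add: sum.delta')
      also have "\<dots> = (\<Sum>j<n. \<Sum>r<m. if r = b then h $$ (i * m + a, j * m + r) * g $$ (j, i) else 0)"
        unfolding sum_mult_index[of _ n m] idx2 using i by (intro sum.cong refl) (auto simp: cc)
      also have "\<dots> = (\<Sum>j<n. h $$ (i * m + a, j * m + b) * g $$ (j, i))"
        using ab by (simp add: sum.delta)
      finally show ?thesis .
    qed
    have "?R $$ (a, b)
        = (kron e (1\<^sub>m m) * ?B) $$ (a, b)"
      by (subst assoc_mult_mat[OF eA hB cC]) simp
    also have "\<dots> = (\<Sum>l<n * n * m. kron e (1\<^sub>m m) $$ (a, l) * ?B $$ (l, b))"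
      using ab by (intro mult_mat_entry[OF eA]) (use hB cC in auto)
    also have "\<dots> = (\<Sum>i<n. \<Sum>j<n. \<Sum>r<m. if r = a then (if i = j then ?B $$ ((i * n + j) * m + r, b) else 0) else 0)"
      unfolding sum_mult_index[of _ "n * n" m] sum_mult_index[of _ n n]
      by (intro sum.cong refl) (auto simp: ee simp del: index_mult_mat)
    also have "\<dots> = (\<Sum>i<n. ?B $$ ((i * n + i) * m + a, b))"
      using ab by (simp add: sum.delta sum.delta' del: index_mult_mat)
    also have "\<dots> = (\<Sum>i<n. \<Sum>j<n. h $$ (i * m + a, j * m + b) * g $$ (j, i))"
      by (intro sum.cong refl) (auto simp: hh simp del: index_mult_mat)
    finally have composite: "?R $$ (a, b)
        = (\<Sum>i<n. \<Sum>j<n. h $$ (i * m + a, j * m + b) * g $$ (j, i))" .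
    have "ptr_left p V W h $$ (a, b) = (\<Sum>i<n. (h * kron g (1\<^sub>m m)) $$ (i * m + a, i * m + b))"
      unfolding ptr_left_def Let_def m[symmetric] n_def[symmetric] g_def[symmetric] using ab by simp
    also have "\<dots> = (\<Sum>i<n. \<Sum>j<n. h $$ (i * m + a, j * m + b) * g $$ (j, i))"
    proof (rule sum.cong[OF refl])
      fix i assume "i \<in> {..<n}"
      then have i: "i < n" by simp
      have "(h * kron g (1\<^sub>m m)) $$ (i * m + a, i * m + b)
          = (\<Sum>l<n * m. h $$ (i * m + a, l) * kron g (1\<^sub>m m) $$ (l, i * m + b))"
        using mult_index_less[OF i ab(1)] mult_index_less[OF i ab(2)] h' g
        by (subst mult_mat_entry[of _ "n * m" "n * m" _ "n * m"]) auto
      also have "\<dots> = (\<Sum>j<n. \<Sum>c<m. if c = b then h $$ (i * m + a, j * m + c) * g $$ (j, i) else 0)"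
        unfolding sum_mult_index using i ab g
        by (intro sum.cong refl) (auto simp: kron_entry[of _ n n _ m m])
      also have "\<dots> = (\<Sum>j<n. h $$ (i * m + a, j * m + b) * g $$ (j, i))"
        using ab by (simp add: sum.delta)
      finally show "(h * kron g (1\<^sub>m m)) $$ (i * m + a, i * m + b)
        = (\<Sum>j<n. h $$ (i * m + a, j * m + b) * g $$ (j, i))" .
    qed
    finally show "ptr_left p V W h $$ (a, b) = ?R $$ (a, b)"
      unfolding composite .
  qed
  then show ?thesis unfolding n_def g_def e_def c_def .
qed

lemma ptr_left_uend:
  assumes p: "p > 0" and V: "is_umod p V" and W: "is_umod p W" and h: "h \<in> uend (utensor V W)"
  shows "ptr_left p V W h \<in> uend W"
proof -
  let ?T = "utensor (utensor (udual V) V) W"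
  note cV = is_umodD(1)[OF V] and cW = is_umodD(1)[OF W]
  have cD: "uact (udual V) x \<in> carrier_mat (udim (udual V)) (udim (udual V))" for x
    using udual_carrier[of V x] cV by simp
  have ct: "uact (utensor A B) x \<in> carrier_mat (udim (utensor A B)) (udim (utensor A B))"
    if "\<And>x. uact A x \<in> carrier_mat (udim A) (udim A)" "\<And>x. uact B x \<in> carrier_mat (udim B) (udim B)" for A B x
    using utensor_carrier[of A B x] that by simp
  have a: "utensor (udual V) (utensor V W) = ?T"
    by (rule utensor_assoc[symmetric]) (use cV cW cD in auto)
  have "kron (vec_of_mat (1\<^sub>m (udim V)))\<^sup>T (1\<^sub>m (udim W)) \<in> uhom ?T (utensor utriv W)"
    by (rule uhom_kron[OF ct[OF cD cV] cW utriv_carrier cW ev_uhom[OF V] one_uhom[OF cW]])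
  then have 1: "kron (vec_of_mat (1\<^sub>m (udim V)))\<^sup>T (1\<^sub>m (udim W)) \<in> uhom ?T W"
    unfolding utensor_utriv(2)[OF cW] .
  have 2: "kron (1\<^sub>m (udim V)) h \<in> uhom ?T ?T"
    unfolding a[symmetric]
    by (rule uhom_kron[OF cD ct[OF cV cW] cD ct[OF cV cW] _ h]) (use one_uhom[OF cD] in simp)
  have "kron (vec_of_mat (act_g_inv p V)\<^sup>T) (1\<^sub>m (udim W)) \<in> uhom (utensor utriv W) ?T"
    by (rule uhom_kron[OF utriv_carrier cW ct[OF cD cV] cW coev_left_uhom[OF p V] one_uhom[OF cW]])
  then have 3: "kron (vec_of_mat (act_g_inv p V)\<^sup>T) (1\<^sub>m (udim W)) \<in> uhom W ?T"
    unfolding utensor_utriv(2)[OF cW] .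
  note cT = ct[OF ct[OF cD cV] cW]
  have hc: "h \<in> carrier_mat (udim V * udim W) (udim V * udim W)"
    using uhomD(1)[OF h] by simp
  show ?thesis
    unfolding ptr_left_eq_ev_coev[OF V hc refl]
    by (rule uhom_comp[OF cW cT cW 3 uhom_comp[OF cT cT cW 2 1]])
qed

lemma ptr_left_mult_right:
  assumes V: "is_umod p V" and h: "h \<in> carrier_mat (udim V * m) (udim V * m)" and m: "m = udim W"
    and f: "f \<in> carrier_mat m m"
  shows "ptr_left p V W (h * kron (1\<^sub>m (udim V)) f) = ptr_left p V W h * f"
proof -
  define n where "n = udim V"
  note h' = h[folded n_def]
  define A where "A = kron (vec_of_mat (1\<^sub>m n))\<^sup>T (1\<^sub>m m) * kron (1\<^sub>m n) h"
  define c where "c = vec_of_mat (act_g_inv p V)\<^sup>T"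
  have c: "c \<in> carrier_mat (n * n) 1"
    unfolding c_def using vec_of_mat_carrier[of "(act_g_inv p V)\<^sup>T" n n] act_g_inverse(2)[OF V] by (simp add: n_def)
  have e: "kron (vec_of_mat (1\<^sub>m n))\<^sup>T (1\<^sub>m m) \<in> carrier_mat m (n * n * m)"
    using kron_carrier[of "(vec_of_mat (1\<^sub>m n))\<^sup>T" 1 "n * n" "1\<^sub>m m" m m] vec_of_mat_carrier[of "1\<^sub>m n" n n] by simp
  have H: "kron (1\<^sub>m n) h \<in> carrier_mat (n * n * m) (n * n * m)"
    using kron_carrier[OF _ h', of "1\<^sub>m n" n n] by (simp add: mult.assoc)
  have C: "kron c (1\<^sub>m m) \<in> carrier_mat (n * n * m) m"
    using kron_carrier[OF c, of "1\<^sub>m m" m m] by simp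
  have A: "A \<in> carrier_mat m (n * n * m)" unfolding A_def using e H by (rule mult_carrier_mat)
  have kf: "kron (1\<^sub>m n) f \<in> carrier_mat (n * m) (n * m)" using f by auto
  have F: "kron (1\<^sub>m (n * n)) f \<in> carrier_mat (n * n * m) (n * n * m)" using f by auto
  have "kron (1\<^sub>m n) (h * kron (1\<^sub>m n) f) = kron (1\<^sub>m n) h * kron (1\<^sub>m (n * n)) f"
    unfolding kron_one[symmetric] kron_assoc
    using kron_mult[of "1\<^sub>m n" n n "1\<^sub>m n" n h "n * m" "n * m" "kron (1\<^sub>m n) f" "n * m"] h' kf by simp
  moreover have "kron (1\<^sub>m (n * n)) f * kron c (1\<^sub>m m) = kron c (1\<^sub>m m) * f"
    using kron_mult[of "1\<^sub>m (n * n)" "n * n" "n * n" c 1 f m m "1\<^sub>m m" m]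
      kron_mult[of c "n * n" 1 "1\<^sub>m 1" 1 "1\<^sub>m m" m m f m] c f kron_one_left[of f] by simp
  moreover have "h * kron (1\<^sub>m n) f \<in> carrier_mat (udim V * m) (udim V * m)"
    using h' kf by (simp add: n_def)
  ultimately show ?thesis
    using ptr_left_eq_ev_coev[OF V _ m, folded n_def c_def] h
      assoc_mult_mat[OF e H F] assoc_mult_mat[OF A F C] assoc_mult_mat[OF A C f] by (simp add: A_def n_def)
qed

text \<open>
  A homomorphism \<open>k : P \<otimes> V \<otimes> V\<^sup>* \<rightarrow> P\<close> is bent into the endomorphism
  \<open>h = (k \<otimes> 1) (1 \<otimes> coev)\<close> of \<open>P \<otimes> V\<close>, where \<open>coev\<close> is the coevaluation into \<open>V\<^sup>* \<otimes> V\<close>.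
  Closing the strand \<open>V\<close> of \<open>h (1 \<otimes> f)\<close> by the partial trace undoes the bending: \<open>f\<close>
  and the closed strand form the invariant tensor of \<open>f\<close> in \<open>V \<otimes> V\<^sup>*\<close>.
\<close>

lemma ptr_right_bend:
  assumes p: "p > 0" and P: "is_umod p P" and V: "is_umod p V" and f: "f \<in> uend V"
    and k: "k \<in> uhom (utensor P (utensor V (udual V))) P"
  obtains h where "h \<in> uend (utensor P V)"
    "ptr_right p P V (h * kron (1\<^sub>m (udim P)) f) = k * kron (1\<^sub>m (udim P)) (vec_of_mat f)"
proof -
  define l n where d: "l = udim P" "n = udim V"
  define c where "c = vec_of_mat (act_g_inv p V)\<^sup>T"
  define h where "h = kron k (1\<^sub>m n) * kron (1\<^sub>m (l * n)) c"
  note cP = is_umodD(1)[OF P] and cV = is_umodD(1)[OF V]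
  have cD: "uact (udual V) x \<in> carrier_mat (udim (udual V)) (udim (udual V))" for x
    using udual_carrier[of V x] cV by simp
  have ct: "uact (utensor A B) x \<in> carrier_mat (udim (utensor A B)) (udim (utensor A B))"
    if "\<And>x. uact A x \<in> carrier_mat (udim A) (udim A)" "\<And>x. uact B x \<in> carrier_mat (udim B) (udim B)" for A B x
    using utensor_carrier[of A B x] that by simp
  let ?Y = "utensor P V"
  note cY = ct[OF cP cV]
  have k': "k \<in> uhom (utensor ?Y (udual V)) P"
    using k unfolding utensor_assoc[OF cP cV cD] .
  have "kron (1\<^sub>m (udim ?Y)) c \<in> uhom (utensor ?Y utriv) (utensor ?Y (utensor (udual V) V))"
    unfolding c_def by (rule uhom_kron[OF cY utriv_carrier cY ct[OF cD cV] one_uhom[OF cY] coev_left_uhom[OF p V]])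
  then have 1: "kron (1\<^sub>m (l * n)) c \<in> uhom ?Y (utensor (utensor ?Y (udual V)) V)"
    unfolding utensor_utriv(1)[OF cY] utensor_assoc[OF cY cD cV, symmetric] by (simp add: d)
  have 2: "kron k (1\<^sub>m n) \<in> uhom (utensor (utensor ?Y (udual V)) V) ?Y"
    unfolding d by (rule uhom_kron[OF ct[OF cY cD] cV cP cV k' one_uhom[OF cV]])
  have h: "h \<in> uend ?Y"
    unfolding h_def by (rule uhom_comp[OF cY ct[OF ct[OF cY cD] cV] cY 1 2])
  define g where "g = act_g p V"
  have g: "g \<in> carrier_mat n n" "act_g_inv p V \<in> carrier_mat n n" "g * act_g_inv p V = 1\<^sub>m n"
    using act_g_inverse[OF V] by (auto simp: g_def d)
  have fc: "f \<in> carrier_mat n n" using uhomD(1)[OF f] by (simp add: d)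
  have kc: "k \<in> carrier_mat l (l * n * n)" using uhomD(1)[OF k] by (simp add: d mult.assoc)
  have cc: "c \<in> carrier_mat (n * n) 1" unfolding c_def using vec_of_mat_carrier[of "(act_g_inv p V)\<^sup>T" n n] g by simp
  define u where "u = vec_of_mat (1\<^sub>m n)"
  have uc: "u \<in> carrier_mat (n * n) 1" unfolding u_def by (rule vec_of_mat_carrier) simp
  define M where "M = kron k (1\<^sub>m n) * kron (1\<^sub>m (l * n)) u"
  have kk: "kron k (1\<^sub>m n) \<in> carrier_mat (l * n) (l * n * (n * n))"
    using kron_carrier[OF kc, of "1\<^sub>m n" n n] by (simp add: mult.assoc)
  have ku: "kron (1\<^sub>m (l * n)) u \<in> carrier_mat (l * n * (n * n)) (l * n)"
    "kron (1\<^sub>m (l * n)) c \<in> carrier_mat (l * n * (n * n)) (l * n)"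
    using kron_carrier[of "1\<^sub>m (l * n)" "l * n" "l * n" u "n * n" 1] uc
      kron_carrier[of "1\<^sub>m (l * n)" "l * n" "l * n" c "n * n" 1] cc by simp_all
  have M: "M \<in> carrier_mat (l * n) (l * n)" unfolding M_def using kk ku by auto
  \<comment> \<open>the twist by \<open>g\<close> in the partial trace undoes the one in the coevaluation\<close>
  have gh: "kron (1\<^sub>m l) g * h = M"
  proof -
    have 1: "kron (1\<^sub>m n) g * c = u"
      unfolding c_def u_def using g
      by (subst kron_vec_of_mat[of _ n n _ n n])
        (auto simp: left_mult_one_mat[of _ n n] transpose_mult[of _ n n _ n, symmetric])
    have 2: "kron (1\<^sub>m (l * n * n)) g * kron (1\<^sub>m (l * n)) c = kron (1\<^sub>m (l * n)) (kron (1\<^sub>m n) g * c)"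
      unfolding kron_one[symmetric, of "l * n" n] kron_assoc
      using kron_mult[of "1\<^sub>m (l * n)" "l * n" "l * n" "1\<^sub>m (l * n)" "l * n" "kron (1\<^sub>m n) g" "n * n" "n * n" c 1] g cc
      by auto
    have 3: "kron (1\<^sub>m l) g * kron k (1\<^sub>m n) = kron k (1\<^sub>m n) * kron (1\<^sub>m (l * n * n)) g"
      using kron_mult[of "1\<^sub>m l" l l k "l * n * n" g n n "1\<^sub>m n" n]
        kron_mult[of k l "l * n * n" "1\<^sub>m (l * n * n)" "l * n * n" "1\<^sub>m n" n n g n] g kc
      by (simp add: left_mult_one_mat[of _ n n] right_mult_one_mat[of _ n n])
    have 4: "kron (1\<^sub>m l) g \<in> carrier_mat (l * n) (l * n)" using g by auto
    have 5: "kron (1\<^sub>m (l * n * n)) g \<in> carrier_mat (l * n * (n * n)) (l * n * (n * n))"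
      using kron_carrier[of "1\<^sub>m (l * n * n)" "l * n * n" "l * n * n" g n n] g by (simp add: mult.assoc)
    have "kron (1\<^sub>m l) g * h = (kron (1\<^sub>m l) g * kron k (1\<^sub>m n)) * kron (1\<^sub>m (l * n)) c"
      unfolding h_def by (rule assoc_mult_mat[OF 4 kk ku(2), symmetric])
    also have "\<dots> = kron k (1\<^sub>m n) * (kron (1\<^sub>m (l * n * n)) g * kron (1\<^sub>m (l * n)) c)"
      unfolding 3 by (rule assoc_mult_mat[OF kk 5 ku(2)])
    also have "\<dots> = M"
      unfolding 2 1 M_def ..
    finally show ?thesis .
  qed
  have Mentry: "M $$ (a * n + i, y) = k $$ (a, y * n + i)" if ai: "a < l" "i < n" and y: "y < l * n" for a i y
  proof -
    have "M $$ (a * n + i, y) = (\<Sum>w<l * n * (n * n). kron k (1\<^sub>m n) $$ (a * n + i, w) * kron (1\<^sub>m (l * n)) u $$ (w, y))"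
      unfolding M_def by (intro mult_mat_entry[OF kk ku(1)] mult_index_less ai y)
    also have "l * n * (n * n) = l * n * n * n" by simp
    also have "(\<Sum>w<l * n * n * n. kron k (1\<^sub>m n) $$ (a * n + i, w) * kron (1\<^sub>m (l * n)) u $$ (w, y))
      = (\<Sum>w<l * n * n. \<Sum>i'<n. if i' = i then k $$ (a, w) * kron (1\<^sub>m (l * n)) u $$ (w * n + i, y) else 0)"
      unfolding sum_mult_index[of _ "l * n * n" n] using ai kc
      by (intro sum.cong refl) (auto simp: kron_entry[of _ l "l * n * n" _ n n])
    also have "\<dots> = (\<Sum>w<l * n * n. k $$ (a, w) * kron (1\<^sub>m (l * n)) u $$ (w * n + i, y))"
      using ai by (simp add: sum.delta)
    also have "\<dots> = (\<Sum>x<l * n. \<Sum>b<n. if b = i then (if x = y then k $$ (a, y * n + i) else 0) else 0)"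
      unfolding sum_mult_index[of _ "l * n" n]
    proof (intro sum.cong refl)
      fix x b assume "x \<in> {..<l * n}" "b \<in> {..<n}"
      then have x: "x < l * n" and b: "b < n" by auto
      have idx: "(x * n + b) * n + i = x * (n * n) + (b * n + i)" by (simp add: algebra_simps)
      have "kron (1\<^sub>m (l * n)) u $$ (x * (n * n) + (b * n + i), y * 1 + 0) = 1\<^sub>m (l * n) $$ (x, y) * u $$ (b * n + i, 0)"
        using uc x y mult_index_less[OF b ai(2)] by (intro kron_entry) auto
      also have "u $$ (b * n + i, 0) = (if b = i then 1 else 0)"
        unfolding u_def using b ai by (subst vec_of_mat_index[of _ n n]) auto
      finally show "k $$ (a, x * n + b) * kron (1\<^sub>m (l * n)) u $$ ((x * n + b) * n + i, y)
        = (if b = i then (if x = y then k $$ (a, y * n + i) else 0) else 0)"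
        unfolding idx using x y by auto
    qed
    also have "\<dots> = k $$ (a, y * n + i)"
      using ai y by (simp add: sum.delta)
    finally show ?thesis .
  qed
  have "ptr_right p P V (h * kron (1\<^sub>m (udim P)) f) = k * kron (1\<^sub>m (udim P)) (vec_of_mat f)"
  proof (rule eq_matI)
    have vf: "vec_of_mat f \<in> carrier_mat (n * n) 1" using fc by (rule vec_of_mat_carrier)
    have kf: "kron (1\<^sub>m l) f \<in> carrier_mat (l * n) (l * n)" using fc by auto
    have kv: "kron (1\<^sub>m l) (vec_of_mat f) \<in> carrier_mat (l * n * n) l"
      using kron_carrier[of "1\<^sub>m l" l l "vec_of_mat f" "n * n" 1] vf by (simp add: mult.assoc)
    show "dim_row (ptr_right p P V (h * kron (1\<^sub>m (udim P)) f)) = dim_row (k * kron (1\<^sub>m (udim P)) (vec_of_mat f))"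
      "dim_col (ptr_right p P V (h * kron (1\<^sub>m (udim P)) f)) = dim_col (k * kron (1\<^sub>m (udim P)) (vec_of_mat f))"
      using kc kv by (auto simp: ptr_right_def Let_def d)
    fix a b assume "a < dim_row (k * kron (1\<^sub>m (udim P)) (vec_of_mat f))" "b < dim_col (k * kron (1\<^sub>m (udim P)) (vec_of_mat f))"
    then have ab: "a < l" "b < l" using kc kv by (auto simp: d)
    have hc: "h \<in> carrier_mat (l * n) (l * n)" using uhomD(1)[OF h] by (simp add: d)
    have "kron (1\<^sub>m l) g * (h * kron (1\<^sub>m l) f) = M * kron (1\<^sub>m l) f"
      unfolding gh[symmetric] using g hc kf
      by (subst assoc_mult_mat[of _ "l * n" "l * n" _ "l * n" _ "l * n"]) auto
    then have "ptr_right p P V (h * kron (1\<^sub>m (udim P)) f) $$ (a, b)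
      = (\<Sum>i<n. (M * kron (1\<^sub>m l) f) $$ (a * n + i, b * n + i))"
      unfolding ptr_right_def Let_def d[symmetric] g_def[symmetric] using ab by simp
    also have "\<dots> = (\<Sum>i<n. \<Sum>j<n. k $$ (a, (b * n + j) * n + i) * f $$ (j, i))"
    proof (rule sum.cong[OF refl])
      fix i assume "i \<in> {..<n}"
      then have i: "i < n" by simp
      have "(M * kron (1\<^sub>m l) f) $$ (a * n + i, b * n + i)
        = (\<Sum>y<l * n. M $$ (a * n + i, y) * kron (1\<^sub>m l) f $$ (y, b * n + i))"
        by (intro mult_mat_entry[OF M kf] mult_index_less ab i)
      also have "\<dots> = (\<Sum>y<l * n. k $$ (a, y * n + i) * kron (1\<^sub>m l) f $$ (y, b * n + i))"
        using ab i by (intro sum.cong refl) (simp add: Mentry)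
      also have "\<dots> = (\<Sum>r<l. \<Sum>j<n. if r = b then k $$ (a, (b * n + j) * n + i) * f $$ (j, i) else 0)"
        unfolding sum_mult_index using ab i fc
        by (intro sum.cong refl) (auto simp: kron_entry[of _ l l _ n n])
      also have "\<dots> = (\<Sum>j<n. k $$ (a, (b * n + j) * n + i) * f $$ (j, i))"
        using ab by (subst sum.swap) (simp add: sum.delta)
      finally show "(M * kron (1\<^sub>m l) f) $$ (a * n + i, b * n + i)
        = (\<Sum>j<n. k $$ (a, (b * n + j) * n + i) * f $$ (j, i))" .
    qed
    also have "\<dots> = (\<Sum>j<n. \<Sum>i<n. k $$ (a, (b * n + j) * n + i) * f $$ (j, i))"
      by (rule sum.swap)
    also have "\<dots> = (\<Sum>j<n. \<Sum>i<n. k $$ (a, b * (n * n) + (j * n + i)) * vec_of_mat f $$ (j * n + i, 0))"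
      using fc by (intro sum.cong refl, subst vec_of_mat_index[of f n n]) (auto simp: algebra_simps)
    also have "\<dots> = (\<Sum>z<n * n. k $$ (a, b * (n * n) + z) * vec_of_mat f $$ (z, 0))"
      unfolding sum_mult_index ..
    also have "\<dots> = (\<Sum>r<l. \<Sum>z<n * n. if r = b then k $$ (a, b * (n * n) + z) * vec_of_mat f $$ (z, 0) else 0)"
      using ab by (subst sum.swap) (simp add: sum.delta)
    also have "\<dots> = (\<Sum>r<l. \<Sum>z<n * n. k $$ (a, r * (n * n) + z) * kron (1\<^sub>m l) (vec_of_mat f) $$ (r * (n * n) + z, b * 1 + 0))"
      using ab by (intro sum.cong refl, subst kron_entry[OF _ vf, of "1\<^sub>m l" l l]) auto
    also have "\<dots> = (\<Sum>w<l * (n * n). k $$ (a, w) * kron (1\<^sub>m l) (vec_of_mat f) $$ (w, b))"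
      unfolding sum_mult_index[of _ l "n * n"] by simp
    also have "\<dots> = (k * kron (1\<^sub>m (udim P)) (vec_of_mat f)) $$ (a, b)"
      using mult_mat_entry[OF kc kv ab] by (simp add: d mult.assoc)
    finally show "ptr_right p P V (h * kron (1\<^sub>m (udim P)) f) $$ (a, b)
      = (k * kron (1\<^sub>m (udim P)) (vec_of_mat f)) $$ (a, b)" .
  qed
  with h show thesis by (rule that)
qed

section \<open>The Steinberg module\<close>

text \<open>
  The eigenvalue of \<open>K\<close> on the \<open>i\<close>-th basis vector \<open>e\<^sub>i\<close>; the highest one is
  \<open>q\<^sup>p\<^sup>-\<^sup>1\<close>.
\<close>

definition steinberg_weight :: "nat \<Rightarrow> nat \<Rightarrow> complex" where
  "steinberg_weight p i = qroot p ^ (p - 1) * inverse (qroot p ^ 2) ^ i"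

text \<open>
  The basis is \<open>e\<^sub>i = F\<^sup>i v / [i]!\<close> for a highest weight vector \<open>v\<close>.  With this scaling
  \<open>E e\<^sub>i = [i] e\<^sub>i\<^sub>-\<^sub>1\<close> and \<open>F e\<^sub>i\<^sub>-\<^sub>1 = [i] e\<^sub>i\<close>, so \<open>F\<close> is the transpose of \<open>E\<close>.  This symmetry will
  turn projectivity into injectivity.
\<close>

definition steinberg :: "nat \<Rightarrow> umod" where
  "steinberg p = \<lparr>udim = p, uact = (\<lambda>x. mat p p (\<lambda>(i, j). case x of
      gE \<Rightarrow> (if j = Suc i then qint p j else 0)
    | gF \<Rightarrow> (if i = Suc j then qint p i else 0)
    | gK \<Rightarrow> (if i = j then steinberg_weight p i else 0)
    | gKinv \<Rightarrow> (if i = j then inverse (steinberg_weight p i) else 0)))\<rparr>"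

lemma steinberg_dim [simp]: "udim (steinberg p) = p"
  by (simp add: steinberg_def)

lemma steinberg_act:
  "uact (steinberg p) gE = mat p p (\<lambda>(i, j). if j = Suc i then qint p j else 0)"
  "uact (steinberg p) gF = mat p p (\<lambda>(i, j). if i = Suc j then qint p i else 0)"
  "uact (steinberg p) gK = mat p p (\<lambda>(i, j). if i = j then steinberg_weight p i else 0)"
  "uact (steinberg p) gKinv = mat p p (\<lambda>(i, j). if i = j then inverse (steinberg_weight p i) else 0)"
  by (simp_all add: steinberg_def)

lemma steinberg_carrier: "uact (steinberg p) x \<in> carrier_mat (udim (steinberg p)) (udim (steinberg p))"
  by (simp add: steinberg_def)

lemma steinberg_weight_nonzero [simp]: "steinberg_weight p i \<noteq> 0"
  by (simp add: steinberg_weight_def)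

lemma steinberg_weight_Suc: "steinberg_weight p (Suc i) = inverse (qroot p ^ 2) * steinberg_weight p i"
  by (simp add: steinberg_weight_def)

lemma steinberg_weight_pow: "p > 0 \<Longrightarrow> steinberg_weight p i ^ (2 * p) = 1"
proof -
  assume p: "p > 0"
  have a: "(z ^ k) ^ (2 * p) = 1" if "z ^ (2 * p) = 1" for z :: complex and k
    using that by (metis mult.commute power_mult power_one)
  have "inverse (qroot p ^ 2) ^ (2 * p) = 1"
    using a[OF qroot_pow_2p[OF p], of 2] by (simp only: power_inverse inverse_1)
  then show ?thesis
    unfolding steinberg_weight_def power_mult_distrib a[OF qroot_pow_2p[OF p]] by (subst a) simp_all
qed

lemma mat_mult_diag:
  assumes "A \<in> carrier_mat n n" "i < n" "j < n"
  shows "(A * mat n n (\<lambda>(i, j). if i = j then d i else (0::complex))) $$ (i, j) = A $$ (i, j) * d j"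
    "(mat n n (\<lambda>(i, j). if i = j then d i else (0::complex)) * A) $$ (i, j) = d i * A $$ (i, j)"
proof -
  have "(A * mat n n (\<lambda>(i, j). if i = j then d i else 0)) $$ (i, j)
    = (\<Sum>k<n. if k = j then A $$ (i, j) * d j else 0)"
    using assms by (subst mult_mat_entry[of _ n n _ n], simp, simp, simp, simp, intro sum.cong) auto
  then show "(A * mat n n (\<lambda>(i, j). if i = j then d i else (0::complex))) $$ (i, j) = A $$ (i, j) * d j"
    using assms by simp
  have "(mat n n (\<lambda>(i, j). if i = j then d i else 0) * A) $$ (i, j)
    = (\<Sum>k<n. if k = i then d i * A $$ (i, j) else 0)"
    using assms by (subst mult_mat_entry[of _ n n _ n], simp, simp, simp, simp, intro sum.cong) auto
  then show "(mat n n (\<lambda>(i, j). if i = j then d i else (0::complex)) * A) $$ (i, j) = d i * A $$ (i, j)"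
    using assms by simp
qed

lemma diag_mat_pow:
  "mat n n (\<lambda>(i, j). if i = j then d i else (0::complex)) ^\<^sub>m k = mat n n (\<lambda>(i, j). if i = j then d i ^ k else 0)"
proof (induction k)
  case 0
  show ?case by (auto intro!: eq_matI)
next
  case (Suc k)
  show ?case
    unfolding pow_mat.simps Suc by (intro eq_matI) (auto simp: mat_mult_diag simp del: index_mult_mat(1))
qed

lemma shift_mat_pow:
  assumes A: "A \<in> carrier_mat n n" and s: "\<And>i j. i < n \<Longrightarrow> j < n \<Longrightarrow> j \<noteq> Suc i \<Longrightarrow> A $$ (i, j) = (0::complex)"
    and ij: "i < n" "j < n" "j \<noteq> i + k"
  shows "(A ^\<^sub>m k) $$ (i, j) = 0"
  using ij
proof (induction k arbitrary: j)
  case 0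
  then show ?case using A by simp
next
  case (Suc k)
  have P: "A ^\<^sub>m k \<in> carrier_mat n n" using A by simp
  have "(A ^\<^sub>m k * A) $$ (i, j) = (\<Sum>l<n. (A ^\<^sub>m k) $$ (i, l) * A $$ (l, j))"
    using Suc.prems by (intro mult_mat_entry[OF P A]) auto
  also have "\<dots> = 0"
  proof (rule sum.neutral, rule ballI)
    fix l assume "l \<in> {..<n}"
    then show "(A ^\<^sub>m k) $$ (i, l) * A $$ (l, j) = 0"
      using Suc s[of l j] by (cases "l = i + k") auto
  qed
  finally show ?case by simp
qed

lemma steinberg_F_transpose: "uact (steinberg p) gF = (uact (steinberg p) gE)\<^sup>T"
  by (auto simp: steinberg_act intro!: eq_matI)

lemma is_umod_steinberg:
  assumes p: "p \<ge> 2"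
  shows "is_umod p (steinberg p)"
proof -
  define E F K L where w: "E = uact (steinberg p) gE" "F = uact (steinberg p) gF"
    "K = uact (steinberg p) gK" "L = uact (steinberg p) gKinv"
  have c: "E \<in> carrier_mat p p" "F \<in> carrier_mat p p" "K \<in> carrier_mat p p" "L \<in> carrier_mat p p"
    by (simp_all add: w steinberg_act)
  note wa = w[unfolded steinberg_act]
  define q where "q = qroot p"
  have q: "q \<noteq> 0" by (simp add: q_def)
  have Ei: "E $$ (i, j) = (if j = Suc i then qint p j else 0)" and Fi: "F $$ (i, j) = (if i = Suc j then qint p i else 0)"
    if "i < p" "j < p" for i j using that by (simp_all add: wa)
  have Ki: "K $$ (i, j) = (if i = j then steinberg_weight p i else 0)"
    and Li: "L $$ (i, j) = (if i = j then inverse (steinberg_weight p i) else 0)"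
    if "i < p" "j < p" for i j using that by (simp_all add: wa)
  have Ep: "E ^\<^sub>m p = 0\<^sub>m p p"
  proof (rule eq_matI)
    fix i j assume "i < dim_row (0\<^sub>m p p)" "j < dim_col (0\<^sub>m p p)"
    then show "(E ^\<^sub>m p) $$ (i, j) = 0\<^sub>m p p $$ (i, j)"
      by (subst shift_mat_pow[OF c(1)]) (auto simp: Ei)
  qed (use c in auto)
  have FT: "F = E\<^sup>T" unfolding w by (rule steinberg_F_transpose)
  have Kd: "(A * K) $$ (i, j) = A $$ (i, j) * steinberg_weight p j" "(K * A) $$ (i, j) = steinberg_weight p i * A $$ (i, j)"
    "(A * L) $$ (i, j) = A $$ (i, j) * inverse (steinberg_weight p j)" "(L * A) $$ (i, j) = inverse (steinberg_weight p i) * A $$ (i, j)"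
    if "A \<in> carrier_mat p p" "i < p" "j < p" for A i j
    unfolding wa by (rule mat_mult_diag[OF that])+
  have KA: "K * A \<in> carrier_mat p p" if "A \<in> carrier_mat p p" for A using c that by auto
  show ?thesis
    unfolding is_umod_iff steinberg_dim w[symmetric] q_def[symmetric]
  proof (intro conjI allI)
    show "uact (steinberg p) x \<in> carrier_mat p p" for x using steinberg_carrier[of p x] by simp
    show "E ^\<^sub>m p = 0\<^sub>m p p" by (rule Ep)
    show "F ^\<^sub>m p = 0\<^sub>m p p" unfolding FT mat_pow_transpose[OF c(1)] Ep by simp
    show "K ^\<^sub>m (2 * p) = 1\<^sub>m p"
      unfolding wa diag_mat_pow using steinberg_weight_pow[of p] p by (auto intro!: eq_matI)
    show "K * L = 1\<^sub>m p" "L * K = 1\<^sub>m p"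
      using c by (auto simp: Kd(1,3) Ki Li intro!: eq_matI simp del: index_mult_mat(1))
    show "K * E * L = q ^ 2 \<cdot>\<^sub>m E"
    proof (rule eq_matI)
      fix i j assume "i < dim_row (q ^ 2 \<cdot>\<^sub>m E)" "j < dim_col (q ^ 2 \<cdot>\<^sub>m E)"
      then have ij: "i < p" "j < p" using c by auto
      then show "(K * E * L) $$ (i, j) = (q ^ 2 \<cdot>\<^sub>m E) $$ (i, j)"
        using c q KA[OF c(1)] by (auto simp: Kd Ei steinberg_weight_Suc q_def[symmetric] field_simps simp del: index_mult_mat(1))
    qed (use c in auto)
    show "K * F * L = inverse (q ^ 2) \<cdot>\<^sub>m F"
    proof (rule eq_matI)
      fix i j assume "i < dim_row (inverse (q ^ 2) \<cdot>\<^sub>m F)" "j < dim_col (inverse (q ^ 2) \<cdot>\<^sub>m F)"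
      then have ij: "i < p" "j < p" using c by auto
      then show "(K * F * L) $$ (i, j) = (inverse (q ^ 2) \<cdot>\<^sub>m F) $$ (i, j)"
        using c q KA[OF c(2)] by (auto simp: Kd Fi steinberg_weight_Suc q_def[symmetric] field_simps simp del: index_mult_mat(1))
    qed (use c in auto)
    show "E * F - F * E = inverse (q - inverse q) \<cdot>\<^sub>m (K - L)"
    proof (rule eq_matI)
      fix i j assume "i < dim_row (inverse (q - inverse q) \<cdot>\<^sub>m (K - L))" "j < dim_col (inverse (q - inverse q) \<cdot>\<^sub>m (K - L))"
      then have ij: "i < p" "j < p" using c by auto
      have "(E * F) $$ (i, j) = (\<Sum>k<p. if k = Suc i then (if i = j then qint p (Suc i) ^ 2 else 0) else 0)"
        unfolding mult_mat_entry[OF c(1,2) ij]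
        by (rule sum.cong) (use ij in \<open>auto simp: Ei Fi power2_eq_square\<close>)
      \<comment> \<open>at the upper end \<open>F e\<^sub>p\<^sub>-\<^sub>1 = 0\<close> agrees with the formula because \<open>[p] = 0\<close>\<close>
      also have "\<dots> = (if i = j then qint p (Suc i) ^ 2 else 0)"
      proof (cases "Suc i < p")
        case False
        then have "Suc i = p" using ij by simp
        then show ?thesis using qint_p[of p] p by (auto simp: sum.delta)
      qed (auto simp: sum.delta)
      finally have EF: "(E * F) $$ (i, j) = (if i = j then qint p (Suc i) ^ 2 else 0)" .
      have "(F * E) $$ (i, j) = (\<Sum>k<p. if k = i - 1 then (if i = j then qint p i ^ 2 else 0) else 0)"
        unfolding mult_mat_entry[OF c(2,1) ij]
        by (rule sum.cong, simp, cases i) (use ij in \<open>auto simp: Ei Fi power2_eq_square\<close>)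
      also have "\<dots> = (if i = j then qint p i ^ 2 else 0)"
        using ij by (auto simp: sum.delta)
      finally have FE: "(F * E) $$ (i, j) = (if i = j then qint p i ^ 2 else 0)" .
      have "(E * F - F * E) $$ (i, j) = (E * F) $$ (i, j) - (F * E) $$ (i, j)" using c ij by simp
      also have "\<dots> = (if i = j then (steinberg_weight p i - inverse (steinberg_weight p i)) / (q - inverse q) else 0)"
        unfolding EF FE using qint_square_diff[OF p, of i]
        by (auto simp: steinberg_weight_def q_def power_inverse)
      also have "\<dots> = (inverse (q - inverse q) \<cdot>\<^sub>m (K - L)) $$ (i, j)"
        using c ij by (simp add: wa divide_inverse)
      finally show "(E * F - F * E) $$ (i, j) = (inverse (q - inverse q) \<cdot>\<^sub>m (K - L)) $$ (i, j)" .
    qed (use c in auto)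
  qed
qed

definition qfact :: "nat \<Rightarrow> nat \<Rightarrow> complex" where
  "qfact p k = (\<Prod>i=1..k. qint p i)"

lemma qfact_0 [simp]: "qfact p 0 = 1"
  by (simp add: qfact_def)

lemma qfact_Suc: "qfact p (Suc k) = qint p (Suc k) * qfact p k"
  by (simp add: qfact_def mult.commute)

lemma qfact_nonzero: "k < p \<Longrightarrow> qfact p k \<noteq> 0"
  by (induction k) (auto simp: qfact_Suc qint_nonzero)

lemma smult_mat_mult_vec:
  "A \<in> carrier_mat n m \<Longrightarrow> v \<in> carrier_vec m \<Longrightarrow> (a \<cdot>\<^sub>m A) *\<^sub>v v = a \<cdot>\<^sub>v (A *\<^sub>v v :: complex vec)"
  by (intro eq_vecI) (auto simp: scalar_prod_def sum_distrib_left mult.assoc)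

lemma mult_mat_vec_entry:
  assumes "A \<in> carrier_mat n m" "v \<in> carrier_vec m" "i < n"
  shows "(A *\<^sub>v v) $ i = (\<Sum>k<m. A $$ (i, k) * v $ k)"
  using assms by (auto simp: scalar_prod_def atLeast0LessThan)

lemma mult_mat_unit_vec:
  "A \<in> carrier_mat n m \<Longrightarrow> i < m \<Longrightarrow> A *\<^sub>v unit_vec m i = col (A :: complex mat) i"
  by (intro eq_vecI) auto

text \<open>
  Highest weight vectors of the weight \<open>q\<^sup>p\<^sup>-\<^sup>1\<close> of the Steinberg module, with \<open>0\<close>
  included: they are the images of \<open>e\<^sub>0\<close> under homomorphisms.
\<close>

definition highest_weight :: "nat \<Rightarrow> umod \<Rightarrow> complex vec \<Rightarrow> bool" where
  "highest_weight p X x \<longleftrightarrow> x \<in> carrier_vec (udim X) \<and> uact X gE *\<^sub>v x = 0\<^sub>v (udim X) \<and>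
     uact X gK *\<^sub>v x = qroot p ^ (p - 1) \<cdot>\<^sub>v x"

lemma highest_weight_act:
  assumes p: "p \<ge> 2" and X: "is_umod p X" and x: "highest_weight p X x"
  defines "y \<equiv> \<lambda>i. (uact X gF ^\<^sub>m i) *\<^sub>v x"
  shows "y i \<in> carrier_vec (udim X)"
    "uact X gF *\<^sub>v y i = y (Suc i)"
    "uact X gK *\<^sub>v y i = steinberg_weight p i \<cdot>\<^sub>v y i"
    "uact X gKinv *\<^sub>v y i = inverse (steinberg_weight p i) \<cdot>\<^sub>v y i"
    "uact X gE *\<^sub>v y i = qint p i ^ 2 \<cdot>\<^sub>v y (i - 1)"
    "(uact X gE ^\<^sub>m i) *\<^sub>v y i = qfact p i ^ 2 \<cdot>\<^sub>v x"
proof -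
  define n where d: "n = udim X"
  define q where "q = qroot p"
  define E F K L where w: "E = uact X gE" "F = uact X gF" "K = uact X gK" "L = uact X gKinv"
  note r = is_umodD[OF X, folded d w q_def]
  note k = is_umod_K_commute[OF X, folded w q_def]
  have c: "E \<in> carrier_mat n n" "F \<in> carrier_mat n n" "K \<in> carrier_mat n n" "L \<in> carrier_mat n n"
    unfolding w using r(1) by blast+
  note x' = x[unfolded highest_weight_def, folded d w q_def]
  have Fi: "F ^\<^sub>m i \<in> carrier_mat n n" for i using c by simp
  have yc: "y i \<in> carrier_vec n" for i
    unfolding y_def w[symmetric] using Fi[of i] x' by auto
  have yS: "F *\<^sub>v y i = y (Suc i)" for i
    unfolding y_def w[symmetric] pow_mat_Suc_left[OF c(2)]
    using assoc_mult_mat_vec[OF c(2) Fi] x' by simp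
  have y0: "y 0 = x" unfolding y_def w[symmetric] using c x' by simp
  have yK: "K *\<^sub>v y i = steinberg_weight p i \<cdot>\<^sub>v y i" for i
  proof (induction i)
    case 0
    then show ?case using x' by (simp add: y0 steinberg_weight_def q_def)
  next
    case (Suc i)
    have "K *\<^sub>v y (Suc i) = (K * F) *\<^sub>v y i"
      unfolding yS[symmetric] using assoc_mult_mat_vec[OF c(3,2) yc] by simp
    also have "\<dots> = inverse (q ^ 2) \<cdot>\<^sub>v ((F * K) *\<^sub>v y i)"
      unfolding k(2) using c yc[of i] by (auto simp: smult_mat_mult_vec[of _ n n])
    also have "(F * K) *\<^sub>v y i = steinberg_weight p i \<cdot>\<^sub>v y (Suc i)"
      unfolding assoc_mult_mat_vec[OF c(2,3) yc] Suc mult_mat_vec[OF c(2) yc] yS ..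
    finally show ?case by (simp add: smult_smult_assoc steinberg_weight_Suc q_def)
  qed
  have yL: "L *\<^sub>v y i = inverse (steinberg_weight p i) \<cdot>\<^sub>v y i" for i
  proof -
    have "y i = (L * K) *\<^sub>v y i" unfolding r(6) using yc[of i] by simp
    also have "\<dots> = steinberg_weight p i \<cdot>\<^sub>v (L *\<^sub>v y i)"
      unfolding assoc_mult_mat_vec[OF c(4,3) yc] yK mult_mat_vec[OF c(4) yc] ..
    finally have "inverse (steinberg_weight p i) \<cdot>\<^sub>v y i
      = inverse (steinberg_weight p i) \<cdot>\<^sub>v (steinberg_weight p i \<cdot>\<^sub>v (L *\<^sub>v y i))" by simp
    then show ?thesis by (simp add: smult_smult_assoc)
  qed
  have yE: "E *\<^sub>v y i = qint p i ^ 2 \<cdot>\<^sub>v y (i - 1)" for i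
  proof (induction i)
    case 0
    then show ?case using x' yc[of 0] by (auto simp: y0)
  next
    case (Suc i)
    define s where "s = inverse (q - inverse q)"
    have "E *\<^sub>v y (Suc i) = (E * F) *\<^sub>v y i"
      unfolding yS[symmetric] using assoc_mult_mat_vec[OF c(1,2) yc] by simp
    also have "E * F = F * E + s \<cdot>\<^sub>m (K - L)"
      unfolding s_def r(9)[symmetric] using c by (intro eq_matI) auto
    also have "(F * E + s \<cdot>\<^sub>m (K - L)) *\<^sub>v y i = (F * E) *\<^sub>v y i + s \<cdot>\<^sub>v (K *\<^sub>v y i - L *\<^sub>v y i)"
    proof -
      have "F * E \<in> carrier_mat n n" "s \<cdot>\<^sub>m (K - L) \<in> carrier_mat n n" "K - L \<in> carrier_mat n n"
        using c by (auto intro: minus_carrier_mat)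
      then show ?thesis
        using add_mult_distrib_mat_vec[of "F * E" n n "s \<cdot>\<^sub>m (K - L)" "y i"] smult_mat_mult_vec[of "K - L" n n "y i" s]
          minus_mult_distrib_mat_vec[OF c(3,4), of "y i"] yc[of i] by (simp del: assoc_mult_mat_vec)
    qed
    also have "(F * E) *\<^sub>v y i = qint p i ^ 2 \<cdot>\<^sub>v y i"
    proof (cases i)
      case 0
      then show ?thesis using assoc_mult_mat_vec[OF c(2,1) yc] x' yc[of 0] c by (auto simp: y0)
    next
      case (Suc j)
      then show ?thesis
        unfolding assoc_mult_mat_vec[OF c(2,1) yc] \<open>E *\<^sub>v y i = qint p i ^ 2 \<cdot>\<^sub>v y (i - 1)\<close> mult_mat_vec[OF c(2) yc] yS by simp
    qed
    also have "qint p i ^ 2 \<cdot>\<^sub>v y i + s \<cdot>\<^sub>v (K *\<^sub>v y i - L *\<^sub>v y i)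
      = (qint p i ^ 2 + s * (steinberg_weight p i - inverse (steinberg_weight p i))) \<cdot>\<^sub>v y i"
      unfolding yK yL using yc[of i] by (intro eq_vecI) (auto simp: algebra_simps)
    also have "qint p i ^ 2 + s * (steinberg_weight p i - inverse (steinberg_weight p i)) = qint p (Suc i) ^ 2"
      using qint_square_diff[OF p, of i]
      by (simp add: s_def steinberg_weight_def q_def divide_inverse power_inverse algebra_simps)
    finally show ?case by simp
  qed
  have "(E ^\<^sub>m i) *\<^sub>v y i = qfact p i ^ 2 \<cdot>\<^sub>v x" for i
  proof (induction i)
    case 0
    then show ?case using c x' by (simp add: y0)
  next
    case (Suc i)
    have Ei: "E ^\<^sub>m i \<in> carrier_mat n n" using c by simp
    have "(E ^\<^sub>m Suc i) *\<^sub>v y (Suc i) = E ^\<^sub>m i *\<^sub>v (E *\<^sub>v y (Suc i))"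
      unfolding pow_mat.simps using assoc_mult_mat_vec[OF Ei c(1) yc] .
    also have "\<dots> = qint p (Suc i) ^ 2 \<cdot>\<^sub>v (qfact p i ^ 2 \<cdot>\<^sub>v x)"
      unfolding yE mult_mat_vec[OF Ei yc] using Suc by simp
    finally show ?case by (simp add: smult_smult_assoc qfact_Suc power_mult_distrib)
  qed
  then show "y i \<in> carrier_vec (udim X)"
    "uact X gF *\<^sub>v y i = y (Suc i)"
    "uact X gK *\<^sub>v y i = steinberg_weight p i \<cdot>\<^sub>v y i"
    "uact X gKinv *\<^sub>v y i = inverse (steinberg_weight p i) \<cdot>\<^sub>v y i"
    "uact X gE *\<^sub>v y i = qint p i ^ 2 \<cdot>\<^sub>v y (i - 1)"
    "(uact X gE ^\<^sub>m i) *\<^sub>v y i = qfact p i ^ 2 \<cdot>\<^sub>v x"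
    unfolding w[symmetric] d[symmetric] using yc yS yK yL yE by blast+
qed

text \<open>
  The Steinberg module is the universal highest weight module of its weight, because
  \<open>F\<^sup>p = 0\<close> holds in every module; the homomorphism sends \<open>e\<^sub>i\<close> to \<open>F\<^sup>i x / [i]!\<close>.
\<close>

lemma steinberg_hom_exists:
  assumes p: "p \<ge> 2" and X: "is_umod p X" and x: "highest_weight p X x"
  obtains h where "h \<in> uhom (steinberg p) X" "h *\<^sub>v unit_vec p 0 = x"
proof -
  define n where d: "n = udim X"
  define y where "y i = (uact X gF ^\<^sub>m i) *\<^sub>v x" for i
  note hw = highest_weight_act[OF p X x, folded y_def d]
  note c = is_umodD(1)[OF X, folded d]
  have xc: "x \<in> carrier_vec n" using x by (simp add: highest_weight_def d)
  define h where "h = mat n p (\<lambda>(r, i). y i $ r / qfact p i)"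
  have h: "h \<in> carrier_mat n p" by (simp add: h_def)
  have sc: "uact (steinberg p) a \<in> carrier_mat p p" for a using steinberg_carrier[of p a] by simp
  have rhs: "(uact X a * h) $$ (r, i) = (uact X a *\<^sub>v y i) $ r / qfact p i" if "r < n" "i < p" for a r i
    using that hw(1)[of i] mult_mat_entry[OF c[of a] h that] mult_mat_vec_entry[OF c[of a] hw(1) that(1)]
    by (auto simp: h_def sum_divide_distrib intro!: sum.cong simp del: index_mult_mat)
  have y_dim: "dim_vec (y i) = n" for i using hw(1)[of i] by simp
  have hom: "h * uact (steinberg p) a = uact X a * h" for a
  proof (rule eq_matI)
    fix r i assume "r < dim_row (uact X a * h)" "i < dim_col (uact X a * h)"
    then have ri: "r < n" "i < p" using h c[of a] by auto
    note lhs = mult_mat_entry[OF h sc[of a] ri]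
    have "(h * uact (steinberg p) a) $$ (r, i) = (uact X a *\<^sub>v y i) $ r / qfact p i"
    proof (cases a)
      case gE
      have "(h * uact (steinberg p) a) $$ (r, i) = (\<Sum>k<p. if k = i - 1 then y (i - 1) $ r / qfact p (i - 1) * qint p i else 0)"
        unfolding lhs using ri by (intro sum.cong refl, cases i) (auto simp: gE steinberg_act h_def)
      also have "\<dots> = qint p i ^ 2 * y (i - 1) $ r / qfact p i"
      proof (cases i)
        case (Suc j)
        then show ?thesis using ri qint_nonzero[of i p] by (simp add: qfact_Suc power2_eq_square)
      qed simp
      finally show ?thesis using ri hw(5)[of i] y_dim by (simp add: gE)
    next
      case gF
      have "(h * uact (steinberg p) a) $$ (r, i) = (\<Sum>k<p. if k = Suc i then y (Suc i) $ r / qfact p i else 0)"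
        unfolding lhs using ri qint_nonzero[of "Suc i" p]
        by (intro sum.cong refl) (auto simp: gF steinberg_act h_def qfact_Suc)
      also have "\<dots> = y (Suc i) $ r / qfact p i"
      proof (cases "Suc i < p")
        case False
        then have "Suc i = p" using ri by simp
        then have "y (Suc i) = 0\<^sub>v n"
          unfolding y_def using is_umodD(3)[OF X] xc by (auto simp: d intro!: eq_vecI)
        then show ?thesis using ri by simp
      qed simp
      finally show ?thesis using hw(2)[of i] by (simp add: gF)
    next
      case gK
      have "(h * uact (steinberg p) a) $$ (r, i) = (\<Sum>k<p. if k = i then y i $ r / qfact p i * steinberg_weight p i else 0)"
        unfolding lhs using ri by (intro sum.cong refl) (auto simp: gK steinberg_act h_def)
      then show ?thesis using ri hw(3)[of i] y_dim by (simp add: gK)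
    next
      case gKinv
      have "(h * uact (steinberg p) a) $$ (r, i) = (\<Sum>k<p. if k = i then y i $ r / qfact p i * inverse (steinberg_weight p i) else 0)"
        unfolding lhs using ri by (intro sum.cong refl) (auto simp: gKinv steinberg_act h_def)
      then show ?thesis using ri hw(4)[of i] y_dim by (simp add: gKinv)
    qed
    then show "(h * uact (steinberg p) a) $$ (r, i) = (uact X a * h) $$ (r, i)"
      unfolding rhs[OF ri] .
  qed (use h carrier_matD[OF c] carrier_matD[OF sc] in auto)
  have "h *\<^sub>v unit_vec p 0 = col h 0"
    using h p by (intro mult_mat_unit_vec) auto
  also have "\<dots> = x"
    using p xc carrier_matD[OF c] by (intro eq_vecI) (auto simp: h_def y_def)
  finally have "h *\<^sub>v unit_vec p 0 = x" .
  with hom h show thesis by (intro that uhomI) (auto simp: d)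
qed

text \<open>
  The sum \<open>1 + A + \<dots> + A\<^sup>k\<^sup>-\<^sup>1\<close>.  If \<open>A\<^sup>k = 1\<close>, it is \<open>k\<close> times the projection
  onto the fixed vectors of \<open>A\<close>.
\<close>

fun geom_mat :: "complex mat \<Rightarrow> nat \<Rightarrow> complex mat" where
  "geom_mat A 0 = 0\<^sub>m (dim_row A) (dim_row A)"
| "geom_mat A (Suc k) = A * geom_mat A k + 1\<^sub>m (dim_row A)"

lemma geom_mat_carrier [simp]: "A \<in> carrier_mat n n \<Longrightarrow> geom_mat A k \<in> carrier_mat n n"
  by (induction k) auto

lemma geom_mat_step:
  assumes A: "A \<in> carrier_mat n n"
  shows "A * geom_mat A k + 1\<^sub>m n = geom_mat A k + A ^\<^sub>m k"
proof (induction k)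
  case 0
  show ?case using A by auto
next
  case (Suc k)
  have g: "geom_mat A k \<in> carrier_mat n n" "A ^\<^sub>m k \<in> carrier_mat n n" using A by auto
  have "A * geom_mat A (Suc k) + 1\<^sub>m n = A * (geom_mat A k + A ^\<^sub>m k) + 1\<^sub>m n"
    using A Suc by simp
  also have "\<dots> = (A * geom_mat A k + A * A ^\<^sub>m k) + 1\<^sub>m n"
    using mult_add_distrib_mat[OF A g] by simp
  also have "\<dots> = (A * geom_mat A k + 1\<^sub>m n) + A * A ^\<^sub>m k"
  proof -
    have "A * geom_mat A k \<in> carrier_mat n n" "A * A ^\<^sub>m k \<in> carrier_mat n n" "1\<^sub>m n \<in> carrier_mat n n"
      using A g by auto
    note c = this
    show ?thesis
      unfolding assoc_add_mat[OF c(1) c(2) c(3)] comm_add_mat[OF c(2) c(3)] assoc_add_mat[OF c(1) c(3) c(2)] ..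
  qed
  finally show ?case using A unfolding pow_mat_Suc_left[OF A] by simp
qed

lemma geom_mat_fixed:
  assumes A: "A \<in> carrier_mat n n" and k: "A ^\<^sub>m k = 1\<^sub>m n"
  shows "A * geom_mat A k = geom_mat A k"
proof (rule eq_matI)
  fix i j assume ij: "i < dim_row (geom_mat A k)" "j < dim_col (geom_mat A k)"
  have c: "geom_mat A k \<in> carrier_mat n n" using A by simp
  have "(A * geom_mat A k + 1\<^sub>m n) $$ (i, j) = (geom_mat A k + 1\<^sub>m n) $$ (i, j)"
    unfolding geom_mat_step[OF A] k ..
  then show "(A * geom_mat A k) $$ (i, j) = geom_mat A k $$ (i, j)"
    using A ij carrier_matD[OF c] by (simp del: index_mult_mat(1))
qed (use A carrier_matD[OF geom_mat_carrier[OF A]] in auto)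

lemma geom_mat_intertwine:
  assumes A: "A \<in> carrier_mat n n" and B: "B \<in> carrier_mat m m" and f: "f \<in> carrier_mat m n" and c: "f * A = B * f"
  shows "f * geom_mat A k = geom_mat B k * f"
proof (induction k)
  case 0
  show ?case using A B f by auto
next
  case (Suc k)
  have g: "geom_mat A k \<in> carrier_mat n n" "geom_mat B k \<in> carrier_mat m m" using A B by auto
  have "f * geom_mat A (Suc k) = f * (A * geom_mat A k) + f"
    using A f g by (simp add: mult_add_distrib_mat[of f m n _ n])
  also have "f * (A * geom_mat A k) = B * (f * geom_mat A k)"
    using A B f g by (simp add: assoc_mult_mat[of f m n A n _ n, symmetric] c assoc_mult_mat[of B m m f n _ n])
  also have "\<dots> = B * geom_mat B k * f"
    unfolding Suc using B f g by (simp add: assoc_mult_mat[of B m m _ m f n])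
  also have "B * geom_mat B k * f + f = geom_mat B (Suc k) * f"
    using B f g by (simp add: add_mult_distrib_mat[of _ m m _ f n])
  finally show ?case .
qed

lemma geom_mat_fixed_vec:
  assumes A: "A \<in> carrier_mat n n" and v: "v \<in> carrier_vec n" "A *\<^sub>v v = v"
  shows "geom_mat A k *\<^sub>v v = of_nat k \<cdot>\<^sub>v v"
proof (induction k)
  case 0
  show ?case using A v by (auto intro!: eq_vecI)
next
  case (Suc k)
  have g: "geom_mat A k \<in> carrier_mat n n" using A by auto
  have "geom_mat A (Suc k) *\<^sub>v v = (A * geom_mat A k) *\<^sub>v v + v"
    using A g v add_mult_distrib_mat_vec[of "A * geom_mat A k" n n "1\<^sub>m n" v] by simp
  also have "(A * geom_mat A k) *\<^sub>v v = of_nat k \<cdot>\<^sub>v v"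
    using assoc_mult_mat_vec[OF A g v(1)] Suc mult_mat_vec[OF A v(1)] v(2) by simp
  finally show ?case using v by (auto simp: algebra_simps)
qed

text \<open>
  Up to a factor, the projection onto the weight space of \<open>q\<^sup>p\<^sup>-\<^sup>1\<close> followed by
  \<open>F\<^sup>p\<^sup>-\<^sup>1\<close> and \<open>E\<^sup>p\<^sup>-\<^sup>1\<close>.  This map commutes with homomorphisms.  Its values are highest weight
  vectors because of \<open>E\<^sup>p = 0\<close>, and on highest weight vectors it is multiplication by
  \<open>2 p ([p - 1]!)\<^sup>2\<close>, which is not zero.  Thus it lifts highest weight vectors along surjections.
\<close>

definition hw_map :: "nat \<Rightarrow> umod \<Rightarrow> complex mat" where
  "hw_map p X = uact X gE ^\<^sub>m (p - 1) * (uact X gF ^\<^sub>m (p - 1) *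
     geom_mat (inverse (qroot p ^ (p - 1)) \<cdot>\<^sub>m uact X gK) (2 * p))"

lemma hw_map_carrier:
  assumes "\<And>x. uact X x \<in> carrier_mat (udim X) (udim X)"
  shows "hw_map p X \<in> carrier_mat (udim X) (udim X)"
  unfolding hw_map_def using assms
  by (intro mult_carrier_mat[of _ _ "udim X"] pow_carrier_mat geom_mat_carrier) auto

lemma uhom_pow:
  assumes f: "f \<in> carrier_mat m n" and A: "A \<in> carrier_mat n n" and B: "B \<in> carrier_mat m m" and c: "f * A = B * f"
  shows "f * A ^\<^sub>m k = B ^\<^sub>m k * (f :: complex mat)"
proof (induction k)
  case (Suc k)
  have P: "A ^\<^sub>m k \<in> carrier_mat n n" "B ^\<^sub>m k \<in> carrier_mat m m" using A B by auto
  have "f * A ^\<^sub>m Suc k = B ^\<^sub>m k * f * A"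
    using Suc assoc_mult_mat[OF f P(1) A] by simp
  also have "\<dots> = B ^\<^sub>m Suc k * f"
    using assoc_mult_mat[OF P(2) f A] assoc_mult_mat[OF P(2) B f] c by simp
  finally show ?case .
qed (use f A B in simp)

lemma hw_map_intertwine:
  assumes cX: "\<And>x. uact X x \<in> carrier_mat (udim X) (udim X)" and cY: "\<And>x. uact Y x \<in> carrier_mat (udim Y) (udim Y)"
    and f: "f \<in> uhom X Y"
  shows "f * hw_map p X = hw_map p Y * f"
proof -
  define n m where d: "n = udim X" "m = udim Y"
  note F = uhomD[OF f, folded d] and c = cX[folded d] cY[folded d]
  define a where "a = inverse (qroot p ^ (p - 1))"
  define SX SY where S: "SX = geom_mat (a \<cdot>\<^sub>m uact X gK) (2 * p)" "SY = geom_mat (a \<cdot>\<^sub>m uact Y gK) (2 * p)"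
  have SC: "SX \<in> carrier_mat n n" "SY \<in> carrier_mat m m" unfolding S using c by auto
  have fS: "f * SX = SY * f"
    unfolding S using c F
    by (intro geom_mat_intertwine[of _ n _ m]) (auto simp: mult_smult_distrib[of f m n _ n] mult_smult_assoc_mat[of _ m m f n])
  have P: "uact X x ^\<^sub>m k \<in> carrier_mat n n" "uact Y x ^\<^sub>m k \<in> carrier_mat m m" for x k using c by auto
  note pw = uhom_pow[OF F(1) c(1) c(2) F(2)]
  have "f * hw_map p X = (f * uact X gE ^\<^sub>m (p - 1)) * (uact X gF ^\<^sub>m (p - 1) * SX)"
    unfolding hw_map_def a_def[symmetric] S[symmetric]
    by (rule assoc_mult_mat[OF F(1) P(1) mult_carrier_mat[OF P(1) SC(1)], symmetric])
  also have "\<dots> = uact Y gE ^\<^sub>m (p - 1) * (f * (uact X gF ^\<^sub>m (p - 1) * SX))"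
    unfolding pw by (rule assoc_mult_mat[OF P(2) F(1) mult_carrier_mat[OF P(1) SC(1)]])
  also have "f * (uact X gF ^\<^sub>m (p - 1) * SX) = (f * uact X gF ^\<^sub>m (p - 1)) * SX"
    by (rule assoc_mult_mat[OF F(1) P(1) SC(1), symmetric])
  also have "\<dots> = uact Y gF ^\<^sub>m (p - 1) * (f * SX)"
    unfolding pw by (rule assoc_mult_mat[OF P(2) F(1) SC(1)])
  also have "\<dots> = (uact Y gF ^\<^sub>m (p - 1) * SY) * f"
    unfolding fS by (rule assoc_mult_mat[OF P(2) SC(2) F(1), symmetric])
  also have "uact Y gE ^\<^sub>m (p - 1) * ((uact Y gF ^\<^sub>m (p - 1) * SY) * f) = hw_map p Y * f"
    unfolding hw_map_def a_def[symmetric] S[symmetric]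
    by (rule assoc_mult_mat[OF P(2) mult_carrier_mat[OF P(2) SC(2)] F(1), symmetric])
  finally show ?thesis .
qed

lemma hw_map_highest_weight:
  assumes p: "p \<ge> 2" and X: "is_umod p X" and v: "v \<in> carrier_vec (udim X)"
  shows "highest_weight p X (hw_map p X *\<^sub>v v)"
proof -
  define n where d: "n = udim X"
  define q where "q = qroot p"
  define lam where "lam = q ^ (p - 1)"
  have lam: "lam \<noteq> 0" by (simp add: lam_def q_def)
  define E F K where w: "E = uact X gE" "F = uact X gF" "K = uact X gK"
  note r = is_umodD[OF X, folded d w q_def]
  note k = is_umod_K_commute[OF X, folded w q_def]
  have c: "E \<in> carrier_mat n n" "F \<in> carrier_mat n n" "K \<in> carrier_mat n n"
    unfolding w using r(1) by blast+
  define A where "A = inverse lam \<cdot>\<^sub>m K"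
  have A: "A \<in> carrier_mat n n" using c by (simp add: A_def)
  have "inverse lam ^ (2 * p) = 1"
  proof -
    have "lam ^ (2 * p) = (q ^ (2 * p)) ^ (p - 1)" unfolding lam_def by (metis mult.commute power_mult)
    then show ?thesis using qroot_pow_2p[of p] p by (simp add: q_def power_inverse)
  qed
  then have Ap: "A ^\<^sub>m (2 * p) = 1\<^sub>m n"
    unfolding A_def mat_pow_smult[OF c(3)] r(4) by (simp add: one_smult_mat)
  define S where "S = geom_mat A (2 * p)"
  have S: "S \<in> carrier_mat n n" using A by (simp add: S_def)
  have KS: "K * S = lam \<cdot>\<^sub>m S"
  proof -
    have "K = lam \<cdot>\<^sub>m A" using lam by (simp add: A_def smult_smult_mat one_smult_mat)
    then have "K * S = lam \<cdot>\<^sub>m (A * S)" using A S by (simp add: mult_smult_assoc_mat[of _ n n _ n])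
    then show ?thesis unfolding S_def geom_mat_fixed[OF A Ap] .
  qed
  define EE FF where "EE = E ^\<^sub>m (p - 1)" and "FF = F ^\<^sub>m (p - 1)"
  have P: "EE \<in> carrier_mat n n" "FF \<in> carrier_mat n n" using c by (auto simp: EE_def FF_def)
  have KE: "K * EE = (q ^ 2) ^ (p - 1) \<cdot>\<^sub>m (EE * K)" and KF: "K * FF = inverse (q ^ 2) ^ (p - 1) \<cdot>\<^sub>m (FF * K)"
    unfolding EE_def FF_def using q_commute_pow[OF c(1,3) k(1)] q_commute_pow[OF c(2,3) k(2)] by simp_all
  have T: "hw_map p X = EE * (FF * S)"
    unfolding hw_map_def EE_def FF_def S_def A_def lam_def w q_def ..
  have FS: "FF * S \<in> carrier_mat n n" using P S by auto
  have TC: "EE * (FF * S) \<in> carrier_mat n n" using P FS by auto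
  have "K * (EE * (FF * S)) = (K * EE) * (FF * S)"
    by (rule assoc_mult_mat[OF c(3) P(1) FS, symmetric])
  also have "\<dots> = (q ^ 2) ^ (p - 1) \<cdot>\<^sub>m (EE * (K * (FF * S)))"
    unfolding KE using P c FS
    by (simp add: mult_smult_assoc_mat[of _ n n _ n] mult_carrier_mat[of _ n n _ n] assoc_mult_mat[OF P(1) c(3) FS])
  also have "K * (FF * S) = (K * FF) * S"
    by (rule assoc_mult_mat[OF c(3) P(2) S, symmetric])
  also have "\<dots> = inverse (q ^ 2) ^ (p - 1) \<cdot>\<^sub>m (FF * (K * S))"
    unfolding KF using P c S
    by (simp add: mult_smult_assoc_mat[of _ n n _ n] mult_carrier_mat[of _ n n _ n] assoc_mult_mat[OF P(2) c(3) S])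
  also have "\<dots> = (inverse (q ^ 2) ^ (p - 1) * lam) \<cdot>\<^sub>m (FF * S)"
    unfolding KS using P S by (simp add: mult_smult_distrib[of _ n n _ n] smult_smult_mat)
  also have "(q ^ 2) ^ (p - 1) \<cdot>\<^sub>m (EE * ((inverse (q ^ 2) ^ (p - 1) * lam) \<cdot>\<^sub>m (FF * S)))
      = lam \<cdot>\<^sub>m (EE * (FF * S))"
  proof -
    have "(q ^ 2) ^ (p - 1) * (inverse (q ^ 2) ^ (p - 1) * lam) = lam"
      by (simp add: q_def power_inverse mult.assoc[symmetric])
    then show ?thesis
      unfolding mult_smult_distrib[OF P(1) FS] smult_smult_mat by (simp only:)
  qed
  finally have KT: "K * (EE * (FF * S)) = lam \<cdot>\<^sub>m (EE * (FF * S))" .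
  have "E * EE = 0\<^sub>m n n"
    unfolding EE_def pow_mat_Suc_left[OF c(1), symmetric] using r(2) p by (simp del: pow_mat.simps)
  then have ET: "E * (EE * (FF * S)) = 0\<^sub>m n n"
    unfolding assoc_mult_mat[OF c(1) P(1) FS, symmetric] using left_mult_zero_mat[OF FS] by simp
  have v': "v \<in> carrier_vec n" using v by (simp add: d)
  show ?thesis
    unfolding highest_weight_def T d[symmetric] w[symmetric] q_def[symmetric] lam_def[symmetric]
    using TC v' c(3)
    by (auto simp: assoc_mult_mat_vec[OF c(1) TC v', symmetric] assoc_mult_mat_vec[OF c(3) TC v', symmetric]
      ET KT smult_mat_mult_vec[OF TC v'] simp del: assoc_mult_mat_vec intro!: eq_vecI)
qed

lemma hw_map_on_highest_weight:
  assumes p: "p \<ge> 2" and X: "is_umod p X" and x: "highest_weight p X x"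
  shows "hw_map p X *\<^sub>v x = (of_nat (2 * p) * qfact p (p - 1) ^ 2) \<cdot>\<^sub>v x"
proof -
  define n where d: "n = udim X"
  define q where "q = qroot p"
  define lam where "lam = q ^ (p - 1)"
  have lam: "lam \<noteq> 0" by (simp add: lam_def q_def)
  define E F K where w: "E = uact X gE" "F = uact X gF" "K = uact X gK"
  note r = is_umodD[OF X, folded d w q_def]
  note x' = x[unfolded highest_weight_def, folded d w q_def, folded lam_def]
  have xc: "x \<in> carrier_vec n" using x' by simp
  have c: "E \<in> carrier_mat n n" "F \<in> carrier_mat n n" "K \<in> carrier_mat n n"
    unfolding w using r(1) by blast+
  define A where "A = inverse lam \<cdot>\<^sub>m K"
  have A: "A \<in> carrier_mat n n" using c by (simp add: A_def)
  have Ax: "A *\<^sub>v x = x"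
    unfolding A_def smult_mat_mult_vec[OF c(3) xc] using x' lam by (simp add: smult_smult_assoc)
  define S where "S = geom_mat A (2 * p)"
  have S: "S \<in> carrier_mat n n" using A by (simp add: S_def)
  have Sx: "S *\<^sub>v x = of_nat (2 * p) \<cdot>\<^sub>v x"
    unfolding S_def by (rule geom_mat_fixed_vec[OF A xc Ax])
  define EE FF where "EE = E ^\<^sub>m (p - 1)" and "FF = F ^\<^sub>m (p - 1)"
  have P: "EE \<in> carrier_mat n n" "FF \<in> carrier_mat n n" using c by (auto simp: EE_def FF_def)
  have FS: "FF * S \<in> carrier_mat n n" using P S by auto
  have T: "hw_map p X = EE * (FF * S)"
    unfolding hw_map_def EE_def FF_def S_def A_def lam_def w q_def ..
  have Fx: "FF *\<^sub>v x \<in> carrier_vec n" using P xc by auto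
  have "hw_map p X *\<^sub>v x = EE *\<^sub>v (FF *\<^sub>v (S *\<^sub>v x))"
    unfolding T assoc_mult_mat_vec[OF P(1) FS xc] assoc_mult_mat_vec[OF P(2) S xc] ..
  also have "\<dots> = of_nat (2 * p) \<cdot>\<^sub>v (EE *\<^sub>v (FF *\<^sub>v x))"
    unfolding Sx mult_mat_vec[OF P(2) xc] mult_mat_vec[OF P(1) Fx] ..
  also have "EE *\<^sub>v (FF *\<^sub>v x) = qfact p (p - 1) ^ 2 \<cdot>\<^sub>v x"
    unfolding EE_def FF_def w by (rule highest_weight_act(6)[OF p X x])
  finally show ?thesis by (simp add: smult_smult_assoc)
qed

lemma steinberg_highest_weight: "p > 0 \<Longrightarrow> highest_weight p (steinberg p) (unit_vec p 0)"
  unfolding highest_weight_def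
  by (auto simp: steinberg_act steinberg_weight_def intro!: eq_vecI)

lemma steinberg_F_unit_vec:
  assumes "Suc i < p"
  shows "uact (steinberg p) gF *\<^sub>v unit_vec p i = qint p (Suc i) \<cdot>\<^sub>v unit_vec p (Suc i)"
  using assms by (intro eq_vecI) (auto simp: steinberg_act)

lemma steinberg_hom_unique:
  assumes X: "\<And>x. uact X x \<in> carrier_mat (udim X) (udim X)"
    and h: "h \<in> uhom (steinberg p) X" "h' \<in> uhom (steinberg p) X"
    and 0: "h *\<^sub>v unit_vec p 0 = h' *\<^sub>v unit_vec p 0"
  shows "h = h'"
proof -
  define n where d: "n = udim X"
  note H = uhomD[OF h(1), folded d, simplified] and H' = uhomD[OF h(2), folded d, simplified]
  note c = X[folded d]
  have sc: "uact (steinberg p) a \<in> carrier_mat p p" for a using steinberg_carrier[of p a] by simp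
  have "h *\<^sub>v unit_vec p i = h' *\<^sub>v unit_vec p i" if "i < p" for i
    using that
  proof (induction i)
    case (Suc i)
    have step: "qint p (Suc i) \<cdot>\<^sub>v (f *\<^sub>v unit_vec p (Suc i)) = uact X gF *\<^sub>v (f *\<^sub>v unit_vec p i)"
      if f: "f \<in> carrier_mat n p" "\<And>x. f * uact (steinberg p) x = uact X x * f" for f
    proof -
      have "qint p (Suc i) \<cdot>\<^sub>v (f *\<^sub>v unit_vec p (Suc i)) = f *\<^sub>v (uact (steinberg p) gF *\<^sub>v unit_vec p i)"
        unfolding steinberg_F_unit_vec[OF Suc.prems] by (rule mult_mat_vec[OF f(1), symmetric]) simp
      also have "\<dots> = (f * uact (steinberg p) gF) *\<^sub>v unit_vec p i"
        by (rule assoc_mult_mat_vec[OF f(1) sc, symmetric]) simp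
      also have "\<dots> = uact X gF *\<^sub>v (f *\<^sub>v unit_vec p i)"
        unfolding f(2) by (rule assoc_mult_mat_vec[OF c f(1)]) simp
      finally show ?thesis .
    qed
    have "qint p (Suc i) \<cdot>\<^sub>v (h *\<^sub>v unit_vec p (Suc i)) = qint p (Suc i) \<cdot>\<^sub>v (h' *\<^sub>v unit_vec p (Suc i))"
      using step[OF H] step[OF H'] Suc by simp
    then have "inverse (qint p (Suc i)) \<cdot>\<^sub>v (qint p (Suc i) \<cdot>\<^sub>v (h *\<^sub>v unit_vec p (Suc i)))
      = inverse (qint p (Suc i)) \<cdot>\<^sub>v (qint p (Suc i) \<cdot>\<^sub>v (h' *\<^sub>v unit_vec p (Suc i)))" by simp
    then show ?case using qint_nonzero[of "Suc i" p] Suc.prems by (simp add: smult_smult_assoc)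
  qed (use 0 in simp)
  then have cols: "col h i = col h' i" if "i < p" for i
    using that mult_mat_unit_vec[of h n p i] mult_mat_unit_vec[of h' n p i] H(1) H'(1) by simp
  show ?thesis by (rule mat_col_eqI) (use cols H(1) H'(1) in auto)
qed

text \<open>
  A homomorphism out of the Steinberg module is determined by the highest weight vector to which it
  sends \<open>e\<^sub>0\<close>.  To lift it along a surjection, take any preimage of that vector; up to a
  scalar, \<open>hw_map\<close> turns it into a preimage that is a highest weight vector.
\<close>

lemma uprojective_steinberg:
  assumes p: "p \<ge> 2"
  shows "uprojective p (steinberg p)"
  unfolding uprojective_def
proof (intro conjI allI impI)
  show "is_umod p (steinberg p)" by (rule is_umod_steinberg[OF p])
  fix X Y g h
  assume X: "is_umod p X" and Y: "is_umod p Y" and g: "g \<in> uhom X Y" and s: "surj_mat g"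
    and h: "h \<in> uhom (steinberg p) Y"
  define y where "y = h *\<^sub>v unit_vec p 0"
  note G = uhomD[OF g] and H = uhomD[OF h, simplified]
  note cX = is_umodD(1)[OF X] and cY = is_umodD(1)[OF Y]
  have sc: "uact (steinberg p) a \<in> carrier_mat p p" for a using steinberg_carrier[of p a] by simp
  have e: "unit_vec p 0 \<in> carrier_vec p" by simp
  have yc: "y \<in> carrier_vec (udim Y)" using H(1) e by (simp add: y_def)
  have y: "highest_weight p Y y"
  proof -
    have "uact Y x *\<^sub>v y = h *\<^sub>v (uact (steinberg p) x *\<^sub>v unit_vec p 0)" for x
      unfolding y_def assoc_mult_mat_vec[OF cY H(1) e, symmetric] assoc_mult_mat_vec[OF H(1) sc e, symmetric] H(2) ..
    moreover have "h *\<^sub>v 0\<^sub>v p = 0\<^sub>v (udim Y)" using H(1) by (auto intro!: eq_vecI)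
    ultimately show ?thesis
      using steinberg_highest_weight[of p] p yc mult_mat_vec[OF H(1) e]
      by (simp add: highest_weight_def y_def[symmetric] del: assoc_mult_mat_vec)
  qed
  obtain x0 where x0: "x0 \<in> carrier_vec (udim X)" "g *\<^sub>v x0 = y"
    using s G(1) yc unfolding surj_mat_def by auto
  define a where "a = of_nat (2 * p) * qfact p (p - 1) ^ 2"
  have a: "a \<noteq> 0" using p qfact_nonzero[of "p - 1" p] by (simp add: a_def)
  define T where "T = hw_map p X"
  have Tc: "T \<in> carrier_mat (udim X) (udim X)" unfolding T_def by (rule hw_map_carrier[OF cX])
  define x where "x = hw_map p X *\<^sub>v (inverse a \<cdot>\<^sub>v x0)"
  have x: "highest_weight p X x"
    unfolding x_def by (rule hw_map_highest_weight[OF p X]) (use x0 in simp)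
  have gx: "g *\<^sub>v x = y"
  proof -
    have "g *\<^sub>v x = (g * T) *\<^sub>v (inverse a \<cdot>\<^sub>v x0)"
      unfolding x_def T_def[symmetric] by (rule assoc_mult_mat_vec[OF G(1) Tc, symmetric]) (use x0 in simp)
    also have "\<dots> = hw_map p Y *\<^sub>v (g *\<^sub>v (inverse a \<cdot>\<^sub>v x0))"
      unfolding T_def hw_map_intertwine[OF cX cY g]
      by (rule assoc_mult_mat_vec[OF hw_map_carrier[OF cY] G(1)]) (use x0 in simp)
    also have "\<dots> = inverse a \<cdot>\<^sub>v (hw_map p Y *\<^sub>v y)"
      unfolding mult_mat_vec[OF G(1) x0(1)] x0(2) by (rule mult_mat_vec[OF hw_map_carrier[OF cY] yc])
    also have "\<dots> = y"
      unfolding hw_map_on_highest_weight[OF p Y y] a_def[symmetric] using a by (simp add: smult_smult_assoc)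
    finally show ?thesis .
  qed
  obtain k where k: "k \<in> uhom (steinberg p) X" "k *\<^sub>v unit_vec p 0 = x"
    using steinberg_hom_exists[OF p X x] .
  have gk: "g * k \<in> uhom (steinberg p) Y"
    by (rule uhom_comp[OF steinberg_carrier cX cY k(1) g])
  have "g * k = h"
  proof (rule steinberg_hom_unique[OF cY gk h])
    show "(g * k) *\<^sub>v unit_vec p 0 = h *\<^sub>v unit_vec p 0"
      using assoc_mult_mat_vec[OF G(1) uhomD(1)[OF k(1), simplified] e] k(2) gx by (simp add: y_def)
  qed
  then show "\<exists>k\<in>uhom (steinberg p) X. g * k = h" using k(1) by blast
qed

text \<open>
  The contragredient module for the anti-automorphism that exchanges \<open>E\<close> and \<open>F\<close> and fixes
  \<open>K\<close>.  Transposition of matrices reverses homomorphisms.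
\<close>

definition utransp :: "umod \<Rightarrow> umod" where
  "utransp V = \<lparr>udim = udim V, uact = (\<lambda>x. case x of
      gE \<Rightarrow> (uact V gF)\<^sup>T | gF \<Rightarrow> (uact V gE)\<^sup>T | gK \<Rightarrow> (uact V gK)\<^sup>T | gKinv \<Rightarrow> (uact V gKinv)\<^sup>T)\<rparr>"

lemma utransp_simps [simp]: "udim (utransp V) = udim V" "uact (utransp V) gE = (uact V gF)\<^sup>T"
  "uact (utransp V) gF = (uact V gE)\<^sup>T" "uact (utransp V) gK = (uact V gK)\<^sup>T" "uact (utransp V) gKinv = (uact V gKinv)\<^sup>T"
  by (simp_all add: utransp_def)

lemma is_umod_utransp:
  assumes V: "is_umod p V"
  shows "is_umod p (utransp V)"
proof -
  define n where d: "n = udim V"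
  define q where "q = qroot p"
  define E F K L where w: "E = uact V gE" "F = uact V gF" "K = uact V gK" "L = uact V gKinv"
  note r = is_umodD[OF V, folded d w q_def]
  note k = is_umod_K_commute[OF V, folded w q_def]
  have c: "E \<in> carrier_mat n n" "F \<in> carrier_mat n n" "K \<in> carrier_mat n n" "L \<in> carrier_mat n n"
    unfolding w using r(1) by blast+
  have q: "q \<noteq> 0" by (simp add: q_def)
  note sq = mult_carrier_mat[of _ n n _ n] left_mult_one_mat[of _ n n] right_mult_one_mat[of _ n n]
    mult_smult_assoc_mat[of _ n n _ n] mult_smult_distrib[of _ n n _ n] transpose_smult_mat
  note as = assoc_mult_mat[of _ n n _ n _ n]
  note tr = transpose_mult[of _ n n _ n, symmetric]
  have LFK: "L * (F * K) = q ^ 2 \<cdot>\<^sub>m F"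
  proof -
    have "F * K = q ^ 2 \<cdot>\<^sub>m (K * F)" using k(2) q by (simp add: smult_smult_mat one_smult_mat)
    then show ?thesis using c by (simp add: sq as[symmetric] r)
  qed
  have LEK: "L * (E * K) = inverse (q ^ 2) \<cdot>\<^sub>m E"
  proof -
    have "E * K = inverse (q ^ 2) \<cdot>\<^sub>m (K * E)" using k(1) q by (simp add: smult_smult_mat one_smult_mat)
    then show ?thesis using c by (simp add: sq as[symmetric] r)
  qed
  show ?thesis
    unfolding is_umod_iff utransp_simps d[symmetric] w[symmetric] q_def[symmetric]
  proof (intro conjI allI)
    show "uact (utransp V) x \<in> carrier_mat n n" for x
      using c unfolding w by (cases x) auto
    show "F\<^sup>T ^\<^sub>m p = 0\<^sub>m n n" "E\<^sup>T ^\<^sub>m p = 0\<^sub>m n n" "K\<^sup>T ^\<^sub>m (2 * p) = 1\<^sub>m n"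
      using c by (simp_all add: mat_pow_transpose[of _ n] r)
    show "K\<^sup>T * L\<^sup>T = 1\<^sub>m n" "L\<^sup>T * K\<^sup>T = 1\<^sub>m n"
      using c by (simp_all add: tr r)
    show "K\<^sup>T * F\<^sup>T * L\<^sup>T = q ^ 2 \<cdot>\<^sub>m F\<^sup>T" "K\<^sup>T * E\<^sup>T * L\<^sup>T = inverse (q ^ 2) \<cdot>\<^sub>m E\<^sup>T"
      using c by (simp_all add: tr sq as LFK LEK)
    have "F\<^sup>T * E\<^sup>T - E\<^sup>T * F\<^sup>T = (E * F - F * E)\<^sup>T"
      using c by (simp add: tr transpose_minus[of _ n n] sq)
    also have "\<dots> = inverse (q - inverse q) \<cdot>\<^sub>m (K\<^sup>T - L\<^sup>T)"
      unfolding r(9) using c by (simp add: transpose_minus[of _ n n] sq)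
    finally show "F\<^sup>T * E\<^sup>T - E\<^sup>T * F\<^sup>T = inverse (q - inverse q) \<cdot>\<^sub>m (K\<^sup>T - L\<^sup>T)" .
  qed
qed

lemma uhom_transpose:
  assumes cV: "\<And>x. uact V x \<in> carrier_mat (udim V) (udim V)" and cW: "\<And>x. uact W x \<in> carrier_mat (udim W) (udim W)"
    and f: "f \<in> uhom V W"
  shows "f\<^sup>T \<in> uhom (utransp W) (utransp V)"
proof (rule uhomI)
  note F = uhomD[OF f]
  have "f\<^sup>T * (uact W x)\<^sup>T = (uact V x)\<^sup>T * f\<^sup>T" for x
    using transpose_mult[OF cW F(1), of x] transpose_mult[OF F(1) cV, of x] F(2) by simp
  then show "f\<^sup>T * uact (utransp W) x = uact (utransp V) x * f\<^sup>T" for x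
    by (cases x) auto
qed (use uhomD(1)[OF f] in simp)

lemma utransp_steinberg: "utransp (steinberg p) = steinberg p"
proof -
  have "uact (utransp (steinberg p)) x = uact (steinberg p) x" for x
    by (cases x) (auto simp: steinberg_act intro!: eq_matI)
  then have "uact (utransp (steinberg p)) = uact (steinberg p)" ..
  then show ?thesis by simp
qed

lemma utransp_utransp:
  assumes "\<And>x. uact V x \<in> carrier_mat (udim V) (udim V)"
  shows "utransp (utransp V) = V"
proof -
  have "uact (utransp (utransp V)) x = uact V x" for x by (cases x) auto
  then have "uact (utransp (utransp V)) = uact V" ..
  then show ?thesis by simp
qed

text \<open>
  The Steinberg module is equal to its own contragredient, so a retraction of \<open>m\<close> is the
  transpose of a section of the surjection \<open>m\<^sup>T\<close>, which exists by projectivity.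
\<close>

lemma steinberg_injective:
  assumes p: "p \<ge> 2" and M: "is_umod p M" and m: "m \<in> uhom (steinberg p) M"
    and l: "l \<in> carrier_mat p (udim M)" "l * m = 1\<^sub>m p"
  obtains k where "k \<in> uhom M (steinberg p)" "k * m = 1\<^sub>m p"
proof -
  note cM = is_umodD(1)[OF M]
  have mc: "m \<in> carrier_mat (udim M) p" using uhomD(1)[OF m] by simp
  have mT: "m\<^sup>T \<in> uhom (utransp M) (steinberg p)"
    using uhom_transpose[OF steinberg_carrier cM m] by (simp add: utransp_steinberg)
  have "surj_mat m\<^sup>T"
    unfolding surj_mat_def
  proof (rule ballI)
    fix y :: "complex vec" assume "y \<in> carrier_vec (dim_row m\<^sup>T)"
    then have y: "y \<in> carrier_vec p" using mc by simp
    have "m\<^sup>T * l\<^sup>T = 1\<^sub>m p"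
      using transpose_mult[OF l(1) mc] l(2) by simp
    then have "m\<^sup>T *\<^sub>v (l\<^sup>T *\<^sub>v y) = y"
      using assoc_mult_mat_vec[of "m\<^sup>T" p "udim M" "l\<^sup>T" p y] mc l(1) y by simp
    then show "\<exists>x\<in>carrier_vec (dim_col m\<^sup>T). m\<^sup>T *\<^sub>v x = y"
      using l(1) mc y by (intro bexI[of _ "l\<^sup>T *\<^sub>v y"]) auto
  qed
  then obtain k where k: "k \<in> uhom (steinberg p) (utransp M)" "m\<^sup>T * k = 1\<^sub>m p"
    using uprojective_steinberg[OF p] is_umod_utransp[OF M] is_umod_steinberg[OF p] mT
      one_uhom[OF steinberg_carrier, of p] unfolding uprojective_def steinberg_dim by blast
  have kc: "k \<in> carrier_mat (udim M) p" using uhomD(1)[OF k(1)] by simp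
  have "k\<^sup>T \<in> uhom M (steinberg p)"
    using uhom_transpose[OF steinberg_carrier is_umodD(1)[OF is_umod_utransp[OF M]] k(1)]
    by (simp add: utransp_steinberg utransp_utransp[OF cM])
  moreover have "k\<^sup>T * m = 1\<^sub>m p"
    using arg_cong[OF k(2), of transpose_mat] transpose_mult[of "m\<^sup>T" p "udim M" k p] mc kc by simp
  ultimately show thesis by (rule that)
qed

text \<open>
  Repeated application of \<open>E\<close> to a non-zero vector of a submodule leaves a multiple of
  \<open>e\<^sub>0\<close> just before it gives \<open>0\<close>; from \<open>e\<^sub>0\<close> the element \<open>F\<close> produces the whole basis.
\<close>

lemma usimple_steinberg:
  assumes p: "p \<ge> 2"
  shows "usimple p (steinberg p)"
  unfolding usimple_def steinberg_dim
proof (intro conjI allI impI)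
  show "is_umod p (steinberg p)" by (rule is_umod_steinberg[OF p])
  show "p > 0" using p by simp
  fix S :: "complex vec set"
  assume sub: "submodule class_ring S (module_vec TYPE(complex) p)"
    and inv: "\<forall>x. \<forall>v\<in>S. uact (steinberg p) x *\<^sub>v v \<in> S"
  interpret S: submodule class_ring S "module_vec TYPE(complex) p" by (rule sub)
  have Sc: "S \<subseteq> carrier_vec p" using S.subset by (simp add: module_vec_simps)
  have Sadd: "v + w \<in> S" if "v \<in> S" "w \<in> S" for v w
    using S.m_closed[OF that] by (simp add: module_vec_simps)
  have S0: "0\<^sub>v p \<in> S" using S.zero_closed by (simp add: module_vec_simps)
  have Ssm: "a \<cdot>\<^sub>v v \<in> S" if "v \<in> S" for a v
    using S.smult_closed[of a v] that by (simp add: module_vec_simps class_ring_simps)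
  show "S = {0\<^sub>v p} \<or> S = carrier_vec p"
  proof (cases "S = {0\<^sub>v p}")
    case False
    then obtain s where s: "s \<in> S" "s \<noteq> 0\<^sub>v p" using S0 by blast
    have E: "(uact (steinberg p) gE *\<^sub>v v) $ i = (if Suc i < p then qint p (Suc i) * v $ Suc i else 0)"
      if "v \<in> carrier_vec p" "i < p" for v i
    proof -
      have "(uact (steinberg p) gE *\<^sub>v v) $ i = (\<Sum>k<p. if k = Suc i then qint p (Suc i) * v $ Suc i else 0)"
        unfolding mult_mat_vec_entry[OF steinberg_carrier[of p gE, unfolded steinberg_dim] that]
        by (rule sum.cong) (use that in \<open>auto simp: steinberg_act\<close>)
      then show ?thesis by simp
    qed
    have "unit_vec p 0 \<in> S" if "s \<in> S" "s \<noteq> 0\<^sub>v p" "\<And>k. m \<le> k \<Longrightarrow> k < p \<Longrightarrow> s $ k = 0" for m s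
      using that
    proof (induction m arbitrary: s)
      case 0
      then have "s = 0\<^sub>v p" using Sc by (intro eq_vecI) auto
      then show ?case using 0 by simp
    next
      case (Suc m)
      let ?t = "uact (steinberg p) gE *\<^sub>v s"
      have sc: "s \<in> carrier_vec p" using Suc.prems Sc by blast
      show ?case
      proof (cases "?t = 0\<^sub>v p")
        case True
        have z: "s $ Suc i = 0" if "Suc i < p" for i
          using E[OF sc, of i] that True qint_nonzero[of "Suc i" p] by simp
        have se: "s = s $ 0 \<cdot>\<^sub>v unit_vec p 0"
        proof (rule eq_vecI)
          fix i assume "i < dim_vec (s $ 0 \<cdot>\<^sub>v unit_vec p 0)"
          then show "s $ i = (s $ 0 \<cdot>\<^sub>v unit_vec p 0) $ i" using z by (cases i) auto
        qed (use sc in auto)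
        have "s $ 0 \<noteq> 0"
        proof
          assume "s $ 0 = 0"
          then have "s = 0\<^sub>v p" using se by (auto intro!: eq_vecI)
          then show False using Suc.prems by simp
        qed
        moreover have "inverse (s $ 0) \<cdot>\<^sub>v s \<in> S" using Ssm Suc.prems by blast
        ultimately show ?thesis using se by (metis left_inverse one_smult_vec smult_smult_assoc)
      next
        case False
        show ?thesis
        proof (rule Suc.IH[OF _ False])
          show "?t \<in> S" using inv Suc.prems by blast
          show "?t $ k = 0" if "m \<le> k" "k < p" for k
            using E[OF sc that(2)] Suc.prems(3)[of "Suc k"] that by simp
        qed
      qed
    qed
    from this[OF s, of p] have e0: "unit_vec p 0 \<in> S" by simp
    have e: "unit_vec p i \<in> S" if "i < p" for i
      using that
    proof (induction i)
      case (Suc i)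
      then have "uact (steinberg p) gF *\<^sub>v unit_vec p i \<in> S" using inv by simp
      then have "inverse (qint p (Suc i)) \<cdot>\<^sub>v (qint p (Suc i) \<cdot>\<^sub>v unit_vec p (Suc i)) \<in> S"
        unfolding steinberg_F_unit_vec[OF Suc.prems] by (rule Ssm)
      then show ?case using qint_nonzero[of "Suc i" p] Suc.prems by (simp add: smult_smult_assoc)
    qed (use e0 in simp)
    have "v \<in> S" if "v \<in> carrier_vec p" "\<And>k. m \<le> k \<Longrightarrow> k < p \<Longrightarrow> v $ k = 0" "m \<le> p" for m v
      using that
    proof (induction m arbitrary: v)
      case 0
      then have "v = 0\<^sub>v p" by (intro eq_vecI) auto
      then show ?case using S0 by simp
    next
      case (Suc m)
      define u where "u = vec p (\<lambda>k. if k = m then 0 else v $ k)"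
      have "u \<in> S"
      proof (rule Suc.IH)
        show "u $ k = 0" if "m \<le> k" "k < p" for k
          using Suc.prems(2)[of k] that by (cases "k = m") (auto simp: u_def)
      qed (use Suc.prems in \<open>auto simp: u_def\<close>)
      then have "u + v $ m \<cdot>\<^sub>v unit_vec p m \<in> S"
        using Sadd Ssm e[of m] Suc.prems by simp
      also have "u + v $ m \<cdot>\<^sub>v unit_vec p m = v"
        using Suc.prems by (intro eq_vecI) (auto simp: u_def)
      finally show ?case .
    qed
    from this[of _ p] have "carrier_vec p \<subseteq> S" by auto
    with Sc show ?thesis by blast
  qed simp
qed

section \<open>Non-degeneracy of the modified trace\<close>

text \<open>
  The modified trace of one endomorphism \<open>h (1 \<otimes> f)\<close> of \<open>P \<otimes> V\<close>, with the Steinberg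
  module \<open>P\<close>, is computed by both partial traces.  The right one is the identity of \<open>P\<close>,
  whose trace is \<open>\<plusminus>1\<close>; the left one is a product \<open>u f\<close> of endomorphisms of \<open>V\<close>.
\<close>

lemma modified_trace_nondegenerate:
  assumes p: "p \<ge> 2" and t: "modified_trace p t" and V: "uprojective p V" and f: "f \<in> uend V"
    and zero: "\<And>u. u \<in> uend V \<Longrightarrow> t V (u * f) = 0"
  shows "f = 0\<^sub>m (udim V) (udim V)"
proof (rule ccontr)
  assume f0: "f \<noteq> 0\<^sub>m (udim V) (udim V)"
  define n where d: "n = udim V"
  let ?P = "steinberg p"
  have V': "is_umod p V" using V by (simp add: uprojective_def)
  note P = is_umod_steinberg[OF p]
  note cP = steinberg_carrier[of p]
  note cD = is_umodD(1)[OF is_umod_utensor[OF p V' is_umod_udual[OF V']]]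
  have fc: "f \<in> carrier_mat n n" using uhomD(1)[OF f] by (simp add: d)
  define \<phi> where "\<phi> = vec_of_mat f"
  have \<phi>: "\<phi> \<in> uhom utriv (utensor V (udual V))"
    unfolding \<phi>_def by (rule coev_uhom[OF V' f])
  have \<phi>c: "\<phi> \<in> carrier_mat (n * n) 1" unfolding \<phi>_def by (rule vec_of_mat_carrier[OF fc])
  have "\<exists>a<n. \<exists>b<n. f $$ (a, b) \<noteq> 0"
  proof (rule ccontr)
    assume "\<not> ?thesis"
    then have "f = 0\<^sub>m n n" using fc by (intro eq_matI) auto
    then show False using f0 d by simp
  qed
  then obtain a b where ab: "a < n" "b < n" "f $$ (a, b) \<noteq> 0" by blast
  define z where "z = a * n + b"
  have z: "z < n * n" "\<phi> $$ (z, 0) \<noteq> 0"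
    using ab mult_index_less[of a n b n] vec_of_mat_index[OF fc ab(1,2)] by (auto simp: z_def \<phi>_def)
  \<comment> \<open>a linear left inverse of \<open>\<phi>\<close>, supported at one non-zero entry of \<open>\<phi>\<close>\<close>
  define \<psi> where "\<psi> = mat 1 (n * n) (\<lambda>(_, j). if j = z then inverse (\<phi> $$ (z, 0)) else 0)"
  have \<psi>c: "\<psi> \<in> carrier_mat 1 (n * n)" by (simp add: \<psi>_def)
  have \<psi>\<phi>: "\<psi> * \<phi> = 1\<^sub>m 1"
  proof (rule eq_matI)
    fix i j assume "i < dim_row (1\<^sub>m 1)" "j < dim_col (1\<^sub>m 1)"
    then have ij: "i < 1" "j < 1" by auto
    have "(\<psi> * \<phi>) $$ (i, j) = (\<Sum>k<n * n. if k = z then inverse (\<phi> $$ (z, 0)) * \<phi> $$ (z, 0) else 0)"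
      unfolding mult_mat_entry[OF \<psi>c \<phi>c ij] by (rule sum.cong) (use ij in \<open>auto simp: \<psi>_def\<close>)
    also have "\<dots> = 1" using z by simp
    finally show "(\<psi> * \<phi>) $$ (i, j) = 1\<^sub>m 1 $$ (i, j)" using ij by simp
  qed (use \<psi>c \<phi>c in auto)
  define m where "m = kron (1\<^sub>m p) \<phi>"
  have "m \<in> uhom (utensor ?P utriv) (utensor ?P (utensor V (udual V)))"
    unfolding m_def
    by (rule uhom_kron[OF cP utriv_carrier cP cD one_uhom[OF cP, unfolded steinberg_dim] \<phi>])
  then have m: "m \<in> uhom ?P (utensor ?P (utensor V (udual V)))"
    unfolding utensor_utriv(1)[OF cP] .
  have "kron (1\<^sub>m p) \<psi> * m = kron (1\<^sub>m p) (\<psi> * \<phi>)"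
    unfolding m_def using kron_mult[of "1\<^sub>m p" p p "1\<^sub>m p" p \<psi> 1 "n * n" \<phi> 1] \<psi>c \<phi>c by simp
  also have "\<dots> = 1\<^sub>m p" unfolding \<psi>\<phi> kron_one by simp
  finally have l: "kron (1\<^sub>m p) \<psi> * m = 1\<^sub>m p" .
  have lc: "kron (1\<^sub>m p) \<psi> \<in> carrier_mat p (udim (utensor ?P (utensor V (udual V))))"
    using kron_carrier[of "1\<^sub>m p" p p \<psi> 1 "n * n"] \<psi>c by (simp add: d)
  obtain k where k: "k \<in> uhom (utensor ?P (utensor V (udual V))) ?P" "k * m = 1\<^sub>m p"
    using steinberg_injective[OF p is_umod_utensor[OF p P is_umod_utensor[OF p V' is_umod_udual[OF V']]] m lc l] .
  have p0: "p > 0" using p by simp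
  obtain h where h: "h \<in> uend (utensor ?P V)"
    "ptr_right p ?P V (h * kron (1\<^sub>m (udim ?P)) f) = k * kron (1\<^sub>m (udim ?P)) (vec_of_mat f)"
    using ptr_right_bend[OF p0 P V' f k(1)] .
  define H where "H = h * kron (1\<^sub>m p) f"
  note cV = is_umodD(1)[OF V']
  have cPV: "uact (utensor ?P V) x \<in> carrier_mat (udim (utensor ?P V)) (udim (utensor ?P V))" for x
    by (rule is_umodD(1)[OF is_umod_utensor[OF p P V']])
  have H: "H \<in> uend (utensor ?P V)"
    unfolding H_def
    by (rule uhom_comp[OF cPV cPV cPV uhom_kron[OF cP cV cP cV one_uhom[OF cP, unfolded steinberg_dim] f] h(1)])
  have pr: "ptr_right p ?P V H = 1\<^sub>m p"
    using h(2) k(2) by (simp add: H_def m_def \<phi>_def)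
  have hc: "h \<in> carrier_mat (udim ?P * n) (udim ?P * n)" using uhomD(1)[OF h(1)] by (simp add: d)
  have pl: "ptr_left p ?P V H = ptr_left p ?P V h * f"
    using ptr_left_mult_right[OF P hc d fc] by (simp add: H_def)
  have "uprojective p ?P" by (rule uprojective_steinberg[OF p])
  then have "t ?P (1\<^sub>m p) = t (utensor ?P V) H"
    using t V' H pr unfolding modified_trace_def by metis
  also have "\<dots> = t V (ptr_left p ?P V h * f)"
    using t V P H pl unfolding modified_trace_def by metis
  also have "\<dots> = 0"
    by (rule zero[OF ptr_left_uend[OF p0 P V' h(1)]])
  finally have "t ?P (1\<^sub>m p) = 0" .
  moreover have "t ?P (1\<^sub>m p) = (- 1) ^ (p - 1)"
  proof -
    have v: "unit_vec p 0 \<in> carrier_vec p" "unit_vec p 0 \<noteq> (0\<^sub>v p :: complex vec)"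
      using p0 arg_cong[of "unit_vec p 0" "0\<^sub>v p :: complex vec" "\<lambda>v. v $ 0"] by auto
    have "uact ?P gE *\<^sub>v unit_vec p 0 = 0\<^sub>v p" "uact ?P gK *\<^sub>v unit_vec p 0 = qroot p ^ (p - 1) \<cdot>\<^sub>v unit_vec p 0"
      using steinberg_highest_weight[OF p0] by (simp_all add: highest_weight_def)
    then show ?thesis
      using t usimple_steinberg[OF p] v steinberg_dim[of p] unfolding modified_trace_def by blast
  qed
  ultimately show False by simp
qed

section \<open>The free algebra and its representations\<close>

definition scal :: "complex \<Rightarrow> free_elt \<Rightarrow> free_elt" where
  "scal c x = Poly_Mapping.single 0 c * x"

lemma free_algebra_simps:
  "carrier free_algebra = UNIV" "mult free_algebra = (*)" "one free_algebra = 1"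
  "zero free_algebra = 0" "add free_algebra = (+)" "smult free_algebra = scal"
  by (simp_all add: free_algebra_def scal_def[abs_def])

lemma ring_free_algebra: "ring free_algebra"
proof (rule ringI)
  show "abelian_group free_algebra"
    by (rule abelian_groupI) (auto simp: free_algebra_simps add.assoc add.commute intro: exI[of _ "- x" for x])
  show "Group.monoid free_algebra"
    by (rule monoidI) (auto simp: free_algebra_simps mult.assoc)
qed (auto simp: free_algebra_simps algebra_simps)

lemma free_algebra_minus: "x \<ominus>\<^bsub>free_algebra\<^esub> y = x - y"
proof -
  interpret ring free_algebra by (rule ring_free_algebra)
  have "\<ominus>\<^bsub>free_algebra\<^esub> y = - y"
    by (rule minus_equality) (auto simp: free_algebra_simps)
  then show ?thesis by (simp add: a_minus_def free_algebra_simps)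
qed

lemma free_algebra_pow: "x [^]\<^bsub>free_algebra\<^esub> (k::nat) = x ^ k"
  by (induction k) (simp_all add: free_algebra_simps power_Suc2 del: power_Suc)

lemma free_elt_expand: "x = (\<Sum>w\<in>Poly_Mapping.keys x. Poly_Mapping.single w (Poly_Mapping.lookup x w))"
  for x :: free_elt
  by (rule poly_mapping_eqI) (auto simp: lookup_sum lookup_single when_def in_keys_iff sum.delta)

lemma free_elt_linear_induct [case_names single add]:
  fixes x :: free_elt
  assumes single: "\<And>w c. P (Poly_Mapping.single w c)" and add: "\<And>x y. P x \<Longrightarrow> P y \<Longrightarrow> P (x + y)"
  shows "P x"
proof -
  have "P (\<Sum>w\<in>A. Poly_Mapping.single w (Poly_Mapping.lookup x w))" if "finite A" for A
    using that
  proof (induction A)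
    case empty
    have "P (Poly_Mapping.single 0 0)" by (rule single)
    then show ?case by simp
  qed (auto intro: single add)
  then show ?thesis using free_elt_expand[of x] by (metis finite_keys)
qed

lemma scal_single: "scal c (Poly_Mapping.single w d) = Poly_Mapping.single w (c * d)"
  by (simp add: scal_def mult_single)

lemma scal_add_right: "scal c (x + y) = scal c x + scal c y"
  by (simp add: scal_def distrib_left)

lemma scal_add_left: "scal (c + d) x = scal c x + scal d x"
  by (simp add: scal_def single_add distrib_right)

lemma scal_scal: "scal c (scal d x) = scal (c * d) x"
  by (simp add: scal_def mult.assoc[symmetric] mult_single)

lemma scal_one: "scal 1 x = x"
  by (simp add: scal_def)

lemma scal_mult_left: "scal c x * y = scal c (x * y)"
  by (simp add: scal_def mult.assoc)

lemma scal_mult_right: "x * scal c y = scal c (x * y)"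
proof -
  have "x * Poly_Mapping.single 0 c = Poly_Mapping.single 0 c * x"
    by (induction x rule: free_elt_linear_induct) (simp_all add: mult_single distrib_left distrib_right mult.commute)
  then show ?thesis by (simp add: scal_def mult.assoc[symmetric])
qed

lemma single_eq_scal: "Poly_Mapping.single w c = scal c (Poly_Mapping.single w 1)"
  by (simp add: scal_single)

lemma single_word_Cons: "Poly_Mapping.single (Word (g # w)) 1 = free_gen g * Poly_Mapping.single (Word w) 1"
  by (simp add: free_gen_def mult_single)

lemma single_word_Nil: "Poly_Mapping.single (Word []) 1 = 1"
  by (simp add: zero_gen_word_def[symmetric])

text \<open>
  The free algebra is spanned by the words in the generators, and a word is a product of a
  generator with a shorter word.
\<close>

lemma free_elt_induct [case_names add scal one gen]:
  fixes x :: free_elt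
  assumes add: "\<And>x y. P x \<Longrightarrow> P y \<Longrightarrow> P (x + y)" and scal: "\<And>c x. P x \<Longrightarrow> P (scal c x)"
    and one: "P 1" and gen: "\<And>g x. P x \<Longrightarrow> P (free_gen g * x)"
  shows "P x"
proof (induction x rule: free_elt_linear_induct)
  case (single w c)
  obtain l where w: "w = Word l" by (cases w)
  have "P (Poly_Mapping.single (Word l) 1)"
    by (induction l) (auto simp: single_word_Nil single_word_Cons intro: one gen)
  then show ?case unfolding w by (subst single_eq_scal) (rule scal)
qed (rule add)

primrec gens_act :: "umod \<Rightarrow> gen list \<Rightarrow> complex mat" where
  "gens_act X [] = 1\<^sub>m (udim X)"
| "gens_act X (g # l) = uact X g * gens_act X l"

definition word_act :: "umod \<Rightarrow> gen_word \<Rightarrow> complex mat" where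
  "word_act X w = (case w of Word l \<Rightarrow> gens_act X l)"

lemma word_act_simps [simp]:
  "word_act X (Word []) = 1\<^sub>m (udim X)" "word_act X (Word (g # l)) = uact X g * word_act X (Word l)"
  by (simp_all add: word_act_def)

text \<open>
  The action of the free algebra on a module, obtained by evaluating words at the matrices of the
  generators.
\<close>

definition free_act :: "umod \<Rightarrow> free_elt \<Rightarrow> complex mat" where
  "free_act X x = mat (udim X) (udim X) (\<lambda>(i, j). \<Sum>w\<in>Poly_Mapping.keys x. Poly_Mapping.lookup x w * word_act X w $$ (i, j))"

lemma free_act_carrier [simp]: "free_act X x \<in> carrier_mat (udim X) (udim X)"
  by (simp add: free_act_def)

lemma free_act_entry:
  assumes "finite A" "Poly_Mapping.keys x \<subseteq> A" "i < udim X" "j < udim X"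
  shows "free_act X x $$ (i, j) = (\<Sum>w\<in>A. Poly_Mapping.lookup x w * word_act X w $$ (i, j))"
  using assms by (auto simp: free_act_def in_keys_iff intro!: sum.mono_neutral_left)

lemma free_act_add: "free_act X (x + y) = free_act X x + free_act X y"
proof (rule eq_matI)
  fix i j assume "i < dim_row (free_act X x + free_act X y)" "j < dim_col (free_act X x + free_act X y)"
  then have ij: "i < udim X" "j < udim X" by (auto simp: free_act_def)
  let ?A = "Poly_Mapping.keys x \<union> Poly_Mapping.keys y"
  have "Poly_Mapping.keys (x + y) \<subseteq> ?A" by (rule Poly_Mapping.keys_add)
  then show "free_act X (x + y) $$ (i, j) = (free_act X x + free_act X y) $$ (i, j)"
    using ij free_act_entry[of ?A x i X j] free_act_entry[of ?A y i X j] free_act_entry[of ?A "x + y" i X j]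
      carrier_matD[OF free_act_carrier[of X y]]
    by (simp add: lookup_add distrib_right sum.distrib)
qed (auto simp: free_act_def)

lemma free_act_single:
  assumes "word_act X w \<in> carrier_mat (udim X) (udim X)"
  shows "free_act X (Poly_Mapping.single w c) = c \<cdot>\<^sub>m word_act X w"
proof (rule eq_matI)
  fix i j assume "i < dim_row (c \<cdot>\<^sub>m word_act X w)" "j < dim_col (c \<cdot>\<^sub>m word_act X w)"
  then have ij: "i < udim X" "j < udim X" using assms by auto
  have "Poly_Mapping.keys (Poly_Mapping.single w c) \<subseteq> {w}" by simp
  then show "free_act X (Poly_Mapping.single w c) $$ (i, j) = (c \<cdot>\<^sub>m word_act X w) $$ (i, j)"
    using ij assms free_act_entry[of "{w}" "Poly_Mapping.single w c" i X j] by simp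
qed (use assms in \<open>auto simp: free_act_def\<close>)

context
  fixes X :: umod
  assumes c: "\<And>g. uact X g \<in> carrier_mat (udim X) (udim X)"
begin

lemma word_act_carrier: "word_act X w \<in> carrier_mat (udim X) (udim X)"
proof (cases w)
  case (Word l)
  have "word_act X (Word l) \<in> carrier_mat (udim X) (udim X)"
    using c by (induction l) (auto intro: mult_carrier_mat)
  then show ?thesis using Word by simp
qed

lemma free_act_scal: "free_act X (scal a x) = a \<cdot>\<^sub>m free_act X x"
proof (induction x rule: free_elt_linear_induct)
  case (single w b)
  show ?case by (simp add: scal_single free_act_single word_act_carrier smult_smult_mat)
next
  case (add x y)
  then show ?case
    using add_smult_distrib_left_mat[OF free_act_carrier free_act_carrier, of a X x y]
    by (simp add: scal_add_right free_act_add)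
qed

lemma free_act_one: "free_act X 1 = 1\<^sub>m (udim X)"
  using free_act_single[OF word_act_carrier, of "Word []" 1] by (simp add: single_word_Nil one_smult_mat)

lemma free_act_gen_mult: "free_act X (free_gen g * x) = uact X g * free_act X x"
proof (induction x rule: free_elt_linear_induct)
  case (single w b)
  obtain l where w: "w = Word l" by (cases w)
  have "free_gen g * Poly_Mapping.single w b = Poly_Mapping.single (Word (g # l)) b"
    by (simp add: w free_gen_def mult_single)
  then show ?case
    using mult_smult_distrib[OF c word_act_carrier, of g b w] free_act_single[OF word_act_carrier, of w b]
      free_act_single[OF word_act_carrier, of "Word (g # l)" b] by (simp add: w)
next
  case (add x y)
  then show ?case
    using mult_add_distrib_mat[OF c free_act_carrier free_act_carrier, of g x y]
    by (simp add: distrib_left free_act_add)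
qed

lemma free_act_gen: "free_act X (free_gen g) = uact X g"
  using free_act_gen_mult[of g 1] right_mult_one_mat[OF c, of g] by (simp add: free_act_one)

lemma free_act_mult: "free_act X (x * y) = free_act X x * free_act X y"
proof (induction x rule: free_elt_induct)
  case (add x x')
  then show ?case
    using add_mult_distrib_mat[OF free_act_carrier free_act_carrier free_act_carrier, of X x x' y]
    by (simp add: distrib_right free_act_add)
next
  case (scal a x)
  then show ?case
    using mult_smult_assoc_mat[OF free_act_carrier free_act_carrier, of a X x y]
    by (simp add: scal_mult_left free_act_scal)
next
  case one
  then show ?case using left_mult_one_mat[OF free_act_carrier] by (simp add: free_act_one)
next
  case (gen g x)
  then show ?case
    using assoc_mult_mat[OF c free_act_carrier free_act_carrier, of g x y]
    by (simp add: mult.assoc free_act_gen_mult)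
qed

end

lemma uhom_free_act:
  assumes cX: "\<And>g. uact X g \<in> carrier_mat (udim X) (udim X)" and cY: "\<And>g. uact Y g \<in> carrier_mat (udim Y) (udim Y)"
    and f: "f \<in> uhom X Y"
  shows "f * free_act X x = free_act Y x * f"
proof (induction x rule: free_elt_induct)
  note F = uhomD[OF f]
  {
    case (add x y)
    then show ?case
      using mult_add_distrib_mat[OF F(1) free_act_carrier free_act_carrier, of x y]
        add_mult_distrib_mat[OF free_act_carrier free_act_carrier F(1), of x y]
      by (simp add: free_act_add)
  next
    case (scal a x)
    then show ?case
      using mult_smult_distrib[OF F(1) free_act_carrier, of a x] mult_smult_assoc_mat[OF free_act_carrier F(1), of a x]
      by (simp add: free_act_scal[OF cX] free_act_scal[OF cY])
  next
    case one
    then show ?case using F(1) by (simp add: free_act_one[OF cX] free_act_one[OF cY])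
  next
    case (gen g x)
    have "f * (uact X g * free_act X x) = (f * uact X g) * free_act X x"
      by (rule assoc_mult_mat[OF F(1) cX free_act_carrier, symmetric])
    also have "\<dots> = uact Y g * (f * free_act X x)"
      unfolding F(2) by (rule assoc_mult_mat[OF cY F(1) free_act_carrier])
    also have "\<dots> = (uact Y g * free_act Y x) * f"
      unfolding gen by (rule assoc_mult_mat[OF cY free_act_carrier F(1), symmetric])
    finally show ?case by (simp add: free_act_gen_mult[OF cX] free_act_gen_mult[OF cY])
  }
qed

text \<open>
  Relators are preserved by algebra homomorphisms.  This is used in both directions: to see that
  every module is annihilated by the relation ideal, and that the regular representation of the
  quotient satisfies the relations.
\<close>

lemma relators_free_hom:
  fixes \<rho> :: "free_elt \<Rightarrow> complex mat"
  assumes c: "\<And>x. \<rho> x \<in> carrier_mat n n" and one: "\<rho> 1 = 1\<^sub>m n" and mult: "\<And>x y. \<rho> (x * y) = \<rho> x * \<rho> y"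
    and add: "\<And>x y. \<rho> (x + y) = \<rho> x + \<rho> y" and sm: "\<And>a x. \<rho> (scal a x) = a \<cdot>\<^sub>m \<rho> x"
  shows "relators p (module_mat TYPE(complex) n n) (\<lambda>g. \<rho> (free_gen g)) = \<rho> ` relators p free_algebra free_gen"
proof -
  have pow: "\<rho> (x ^ k) = \<rho> x ^\<^sub>m k" for x k
    by (induction k) (simp_all add: one power_Suc2 mult carrier_matD(1)[OF c] del: power_Suc)
  have minus: "\<rho> (x - y) = \<rho> x - \<rho> y" for x y
  proof -
    have "\<rho> x = \<rho> (x - y) + \<rho> y" unfolding add[symmetric] by simp
    then show ?thesis using c[of "x - y"] c[of y] by (auto intro!: eq_matI)
  qed
  have mc: "\<rho> x * \<rho> y \<in> carrier_mat n n" "\<rho> x - \<rho> y \<in> carrier_mat n n" "\<rho> x * \<rho> y * \<rho> z \<in> carrier_mat n n"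
    "\<rho> x * \<rho> y - \<rho> z * \<rho> z' \<in> carrier_mat n n" for x y z z'
    using c by (auto intro!: mult_carrier_mat minus_carrier_mat)
  show ?thesis
    unfolding relators_def Let_def free_algebra_simps free_algebra_minus free_algebra_pow image_insert image_empty
    using c mc by (simp add: module_mat_simps module_mat_pow module_mat_minus pow minus mult one sm)
qed

lemma ideal_rel_ideal: "ideal (rel_ideal p) free_algebra"
  unfolding rel_ideal_def by (rule ring.genideal_ideal[OF ring_free_algebra]) (simp add: free_algebra_simps)

lemma relators_subset_rel_ideal: "relators p free_algebra free_gen \<subseteq> rel_ideal p"
  unfolding rel_ideal_def by (rule ring.genideal_self[OF ring_free_algebra]) (simp add: free_algebra_simps)

text \<open>
  The annihilator of \<open>X\<close> in the free algebra is a two-sided ideal that contains the relators.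
\<close>

lemma free_act_rel_ideal:
  assumes X: "is_umod p X" and x: "x \<in> rel_ideal p"
  shows "free_act X x = 0\<^sub>m (udim X) (udim X)"
proof -
  note c = is_umodD(1)[OF X]
  define n where "n = udim X"
  have fc: "free_act X y \<in> carrier_mat n n" for y by (simp add: n_def)
  define J where "J = {y. free_act X y = 0\<^sub>m n n}"
  have neg: "- y = scal (- 1) y" for y :: free_elt
  proof -
    have "scal (- 1) y + y = scal (- 1 + 1) y" unfolding scal_add_left by (simp add: scal_one)
    also have "\<dots> = 0" by (simp add: scal_def)
    finally have "scal (- 1) y = - y" by (simp only: eq_neg_iff_add_eq_0)
    then show ?thesis ..
  qed
  have "ideal J free_algebra"
  proof (rule idealI[OF ring_free_algebra])
    have z: "free_act X 0 = 0\<^sub>m n n"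
      by (auto simp: free_act_def n_def intro!: eq_matI)
    show "subgroup J (add_monoid free_algebra)"
    proof (rule group.subgroupI)
      show "group (add_monoid free_algebra)"
        using ring_free_algebra abelian_group.a_group ring.is_abelian_group by blast
      show "J \<subseteq> carrier (add_monoid free_algebra)" by (simp add: free_algebra_simps)
      show "J \<noteq> {}" using z by (auto simp: J_def)
      show "y \<otimes>\<^bsub>add_monoid free_algebra\<^esub> y' \<in> J" if "y \<in> J" "y' \<in> J" for y y'
        using that by (simp add: J_def free_algebra_simps free_act_add)
      show "inv\<^bsub>add_monoid free_algebra\<^esub> y \<in> J" if "y \<in> J" for y
      proof -
        have "inv\<^bsub>add_monoid free_algebra\<^esub> y = - y"
          using free_algebra_minus[of 0 y] abelian_group.minus_eq[OF ring.is_abelian_group[OF ring_free_algebra], of 0 y]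
          by (simp add: a_inv_def free_algebra_simps)
        then show ?thesis using that by (simp add: J_def neg free_act_scal[OF c])
      qed
    qed
    show "y' \<otimes>\<^bsub>free_algebra\<^esub> y \<in> J" if "y \<in> J" "y' \<in> carrier free_algebra" for y y'
      using that right_mult_zero_mat[OF fc] by (simp add: J_def free_algebra_simps free_act_mult[OF c])
    show "y \<otimes>\<^bsub>free_algebra\<^esub> y' \<in> J" if "y \<in> J" "y' \<in> carrier free_algebra" for y y'
      using that left_mult_zero_mat[OF fc] by (simp add: J_def free_algebra_simps free_act_mult[OF c])
  qed
  moreover have "relators p free_algebra free_gen \<subseteq> J"
  proof -
    have "free_act X ` relators p free_algebra free_gen = relators p (module_mat TYPE(complex) n n) (uact X)"
      using relators_free_hom[of "free_act X" n p] fc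
      by (simp add: free_act_one[OF c] free_act_mult[OF c] free_act_add free_act_scal[OF c] free_act_gen[OF c] n_def)
    also have "\<dots> \<subseteq> {0\<^sub>m n n}" using X by (simp add: is_umod_def n_def)
    finally show ?thesis by (auto simp: J_def)
  qed
  ultimately have "rel_ideal p \<subseteq> J"
    unfolding rel_ideal_def by (rule ring.genideal_minimal[OF ring_free_algebra])
  then show ?thesis using x by (auto simp: J_def n_def)
qed

section \<open>The algebra structure of the restricted quantum group\<close>

definition uq_proj :: "nat \<Rightarrow> free_elt \<Rightarrow> free_elt set" where
  "uq_proj p x = rel_ideal p +>\<^bsub>free_algebra\<^esub> x"

lemma rel_ideal_closed:
  shows "0 \<in> rel_ideal p" "x \<in> rel_ideal p \<Longrightarrow> y \<in> rel_ideal p \<Longrightarrow> x + y \<in> rel_ideal p"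
    "x \<in> rel_ideal p \<Longrightarrow> y * x \<in> rel_ideal p" "x \<in> rel_ideal p \<Longrightarrow> scal a x \<in> rel_ideal p"
    "x \<in> rel_ideal p \<Longrightarrow> - x \<in> rel_ideal p"
proof -
  interpret ideal "rel_ideal p" free_algebra by (rule ideal_rel_ideal)
  show "0 \<in> rel_ideal p" using additive_subgroup.zero_closed[OF is_additive_subgroup] by (simp add: free_algebra_simps)
  show "x + y \<in> rel_ideal p" if "x \<in> rel_ideal p" "y \<in> rel_ideal p"
    using additive_subgroup.a_closed[OF is_additive_subgroup that] by (simp add: free_algebra_simps)
  show *: "y * x \<in> rel_ideal p" if "x \<in> rel_ideal p" for y
    using I_l_closed[OF that, of y] by (simp add: free_algebra_simps)
  show "scal a x \<in> rel_ideal p" if "x \<in> rel_ideal p"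
    unfolding scal_def by (rule *[OF that])
  show "- x \<in> rel_ideal p" if "x \<in> rel_ideal p"
    using *[OF that, of "- 1"] by simp
qed

lemma uq_proj_set: "uq_proj p x = (\<lambda>i. i + x) ` rel_ideal p"
  by (auto simp: uq_proj_def a_r_coset_def' free_algebra_simps)

lemma uq_proj_eq_iff: "uq_proj p x = uq_proj p y \<longleftrightarrow> x - y \<in> rel_ideal p"
proof
  assume "uq_proj p x = uq_proj p y"
  moreover have "x \<in> uq_proj p x" unfolding uq_proj_set using rel_ideal_closed(1) by force
  ultimately obtain i where "i \<in> rel_ideal p" "x = i + y" unfolding uq_proj_set by blast
  then show "x - y \<in> rel_ideal p" by simp
next
  have *: "uq_proj p x \<subseteq> uq_proj p y" if "x - y \<in> rel_ideal p" for x y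
  proof
    fix z assume "z \<in> uq_proj p x"
    then obtain i where i: "i \<in> rel_ideal p" "z = i + x" unfolding uq_proj_set by blast
    then have "z = (i + (x - y)) + y" by simp
    then show "z \<in> uq_proj p y" unfolding uq_proj_set using rel_ideal_closed(2)[OF i(1) that] by blast
  qed
  assume "x - y \<in> rel_ideal p"
  with *[OF this] *[of y x] rel_ideal_closed(5)[of "x - y" p] show "uq_proj p x = uq_proj p y" by auto
qed

lemma Uq_fields:
  "carrier (Uq p) = range (uq_proj p)"
  "\<one>\<^bsub>Uq p\<^esub> = uq_proj p 1" "\<zero>\<^bsub>Uq p\<^esub> = uq_proj p 0"
  "uq_proj p x \<otimes>\<^bsub>Uq p\<^esub> uq_proj p y = uq_proj p (x * y)"
  "uq_proj p x \<oplus>\<^bsub>Uq p\<^esub> uq_proj p y = uq_proj p (x + y)"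
  "c \<odot>\<^bsub>Uq p\<^esub> uq_proj p x = uq_proj p (scal c x)"
proof -
  interpret ideal "rel_ideal p" free_algebra by (rule ideal_rel_ideal)
  show "carrier (Uq p) = range (uq_proj p)"
    by (auto simp: Uq_def quot_algebra_def FactRing_def A_RCOSETS_def' free_algebra_simps uq_proj_def)
  show "\<one>\<^bsub>Uq p\<^esub> = uq_proj p 1"
    by (simp add: Uq_def quot_algebra_def FactRing_def free_algebra_simps uq_proj_def)
  have "uq_proj p 0 = rel_ideal p" unfolding uq_proj_set by simp
  then show "\<zero>\<^bsub>Uq p\<^esub> = uq_proj p 0"
    by (simp add: Uq_def quot_algebra_def FactRing_def)
  show "uq_proj p x \<otimes>\<^bsub>Uq p\<^esub> uq_proj p y = uq_proj p (x * y)"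
    using rcoset_mult_add[of x y] by (simp add: Uq_def quot_algebra_def FactRing_def free_algebra_simps uq_proj_def)
  show "uq_proj p x \<oplus>\<^bsub>Uq p\<^esub> uq_proj p y = uq_proj p (x + y)"
    using a_rcos_sum[of x y] by (simp add: Uq_def quot_algebra_def FactRing_def free_algebra_simps uq_proj_def)
  have "c \<odot>\<^bsub>Uq p\<^esub> uq_proj p x = (\<Union>x'\<in>uq_proj p x. uq_proj p (scal c x'))"
    by (simp add: Uq_def quot_algebra_def free_algebra_simps uq_proj_def[symmetric])
  also have "\<dots> = uq_proj p (scal c x)"
  proof -
    have "uq_proj p (scal c x') = uq_proj p (scal c x)" if "x' \<in> uq_proj p x" for x'
      using that unfolding uq_proj_eq_iff unfolding uq_proj_set
      by (auto simp: scal_add_right rel_ideal_closed)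
    moreover have "x \<in> uq_proj p x" unfolding uq_proj_set using rel_ideal_closed(1) by force
    ultimately show ?thesis by blast
  qed
  finally show "c \<odot>\<^bsub>Uq p\<^esub> uq_proj p x = uq_proj p (scal c x)" .
qed

lemma Uq_gen_eq: "Uq_gen p g = uq_proj p (free_gen g)"
  by (simp add: Uq_gen_def uq_proj_def)

lemma Uq_carrierE:
  assumes "u \<in> carrier (Uq p)"
  obtains x where "u = uq_proj p x"
  using assms by (auto simp: Uq_fields)

lemma uq_proj_carrier [simp]: "uq_proj p x \<in> carrier (Uq p)"
  by (simp add: Uq_fields)

lemma ring_Uq: "ring (Uq p)"
proof (rule ringI)
  show "abelian_group (Uq p)"
  proof (rule abelian_groupI)
    show "\<exists>v\<in>carrier (Uq p). v \<oplus>\<^bsub>Uq p\<^esub> u = \<zero>\<^bsub>Uq p\<^esub>" if "u \<in> carrier (Uq p)" for u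
    proof -
      obtain x where "u = uq_proj p x" using \<open>u \<in> carrier (Uq p)\<close> by (rule Uq_carrierE)
      then show ?thesis by (intro bexI[of _ "uq_proj p (- x)"]) (simp_all add: Uq_fields)
    qed
  qed (auto elim!: Uq_carrierE simp: Uq_fields(2-) add_ac)
  show "Group.monoid (Uq p)"
    by (rule monoidI) (auto elim!: Uq_carrierE simp: Uq_fields(2-) mult.assoc)
qed (auto elim!: Uq_carrierE simp: Uq_fields(2-) algebra_simps)

lemma Uq_minus: "uq_proj p x \<ominus>\<^bsub>Uq p\<^esub> uq_proj p y = uq_proj p (x - y)"
proof -
  interpret ring "Uq p" by (rule ring_Uq)
  have "\<ominus>\<^bsub>Uq p\<^esub> uq_proj p y = uq_proj p (- y)"
    by (rule minus_equality) (auto simp: Uq_fields(2-))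
  then show ?thesis by (simp add: a_minus_def Uq_fields(2-))
qed

lemma vectorspace_Uq: "vectorspace class_ring (Uq p)"
proof -
  have f: "field (class_ring :: complex ring)" by (rule class_field)
  have "module class_ring (Uq p)"
  proof (rule moduleI)
    show "cring (class_ring :: complex ring)" using f by (simp add: field_def domain_def)
    show "abelian_group (Uq p)" by (rule ring.is_abelian_group[OF ring_Uq])
  qed (auto elim!: Uq_carrierE simp: Uq_fields(2-) class_ring_simps scal_add_left scal_add_right scal_scal scal_one)
  with f show ?thesis by (simp add: vectorspace_def)
qed

section \<open>Coordinates and the regular representation\<close>

lemma linear_form_finsum:
  assumes \<xi>: "linear_form (Uq p) \<xi>" and A: "finite A" and f: "\<And>a. a \<in> A \<Longrightarrow> f a \<in> carrier (Uq p)"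
  shows "\<xi> (finsum (Uq p) f A) = (\<Sum>a\<in>A. \<xi> (f a))"
  using A f
proof (induction A)
  interpret vectorspace class_ring "Uq p" by (rule vectorspace_Uq)
  case empty
  have "\<xi> (0 \<odot>\<^bsub>Uq p\<^esub> \<zero>\<^bsub>Uq p\<^esub>) = 0 * \<xi> \<zero>\<^bsub>Uq p\<^esub>"
    using \<xi> unfolding linear_form_def by blast
  moreover have "0 \<odot>\<^bsub>Uq p\<^esub> \<zero>\<^bsub>Uq p\<^esub> = \<zero>\<^bsub>Uq p\<^esub>" by (simp add: Uq_fields(2-) scal_def)
  ultimately show ?case by simp
next
  interpret vectorspace class_ring "Uq p" by (rule vectorspace_Uq)
  case (insert a A)
  have "finsum (Uq p) f A \<in> carrier (Uq p)" using insert by (intro M.finsum_closed) auto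
  then show ?case
    using insert \<xi> M.finsum_insert[OF insert(1,2), of f] unfolding linear_form_def by (auto simp: Pi_iff)
qed

locale regular_basis =
  fixes p :: nat and bs :: "free_elt set list"
  assumes p: "p \<ge> 2" and basis: "ordered_basis (Uq p) bs"
begin

abbreviation U where "U \<equiv> Uq p"
abbreviation N where "N \<equiv> length bs"
abbreviation co where "co \<equiv> coords U bs"

sublocale vectorspace class_ring U by (rule vectorspace_Uq)
sublocale ring U by (rule ring_Uq)

definition of_coords :: "complex vec \<Rightarrow> free_elt set" where
  "of_coords v = finsum U (\<lambda>i. v $ i \<odot>\<^bsub>U\<^esub> bs ! i) {..<N}"

lemma bs_carrier: "i < N \<Longrightarrow> bs ! i \<in> carrier U"
  using basis nth_mem[of i bs] unfolding ordered_basis_def basis_def by blast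

lemma smult_carrier [simp]: "u \<in> carrier U \<Longrightarrow> c \<odot>\<^bsub>U\<^esub> u \<in> carrier U"
  by (auto elim!: Uq_carrierE simp: Uq_fields(6))

lemma of_coords_carrier [simp]: "of_coords v \<in> carrier U"
  unfolding of_coords_def by (rule M.finsum_closed) (auto simp: bs_carrier)

lemma ex1_coords:
  assumes u: "u \<in> carrier U"
  shows "\<exists>!v. v \<in> carrier_vec N \<and> u = of_coords v"
proof -
  have d: "distinct bs" and b: "basis (set bs)" and sub: "set bs \<subseteq> carrier U"
    using basis unfolding ordered_basis_def basis_def by auto
  have inj: "inj_on ((!) bs) {..<N}" using d by (auto simp: inj_on_def nth_eq_iff_index_eq)
  have img: "(!) bs ` {..<N} = set bs" by (auto simp: in_set_conv_nth)
  have comb: "lincomb a (set bs) = of_coords (vec N (\<lambda>i. a (bs ! i)))" for a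
  proof -
    have "lincomb a (set bs) = finsum U (\<lambda>i. a (bs ! i) \<odot>\<^bsub>U\<^esub> bs ! i) {..<N}"
      unfolding lincomb_def img[symmetric]
      by (subst M.finsum_reindex[OF _ inj]) (auto simp: bs_carrier)
    also have "\<dots> = of_coords (vec N (\<lambda>i. a (bs ! i)))"
      unfolding of_coords_def by (rule M.finsum_cong') (auto simp: bs_carrier)
    finally show ?thesis .
  qed
  have ex1: "\<exists>!a. a \<in> set bs \<rightarrow>\<^sub>E carrier class_ring \<and> lincomb a (set bs) = u"
    using basis_criterion[OF _ sub] b u by auto
  then obtain a where a: "lincomb a (set bs) = u" "a \<in> set bs \<rightarrow>\<^sub>E UNIV" by (auto simp: class_ring_simps)
  show ?thesis
  proof (rule ex1I[of _ "vec N (\<lambda>i. a (bs ! i))"])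
    show "vec N (\<lambda>i. a (bs ! i)) \<in> carrier_vec N \<and> u = of_coords (vec N (\<lambda>i. a (bs ! i)))"
      using a comb by simp
    fix v assume v: "v \<in> carrier_vec N \<and> u = of_coords v"
    define a' where "a' = restrict (\<lambda>x. v $ (the_inv_into {..<N} ((!) bs) x)) (set bs)"
    have a'i: "a' (bs ! i) = v $ i" if "i < N" for i
      using that the_inv_into_f_f[OF inj, of i] by (auto simp: a'_def)
    have v': "v = vec N (\<lambda>i. a' (bs ! i))" using v a'i by (intro eq_vecI) auto
    have "lincomb a' (set bs) = u" unfolding comb v'[symmetric] using v by simp
    then have "a' = a" using ex1 a by (auto simp: class_ring_simps a'_def)
    then show "v = vec N (\<lambda>i. a (bs ! i))" using v' by simp
  qed
qed

lemma coords:
  assumes "u \<in> carrier U"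
  shows "co u \<in> carrier_vec N" "of_coords (co u) = u"
  using theI'[OF ex1_coords[OF assms]] unfolding coords_def of_coords_def by auto

lemma dim_coords [simp]: "u \<in> carrier U \<Longrightarrow> dim_vec (co u) = N"
  using coords(1) by auto

lemma coords_of_coords: "v \<in> carrier_vec N \<Longrightarrow> co (of_coords v) = v"
  unfolding coords_def of_coords_def[symmetric] by (rule the1_equality[OF ex1_coords]) simp_all

lemma of_coords_add:
  assumes "v \<in> carrier_vec N" "w \<in> carrier_vec N"
  shows "of_coords (v + w) = of_coords v \<oplus>\<^bsub>U\<^esub> of_coords w"
proof -
  have "of_coords (v + w) = finsum U (\<lambda>i. (v $ i \<odot>\<^bsub>U\<^esub> bs ! i) \<oplus>\<^bsub>U\<^esub> (w $ i \<odot>\<^bsub>U\<^esub> bs ! i)) {..<N}"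
    unfolding of_coords_def using assms
    by (intro M.finsum_cong') (auto simp: bs_carrier smult_l_distr[unfolded class_ring_simps, simplified])
  also have "\<dots> = of_coords v \<oplus>\<^bsub>U\<^esub> of_coords w"
    unfolding of_coords_def by (rule M.finsum_addf) (auto simp: bs_carrier)
  finally show ?thesis .
qed

lemma of_coords_smult:
  assumes "v \<in> carrier_vec N"
  shows "of_coords (c \<cdot>\<^sub>v v) = c \<odot>\<^bsub>U\<^esub> of_coords v"
proof -
  have "of_coords (c \<cdot>\<^sub>v v) = finsum U (\<lambda>i. c \<odot>\<^bsub>U\<^esub> (v $ i \<odot>\<^bsub>U\<^esub> bs ! i)) {..<N}"
    unfolding of_coords_def using assms
    by (intro M.finsum_cong') (auto simp: bs_carrier smult_assoc1[unfolded class_ring_simps, simplified])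
  also have "\<dots> = c \<odot>\<^bsub>U\<^esub> of_coords v"
    unfolding of_coords_def by (rule finsum_smult[symmetric]) (auto simp: bs_carrier class_ring_simps)
  finally show ?thesis .
qed

lemma coords_add: "u \<in> carrier U \<Longrightarrow> w \<in> carrier U \<Longrightarrow> co (u \<oplus>\<^bsub>U\<^esub> w) = co u + co w"
  using coords_of_coords[of "co u + co w"] of_coords_add[of "co u" "co w"] coords[of u] coords[of w] by simp

lemma coords_smult: "u \<in> carrier U \<Longrightarrow> co (c \<odot>\<^bsub>U\<^esub> u) = c \<cdot>\<^sub>v co u"
  using coords_of_coords[of "c \<cdot>\<^sub>v co u"] of_coords_smult[of "co u" c] coords[of u] by simp

text \<open>
  Applied to the entries of coordinate vectors, this one formula also describes the matrices of
  linear maps.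
\<close>

lemma linear_form_coords:
  assumes \<xi>: "linear_form U \<xi>" and u: "u \<in> carrier U"
  shows "\<xi> u = (\<Sum>j<N. co u $ j * \<xi> (bs ! j))"
proof -
  have "\<xi> u = \<xi> (finsum U (\<lambda>i. co u $ i \<odot>\<^bsub>U\<^esub> bs ! i) {..<N})"
    using coords(2)[OF u] by (simp add: of_coords_def)
  also have "\<dots> = (\<Sum>j<N. \<xi> (co u $ j \<odot>\<^bsub>U\<^esub> bs ! j))"
    by (rule linear_form_finsum[OF \<xi>]) (auto simp: bs_carrier)
  also have "\<dots> = (\<Sum>j<N. co u $ j * \<xi> (bs ! j))"
    using \<xi> by (intro sum.cong refl) (auto simp: linear_form_def bs_carrier)
  finally show ?thesis .
qed

definition linear_map :: "(free_elt set \<Rightarrow> free_elt set) \<Rightarrow> bool" where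
  "linear_map \<phi> \<longleftrightarrow> (\<forall>u\<in>carrier U. \<phi> u \<in> carrier U) \<and>
    (\<forall>u\<in>carrier U. \<forall>w\<in>carrier U. \<phi> (u \<oplus>\<^bsub>U\<^esub> w) = \<phi> u \<oplus>\<^bsub>U\<^esub> \<phi> w) \<and>
    (\<forall>c. \<forall>u\<in>carrier U. \<phi> (c \<odot>\<^bsub>U\<^esub> u) = c \<odot>\<^bsub>U\<^esub> \<phi> u)"

lemma matrix_in_basis_carrier [simp]: "matrix_in_basis U bs \<phi> \<in> carrier_mat N N"
  by (simp add: matrix_in_basis_def)

lemma matrix_in_basis_coords:
  assumes \<phi>: "linear_map \<phi>" and u: "u \<in> carrier U"
  shows "matrix_in_basis U bs \<phi> *\<^sub>v co u = co (\<phi> u)"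
proof (rule eq_vecI)
  have c: "\<phi> u \<in> carrier U" using \<phi> u by (simp add: linear_map_def)
  show "dim_vec (matrix_in_basis U bs \<phi> *\<^sub>v co u) = dim_vec (co (\<phi> u))"
    using coords(1)[OF c] by (simp add: matrix_in_basis_def)
  fix i assume "i < dim_vec (co (\<phi> u))"
  then have i: "i < N" using coords(1)[OF c] by simp
  have "linear_form U (\<lambda>w. co (\<phi> w) $ i)"
    using \<phi> i coords(1) by (auto simp: linear_form_def linear_map_def coords_add coords_smult)
  from linear_form_coords[OF this u]
  show "(matrix_in_basis U bs \<phi> *\<^sub>v co u) $ i = co (\<phi> u) $ i"
    unfolding mult_mat_vec_entry[OF matrix_in_basis_carrier coords(1)[OF u] i]
    using i by (auto simp: matrix_in_basis_def mult.commute intro!: sum.cong)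
qed

lemma mat_eq_by_coords:
  assumes "A \<in> carrier_mat m N" "B \<in> carrier_mat m N" "\<And>u. u \<in> carrier U \<Longrightarrow> A *\<^sub>v co u = B *\<^sub>v co u"
  shows "A = B"
proof (rule mat_col_eqI)
  fix i assume i: "i < dim_col B"
  then have i: "i < N" using assms by simp
  have "unit_vec N i = co (of_coords (unit_vec N i))" by (rule coords_of_coords[symmetric]) simp
  then have "A *\<^sub>v unit_vec N i = B *\<^sub>v unit_vec N i" using assms(3)[OF of_coords_carrier] by metis
  then show "col A i = col B i" using mult_mat_unit_vec[of A m N i] mult_mat_unit_vec[of B m N i] assms i by simp
qed (use assms in auto)

definition lmul :: "free_elt set \<Rightarrow> complex mat" where
  "lmul u = matrix_in_basis U bs (\<lambda>y. u \<otimes>\<^bsub>U\<^esub> y)"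

abbreviation rmul where "rmul \<equiv> right_mult p bs"

lemma linear_map_mult:
  assumes "u \<in> carrier U"
  shows "linear_map (\<lambda>y. u \<otimes>\<^bsub>U\<^esub> y)" "linear_map (\<lambda>y. y \<otimes>\<^bsub>U\<^esub> u)"
proof -
  have "linear_map (\<lambda>y. u \<otimes>\<^bsub>U\<^esub> y) \<and> linear_map (\<lambda>y. y \<otimes>\<^bsub>U\<^esub> u)"
    unfolding linear_map_def using assms
    by (intro conjI ballI allI; elim Uq_carrierE)
      (simp_all only: uq_proj_carrier Uq_fields(4-6) distrib_left distrib_right scal_mult_left scal_mult_right)
  then show "linear_map (\<lambda>y. u \<otimes>\<^bsub>U\<^esub> y)" "linear_map (\<lambda>y. y \<otimes>\<^bsub>U\<^esub> u)" by blast+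
qed

lemma lmul_carrier [simp]: "lmul u \<in> carrier_mat N N" and rmul_carrier [simp]: "rmul u \<in> carrier_mat N N"
  by (simp_all add: lmul_def right_mult_def)

lemma lmul_coords: "u \<in> carrier U \<Longrightarrow> y \<in> carrier U \<Longrightarrow> lmul u *\<^sub>v co y = co (u \<otimes>\<^bsub>U\<^esub> y)"
  unfolding lmul_def by (rule matrix_in_basis_coords[OF linear_map_mult(1)])

lemma rmul_coords: "u \<in> carrier U \<Longrightarrow> y \<in> carrier U \<Longrightarrow> rmul u *\<^sub>v co y = co (y \<otimes>\<^bsub>U\<^esub> u)"
  unfolding right_mult_def by (rule matrix_in_basis_coords[OF linear_map_mult(2)])

lemma mult_vec_assoc: "A \<in> carrier_mat m N \<Longrightarrow> B \<in> carrier_mat N N \<Longrightarrow> u \<in> carrier U \<Longrightarrow>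
    (A * B) *\<^sub>v co u = A *\<^sub>v (B *\<^sub>v co u)"
  using assoc_mult_mat_vec coords(1) by blast

lemma lmul_hom:
  assumes "u \<in> carrier U" "w \<in> carrier U"
  shows "lmul (u \<otimes>\<^bsub>U\<^esub> w) = lmul u * lmul w" "lmul (u \<oplus>\<^bsub>U\<^esub> w) = lmul u + lmul w"
    "lmul (c \<odot>\<^bsub>U\<^esub> u) = c \<cdot>\<^sub>m lmul u" "lmul \<one>\<^bsub>U\<^esub> = 1\<^sub>m N"
proof -
  have lc: "u \<otimes>\<^bsub>U\<^esub> w \<in> carrier U" "u \<oplus>\<^bsub>U\<^esub> w \<in> carrier U" "c \<odot>\<^bsub>U\<^esub> u \<in> carrier U"
    using assms by auto
  show "lmul (u \<otimes>\<^bsub>U\<^esub> w) = lmul u * lmul w"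
    using assms lc by (intro mat_eq_by_coords[of _ N]) (auto simp: lmul_coords mult_vec_assoc[of _ N] m_assoc mult_carrier_mat[of _ N N] simp del: assoc_mult_mat_vec)
  show "lmul (u \<oplus>\<^bsub>U\<^esub> w) = lmul u + lmul w"
    using assms lc by (intro mat_eq_by_coords[of _ N])
      (auto simp: lmul_coords add_mult_distrib_mat_vec[OF lmul_carrier lmul_carrier coords(1)] coords_add[symmetric] l_distr)
  show "lmul (c \<odot>\<^bsub>U\<^esub> u) = c \<cdot>\<^sub>m lmul u"
    using assms lc by (intro mat_eq_by_coords[of _ N])
      (auto simp: lmul_coords smult_mat_mult_vec[OF lmul_carrier coords(1)] coords_smult[symmetric] linear_map_mult(2)[unfolded linear_map_def])
  show "lmul \<one>\<^bsub>U\<^esub> = 1\<^sub>m N"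
    by (intro mat_eq_by_coords[of _ N]) (auto simp: lmul_coords coords(1))
qed

lemma rmul_hom:
  assumes "u \<in> carrier U" "w \<in> carrier U"
  shows "rmul (u \<otimes>\<^bsub>U\<^esub> w) = rmul w * rmul u" "rmul (u \<oplus>\<^bsub>U\<^esub> w) = rmul u + rmul w"
    "rmul (c \<odot>\<^bsub>U\<^esub> u) = c \<cdot>\<^sub>m rmul u"
proof -
  have lc: "u \<otimes>\<^bsub>U\<^esub> w \<in> carrier U" "u \<oplus>\<^bsub>U\<^esub> w \<in> carrier U" "c \<odot>\<^bsub>U\<^esub> u \<in> carrier U"
    using assms by auto
  show "rmul (u \<otimes>\<^bsub>U\<^esub> w) = rmul w * rmul u"
    using assms lc by (intro mat_eq_by_coords[of _ N]) (auto simp: rmul_coords mult_vec_assoc[of _ N] m_assoc mult_carrier_mat[of _ N N] simp del: assoc_mult_mat_vec)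
  show "rmul (u \<oplus>\<^bsub>U\<^esub> w) = rmul u + rmul w"
    using assms lc by (intro mat_eq_by_coords[of _ N])
      (auto simp: rmul_coords add_mult_distrib_mat_vec[OF rmul_carrier rmul_carrier coords(1)] coords_add[symmetric] r_distr)
  show "rmul (c \<odot>\<^bsub>U\<^esub> u) = c \<cdot>\<^sub>m rmul u"
    using assms lc by (intro mat_eq_by_coords[of _ N])
      (auto simp: rmul_coords smult_mat_mult_vec[OF rmul_carrier coords(1)] coords_smult[symmetric] linear_map_mult(1)[unfolded linear_map_def])
qed

abbreviation reg where "reg \<equiv> regular_umod p bs"

lemma reg_simps [simp]: "udim reg = N" "uact reg g = lmul (uq_proj p (free_gen g))"
  by (simp_all add: regular_umod_def lmul_def Uq_gen_eq)

lemma is_umod_reg: "is_umod p reg"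
proof -
  have "relators p (module_mat TYPE(complex) N N) (\<lambda>g. lmul (uq_proj p (free_gen g)))
    = (\<lambda>x. lmul (uq_proj p x)) ` relators p free_algebra free_gen"
    by (rule relators_free_hom) (simp_all add: Uq_fields(2)[symmetric] Uq_fields(4-)[symmetric] lmul_hom[of "uq_proj p x" "uq_proj p y" for x y] lmul_hom(3,4)[OF uq_proj_carrier uq_proj_carrier])
  also have "\<dots> \<subseteq> {0\<^sub>m N N}"
  proof (rule image_subsetI)
    fix x assume "x \<in> relators p free_algebra free_gen"
    then have "x \<in> rel_ideal p" using relators_subset_rel_ideal by blast
    then have "uq_proj p x = uq_proj p (scal 0 0)" unfolding uq_proj_eq_iff by (simp add: scal_def)
    also have "lmul \<dots> = 0 \<cdot>\<^sub>m lmul (uq_proj p 0)"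
      unfolding Uq_fields(6)[symmetric] by (rule lmul_hom(3)[OF uq_proj_carrier uq_proj_carrier])
    also have "\<dots> = 0\<^sub>m N N" using carrier_matD[OF lmul_carrier[of "uq_proj p 0"]] by (intro eq_matI) simp_all
    finally show "lmul (uq_proj p x) \<in> {0\<^sub>m N N}" by simp
  qed
  finally have "relators p (module_mat TYPE(complex) N N) (uact reg) \<subseteq> {0\<^sub>m N N}"
    unfolding reg_simps(2)[abs_def] by simp
  then show ?thesis unfolding is_umod_def by simp
qed

lemma free_act_reg: "free_act reg x = lmul (uq_proj p x)"
proof (induction x rule: free_elt_induct)
  note c = is_umodD(1)[OF is_umod_reg]
  {
    case (add x y)
    then show ?case using lmul_hom(2)[of "uq_proj p x" "uq_proj p y"] by (simp add: free_act_add Uq_fields)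
  next
    case (scal a x)
    then show ?case using lmul_hom(3)[of "uq_proj p x" "uq_proj p x" a] by (simp add: free_act_scal[OF c] Uq_fields)
  next
    case one
    then show ?case using lmul_hom(4)[of "uq_proj p 1" "uq_proj p 1"] by (simp add: free_act_one[OF c] Uq_fields)
  next
    case (gen g x)
    then show ?case using lmul_hom(1)[of "uq_proj p (free_gen g)" "uq_proj p x"] by (simp add: free_act_gen_mult[OF c] Uq_fields)
  }
qed

lemma rmul_uend:
  assumes u: "u \<in> carrier U"
  shows "rmul u \<in> uend reg"
proof (rule uhomI)
  fix g
  show "rmul u * uact reg g = uact reg g * rmul u"
    unfolding reg_simps
  proof (rule mat_eq_by_coords)
    fix w assume w: "w \<in> carrier U"
    show "(rmul u * lmul (uq_proj p (free_gen g))) *\<^sub>v co w = (lmul (uq_proj p (free_gen g)) * rmul u) *\<^sub>v co w"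
      unfolding mult_vec_assoc[OF rmul_carrier lmul_carrier w] mult_vec_assoc[OF lmul_carrier rmul_carrier w]
      using u w by (simp add: lmul_coords rmul_coords m_assoc)
  qed (rule mult_carrier_mat[of _ N N], simp, simp)+
qed simp

text \<open>
  An endomorphism of the regular module is the right multiplication by the image of the unit.
\<close>

lemma uend_reg_eq_rmul:
  assumes f: "f \<in> uend reg"
  obtains u where "u \<in> carrier U" "f = rmul u"
proof -
  note F = uhomD[OF f, simplified]
  define u where "u = of_coords (f *\<^sub>v co \<one>\<^bsub>U\<^esub>)"
  have fc: "f *\<^sub>v co \<one>\<^bsub>U\<^esub> \<in> carrier_vec N" using F(1) coords(1)[OF one_closed] by auto
  have "f = rmul u"
  proof (rule mat_eq_by_coords[OF F(1) rmul_carrier])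
    fix w assume w: "w \<in> carrier U"
    then obtain x where x: "w = uq_proj p x" by (rule Uq_carrierE)
    have "f *\<^sub>v co w = f *\<^sub>v (free_act reg x *\<^sub>v co \<one>\<^bsub>U\<^esub>)"
      using w by (simp add: free_act_reg x lmul_coords)
    also have "\<dots> = free_act reg x *\<^sub>v (f *\<^sub>v co \<one>\<^bsub>U\<^esub>)"
      using uhom_free_act[OF is_umodD(1)[OF is_umod_reg] is_umodD(1)[OF is_umod_reg] f, of x] F(1)
        mult_vec_assoc[of f N "free_act reg x" "\<one>\<^bsub>U\<^esub>"] mult_vec_assoc[of "free_act reg x" N f "\<one>\<^bsub>U\<^esub>"]
        free_act_carrier[of reg x] by simp
    also have "\<dots> = co (w \<otimes>\<^bsub>U\<^esub> u)"
      using lmul_coords[OF w of_coords_carrier, of "f *\<^sub>v co \<one>\<^bsub>U\<^esub>"] coords_of_coords[OF fc]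
      by (simp add: free_act_reg x u_def)
    finally show "f *\<^sub>v co w = rmul u *\<^sub>v co w"
      using w by (simp add: rmul_coords u_def)
  qed
  moreover have "u \<in> carrier U" unfolding u_def by (rule of_coords_carrier)
  ultimately show thesis by (rule that[rotated])
qed

text \<open>
  The regular module is free on the unit: a homomorphism into \<open>X\<close> is given by
  \<open>u \<mapsto> u x\<^sub>0\<close> for an arbitrary \<open>x\<^sub>0\<close>, so it can be lifted along a surjection by lifting the
  image of the unit.
\<close>

lemma uprojective_reg: "uprojective p reg"
  unfolding uprojective_def
proof (intro conjI allI impI)
  show "is_umod p reg" by (rule is_umod_reg)
  fix X Y g h
  assume X: "is_umod p X" and Y: "is_umod p Y" and g: "g \<in> uhom X Y" and s: "surj_mat g" and h: "h \<in> uhom reg Y"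
  note G = uhomD[OF g] and H = uhomD[OF h, simplified]
  note cX = is_umodD(1)[OF X] and cY = is_umodD(1)[OF Y] and cR = is_umodD(1)[OF is_umod_reg]
  have "h *\<^sub>v co \<one>\<^bsub>U\<^esub> \<in> carrier_vec (udim Y)" using H(1) coords(1)[OF one_closed] by auto
  then obtain x0 where x0: "x0 \<in> carrier_vec (udim X)" "g *\<^sub>v x0 = h *\<^sub>v co \<one>\<^bsub>U\<^esub>"
    using s G(1) unfolding surj_mat_def by auto
  define act where "act u = free_act X (SOME x. uq_proj p x = u) *\<^sub>v x0" for u
  \<comment> \<open>independent of the representative, since the relation ideal annihilates \<open>X\<close>\<close>
  have act: "act (uq_proj p x) = free_act X x *\<^sub>v x0" for x
  proof -
    define y where "y = (SOME y. uq_proj p y = uq_proj p x)"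
    have "uq_proj p y = uq_proj p x" unfolding y_def by (rule someI) simp
    then have "y - x \<in> rel_ideal p" unfolding uq_proj_eq_iff .
    then have "free_act X (y - x) = 0\<^sub>m (udim X) (udim X)" by (rule free_act_rel_ideal[OF X])
    then have "free_act X y = free_act X x"
      using free_act_add[of X "y - x" x] left_add_zero_mat[OF free_act_carrier[of X x]] by simp
    then show ?thesis by (simp add: act_def y_def)
  qed
  have act_carrier: "act u \<in> carrier_vec (udim X)" if "u \<in> carrier U" for u
    using that x0(1) mult_mat_vec_carrier[OF free_act_carrier x0(1)] by (auto elim!: Uq_carrierE simp: act)
  define k where "k = mat (udim X) N (\<lambda>(r, j). act (bs ! j) $ r)"
  have k: "k \<in> carrier_mat (udim X) N" by (simp add: k_def)
  have kc: "k *\<^sub>v co u = act u" if u: "u \<in> carrier U" for u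
  proof (rule eq_vecI)
    show "dim_vec (k *\<^sub>v co u) = dim_vec (act u)" using k act_carrier[OF u] by simp
    fix r assume "r < dim_vec (act u)"
    then have r: "r < udim X" using act_carrier[OF u] by simp
    have "linear_form U (\<lambda>w. act w $ r)"
      unfolding linear_form_def
    proof (intro conjI ballI allI)
      fix w w' assume "w \<in> carrier U" "w' \<in> carrier U"
      then show "act (w \<oplus>\<^bsub>U\<^esub> w') $ r = act w $ r + act w' $ r"
        using r x0(1) by (auto elim!: Uq_carrierE simp: Uq_fields act free_act_add
          add_mult_distrib_mat_vec[OF free_act_carrier free_act_carrier x0(1)] carrier_matD(1)[OF free_act_carrier[of X]] simp del: index_mult_mat_vec)
    next
      fix c w assume "w \<in> carrier U"
      then show "act (c \<odot>\<^bsub>U\<^esub> w) $ r = c * act w $ r"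
        using r x0(1) carrier_matD(1)[OF free_act_carrier[of X]] by (auto elim!: Uq_carrierE simp: Uq_fields act free_act_scal[OF cX]
          smult_mat_mult_vec[OF free_act_carrier x0(1)] simp del: index_mult_mat_vec)
    qed
    from linear_form_coords[OF this u] show "(k *\<^sub>v co u) $ r = act u $ r"
      unfolding mult_mat_vec_entry[OF k coords(1)[OF u] r] using r by (auto simp: k_def mult.commute intro!: sum.cong)
  qed
  have "k \<in> uhom reg X"
  proof (rule uhomI)
    fix x
    show "k * uact reg x = uact X x * k"
    proof (rule mat_eq_by_coords)
      fix u assume u: "u \<in> carrier U"
      then obtain y where y: "u = uq_proj p y" by (rule Uq_carrierE)
      have "(k * uact reg x) *\<^sub>v co u = act (uq_proj p (free_gen x) \<otimes>\<^bsub>U\<^esub> u)"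
        using u k by (simp add: mult_vec_assoc lmul_coords kc del: assoc_mult_mat_vec)
      also have "\<dots> = uact X x *\<^sub>v act u"
        unfolding y Uq_fields act free_act_gen_mult[OF cX] by (rule assoc_mult_mat_vec[OF cX free_act_carrier x0(1)])
      also have "\<dots> = (uact X x * k) *\<^sub>v co u"
        using assoc_mult_mat_vec[OF cX k coords(1)[OF u]] kc[OF u] by simp
      finally show "(k * uact reg x) *\<^sub>v co u = (uact X x * k) *\<^sub>v co u" .
    qed (use k cX in \<open>auto intro: mult_carrier_mat\<close>)
  qed (use k in simp)
  moreover have "g * k = h"
  proof (rule mat_eq_by_coords[OF mult_carrier_mat[OF G(1) k] H(1)])
    fix u assume u: "u \<in> carrier U"
    then obtain y where y: "u = uq_proj p y" by (rule Uq_carrierE)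
    have "(g * k) *\<^sub>v co u = g *\<^sub>v (free_act X y *\<^sub>v x0)"
      using assoc_mult_mat_vec[OF G(1) k coords(1)[OF u]] kc[OF u] by (simp add: y act)
    also have "\<dots> = free_act Y y *\<^sub>v (h *\<^sub>v co \<one>\<^bsub>U\<^esub>)"
      unfolding x0(2)[symmetric] assoc_mult_mat_vec[OF G(1) free_act_carrier x0(1), symmetric]
        uhom_free_act[OF cX cY g] by (rule assoc_mult_mat_vec[OF free_act_carrier G(1) x0(1)])
    also have "\<dots> = h *\<^sub>v (free_act reg y *\<^sub>v co \<one>\<^bsub>U\<^esub>)"
      using assoc_mult_mat_vec[OF free_act_carrier H(1) coords(1)[OF one_closed], of y]
        assoc_mult_mat_vec[OF H(1) free_act_carrier[of reg, simplified] coords(1)[OF one_closed], of y]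
        uhom_free_act[OF cR cY h, of y] by simp
    also have "\<dots> = h *\<^sub>v co u"
      using u lmul_coords[OF u one_closed] by (simp add: free_act_reg y)
    finally show "(g * k) *\<^sub>v co u = h *\<^sub>v co u" .
  qed
  ultimately show "\<exists>k\<in>uhom reg X. g * k = h" by blast
qed

end

section \<open>Central elements and commutators\<close>

text \<open>
  A linear form that separates an element from a subspace.  It is constructed on the free algebra, a
  vector space that fills its type, and is meant to descend to the quotient: take for \<open>S\<close> the
  preimage of a subspace.
\<close>

lemma free_elt_separating_form:
  assumes S: "0 \<in> S" "\<And>x y. x \<in> S \<Longrightarrow> y \<in> S \<Longrightarrow> x + y \<in> S" "\<And>c x. x \<in> S \<Longrightarrow> scal c x \<in> S"
    and a: "a \<notin> S"
  shows "\<exists>g :: free_elt \<Rightarrow> complex. (\<forall>x y. g (x + y) = g x + g y) \<and> (\<forall>c x. g (scal c x) = c * g x) \<and>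
    (\<forall>x\<in>S. g x = 0) \<and> g a = 1"
proof -
  interpret V: Vector_Spaces.vector_space scal
    by unfold_locales (simp_all add: scal_add_right scal_add_left scal_scal scal_one)
  interpret C: Vector_Spaces.vector_space "(*) :: complex \<Rightarrow> complex \<Rightarrow> complex"
    by unfold_locales (simp_all add: algebra_simps)
  interpret P: vector_space_pair scal "(*) :: complex \<Rightarrow> complex \<Rightarrow> complex" ..
  have sub: "V.subspace S" using S by (simp add: V.subspace_def)
  obtain B where B: "B \<subseteq> S" "V.independent B" "S \<subseteq> V.span B"
    by (rule V.maximal_independent_subset)
  have "V.span B = S" using B V.span_minimal[OF B(1) sub] by blast
  then have ind: "V.independent (insert a B)" using a B by (intro V.independent_insertI) auto
  obtain g where g: "Vector_Spaces.linear scal (*) g" "\<forall>x\<in>insert a B. g x = (if x = a then 1 else 0 :: complex)"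
    using P.linear_independent_extend[OF ind, of "\<lambda>x. if x = a then 1 else 0"] by blast
  have g0: "g x = 0" if "x \<in> S" for x
  proof (rule P.linear_eq_0_on_span[OF g(1)])
    show "x \<in> V.span B" using that B by blast
    show "g y = 0" if "y \<in> B" for y using that g(2) a B(1) by auto
  qed
  interpret g: Vector_Spaces.linear scal "(*)" g by (rule g(1))
  show ?thesis using g.add g.scale g0 g(2) by (intro exI[of _ g]) simp
qed

locale modified_trace_regular = regular_basis +
  fixes t :: "umod \<Rightarrow> complex mat \<Rightarrow> complex"
  assumes t: "modified_trace p t"
begin

abbreviation Tr where "Tr \<equiv> Tr_U p t bs"

lemma Tr_eq: "Tr u = t reg (rmul u)"
  by (simp add: Tr_U_def Tr_End_def)

lemma t_linear:
  "f \<in> uend reg \<Longrightarrow> h \<in> uend reg \<Longrightarrow> t reg (f + h) = t reg f + t reg h"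
  "f \<in> uend reg \<Longrightarrow> t reg (c \<cdot>\<^sub>m f) = c * t reg f"
  using t uprojective_reg unfolding modified_trace_def by blast+

lemma t_cyclic: "f \<in> uend reg \<Longrightarrow> h \<in> uend reg \<Longrightarrow> t reg (h * f) = t reg (f * h)"
  using t uprojective_reg unfolding modified_trace_def by blast

lemma linear_form_Tr: "linear_form U Tr"
  unfolding linear_form_def Tr_eq
  by (auto simp: rmul_hom(2) rmul_hom(3)[where w = "\<one>\<^bsub>U\<^esub>"] t_linear rmul_uend)

lemma Tr_symmetric: "u \<in> carrier U \<Longrightarrow> w \<in> carrier U \<Longrightarrow> Tr (u \<otimes>\<^bsub>U\<^esub> w) = Tr (w \<otimes>\<^bsub>U\<^esub> u)"
  unfolding Tr_eq by (simp add: rmul_hom(1) t_cyclic rmul_uend)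

lemma Tr_partial_trace:
  assumes f: "f \<in> uend (utensor_power reg 2)"
  shows "Tr_End p t bs 2 f = Tr_End p t bs 1 (ptr_right p reg reg f)"
    "Tr_End p t bs 2 f = Tr_End p t bs 1 (ptr_left p reg reg f)"
proof -
  have e: "utensor_power reg 2 = utensor reg reg" by (simp add: numeral_2_eq_2)
  have "t (utensor reg reg) f = t reg (ptr_right p reg reg f)" "t (utensor reg reg) f = t reg (ptr_left p reg reg f)"
    using t uprojective_reg is_umod_reg f unfolding modified_trace_def e by blast+
  then show "Tr_End p t bs 2 f = Tr_End p t bs 1 (ptr_right p reg reg f)"
    "Tr_End p t bs 2 f = Tr_End p t bs 1 (ptr_left p reg reg f)"
    by (simp_all add: Tr_End_def e)
qed

lemma zero_smult: "u \<in> carrier U \<Longrightarrow> 0 \<odot>\<^bsub>U\<^esub> u = \<zero>\<^bsub>U\<^esub>"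
  by (auto elim!: Uq_carrierE simp: Uq_fields(3,6) scal_def)

text \<open>
  Right multiplication by \<open>u\<close> is an endomorphism of the regular module; its products with all
  endomorphisms are the right multiplications by the elements \<open>u w\<close>.
\<close>

lemma Tr_nondegenerate:
  assumes u: "u \<in> carrier U" and zero: "\<And>w. w \<in> carrier U \<Longrightarrow> Tr (u \<otimes>\<^bsub>U\<^esub> w) = 0"
  shows "u = \<zero>\<^bsub>U\<^esub>"
proof -
  have "rmul u = 0\<^sub>m (udim reg) (udim reg)"
  proof (rule modified_trace_nondegenerate[OF p t uprojective_reg rmul_uend[OF u]])
    fix f assume "f \<in> uend reg"
    then obtain w where w: "w \<in> carrier U" "f = rmul w" by (rule uend_reg_eq_rmul)
    then show "t reg (f * rmul u) = 0"
      using zero[OF w(1)] rmul_hom(1)[OF u w(1)] by (simp add: Tr_eq)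
  qed
  then have "co u = 0\<^sub>m N N *\<^sub>v co \<one>\<^bsub>U\<^esub>"
    using rmul_coords[OF u one_closed] u by simp
  also have "\<dots> = 0 \<cdot>\<^sub>v co u"
    using u coords(1)[OF one_closed] by (auto intro!: eq_vecI)
  finally have "of_coords (co u) = 0 \<odot>\<^bsub>U\<^esub> of_coords (co u)"
    using of_coords_smult[OF coords(1)[OF u], of 0] by simp
  then have "u = 0 \<odot>\<^bsub>U\<^esub> u" by (simp add: coords(2)[OF u])
  also have "\<dots> = \<zero>\<^bsub>U\<^esub>" by (rule zero_smult[OF u])
  finally show ?thesis .
qed

text \<open>
  The Gram matrix of the non-degenerate form is invertible, so a linear system determines the
  coordinates of an element \<open>z\<close> for which \<open>Tr (z _)\<close> agrees with \<open>\<phi>\<close> on the basis.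
\<close>

lemma linear_form_representable:
  assumes \<phi>: "linear_form U \<phi>"
  obtains z where "z \<in> carrier U" "\<And>u. u \<in> carrier U \<Longrightarrow> \<phi> u = Tr (z \<otimes>\<^bsub>U\<^esub> u)"
proof -
  define G where "G = mat N N (\<lambda>(i, j). Tr (bs ! j \<otimes>\<^bsub>U\<^esub> bs ! i))"
  have G: "G \<in> carrier_mat N N" by (simp add: G_def)
  have lin1: "linear_form U (\<lambda>z. Tr (z \<otimes>\<^bsub>U\<^esub> u))" and lin2: "linear_form U (\<lambda>z. Tr (u \<otimes>\<^bsub>U\<^esub> z))"
    if "u \<in> carrier U" for u
    using that linear_form_Tr linear_map_mult[OF that] unfolding linear_form_def linear_map_def by simp_all
  have Gv: "(G *\<^sub>v v) $ i = Tr (of_coords v \<otimes>\<^bsub>U\<^esub> bs ! i)" if v: "v \<in> carrier_vec N" and i: "i < N" for v i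
  proof -
    have "Tr (of_coords v \<otimes>\<^bsub>U\<^esub> bs ! i) = (\<Sum>j<N. v $ j * Tr (bs ! j \<otimes>\<^bsub>U\<^esub> bs ! i))"
      using linear_form_coords[OF lin1[OF bs_carrier[OF i]] of_coords_carrier, of v] coords_of_coords[OF v] by simp
    then show ?thesis
      unfolding mult_mat_vec_entry[OF G v i] using i by (simp add: G_def mult.commute)
  qed
  have "det G \<noteq> 0"
  proof
    assume "det G = 0"
    then obtain v where v: "v \<in> carrier_vec N" "v \<noteq> 0\<^sub>v N" "G *\<^sub>v v = 0\<^sub>v N"
      unfolding det_0_iff_vec_prod_zero_field[OF G] by blast
    have "of_coords v = \<zero>\<^bsub>U\<^esub>"
    proof (rule Tr_nondegenerate[OF of_coords_carrier])
      fix w assume w: "w \<in> carrier U"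
      have "Tr (of_coords v \<otimes>\<^bsub>U\<^esub> w) = (\<Sum>i<N. co w $ i * Tr (of_coords v \<otimes>\<^bsub>U\<^esub> bs ! i))"
        by (rule linear_form_coords[OF lin2[OF of_coords_carrier] w])
      also have "\<dots> = 0" using Gv[OF v(1), symmetric] v(3) by (intro sum.neutral) simp
      finally show "Tr (of_coords v \<otimes>\<^bsub>U\<^esub> w) = 0" .
    qed
    also have "\<zero>\<^bsub>U\<^esub> = 0 \<odot>\<^bsub>U\<^esub> of_coords v" by (simp add: zero_smult)
    also have "\<dots> = of_coords (0 \<cdot>\<^sub>v v)" by (rule of_coords_smult[OF v(1), symmetric])
    finally have "co (of_coords v) = co (of_coords (0 \<cdot>\<^sub>v v))" by (rule arg_cong)
    also have "co (of_coords v) = v" by (rule coords_of_coords[OF v(1)])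
    also have "0 \<cdot>\<^sub>v v = 0\<^sub>v N" using v(1) by auto
    also have "co (of_coords (0\<^sub>v N)) = 0\<^sub>v N" by (rule coords_of_coords) simp
    finally show False using v(2) by simp
  qed
  define b where "b = vec N (\<lambda>i. \<phi> (bs ! i))"
  have b: "b \<in> carrier_vec N" by (simp add: b_def)
  define v where "v = inverse (det G) \<cdot>\<^sub>v (adj_mat G *\<^sub>v b)"
  note adj = adj_mat[OF G]
  have v: "v \<in> carrier_vec N" using adj(1) b by (simp add: v_def)
  have "G *\<^sub>v v = inverse (det G) \<cdot>\<^sub>v ((G * adj_mat G) *\<^sub>v b)"
    unfolding v_def using mult_mat_vec[OF G mult_mat_vec_carrier[OF adj(1) b]] assoc_mult_mat_vec[OF G adj(1) b] by simp
  also have "\<dots> = b"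
    unfolding adj(2) using smult_mat_mult_vec[of "1\<^sub>m N" N N b "det G"] b \<open>det G \<noteq> 0\<close> by (simp add: smult_smult_assoc)
  finally have Gb: "G *\<^sub>v v = b" .
  show thesis
  proof (rule that[OF of_coords_carrier])
    fix u assume u: "u \<in> carrier U"
    have "\<phi> u = (\<Sum>i<N. co u $ i * Tr (of_coords v \<otimes>\<^bsub>U\<^esub> bs ! i))"
      unfolding linear_form_coords[OF \<phi> u] using Gv[OF v, symmetric] by (intro sum.cong refl) (simp add: Gb b_def)
    also have "\<dots> = Tr (of_coords v \<otimes>\<^bsub>U\<^esub> u)"
      by (rule linear_form_coords[OF lin2[OF of_coords_carrier] u, symmetric])
    finally show "\<phi> u = Tr (of_coords v \<otimes>\<^bsub>U\<^esub> u)" .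
  qed
qed

abbreviation comm where "comm \<equiv> commutator_span U"

lemma commutator_in: "x \<in> carrier U \<Longrightarrow> y \<in> carrier U \<Longrightarrow> x \<otimes>\<^bsub>U\<^esub> y \<ominus>\<^bsub>U\<^esub> y \<otimes>\<^bsub>U\<^esub> x \<in> comm"
  and submodule_comm: "submodule class_ring comm U"
  and comm_minimal: "submodule class_ring M U \<Longrightarrow>
    (\<And>x y. x \<in> carrier U \<Longrightarrow> y \<in> carrier U \<Longrightarrow> x \<otimes>\<^bsub>U\<^esub> y \<ominus>\<^bsub>U\<^esub> y \<otimes>\<^bsub>U\<^esub> x \<in> M) \<Longrightarrow> comm \<subseteq> M"
proof -
  let ?S = "{x \<otimes>\<^bsub>U\<^esub> y \<ominus>\<^bsub>U\<^esub> y \<otimes>\<^bsub>U\<^esub> x | x y. x \<in> carrier U \<and> y \<in> carrier U}"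
  have S: "?S \<subseteq> carrier U" by auto
  show "submodule class_ring comm U"
    unfolding commutator_span_def by (rule span_is_submodule[OF S])
  show "x \<otimes>\<^bsub>U\<^esub> y \<ominus>\<^bsub>U\<^esub> y \<otimes>\<^bsub>U\<^esub> x \<in> comm" if "x \<in> carrier U" "y \<in> carrier U"
    unfolding commutator_span_def using in_own_span[OF S] that by blast
  show "comm \<subseteq> M" if "submodule class_ring M U" "\<And>x y. x \<in> carrier U \<Longrightarrow> y \<in> carrier U \<Longrightarrow> x \<otimes>\<^bsub>U\<^esub> y \<ominus>\<^bsub>U\<^esub> y \<otimes>\<^bsub>U\<^esub> x \<in> M"
    unfolding commutator_span_def by (rule span_is_subset[OF _ that(1)]) (use that(2) in blast)
qed

lemma comm_carrier: "comm \<subseteq> carrier U"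
  using submodule.subset[OF submodule_comm] .

lemma linear_form_zero_minus:
  assumes \<phi>: "linear_form U \<phi>"
  shows "\<phi> \<zero>\<^bsub>U\<^esub> = 0" "u \<in> carrier U \<Longrightarrow> w \<in> carrier U \<Longrightarrow> \<phi> (u \<ominus>\<^bsub>U\<^esub> w) = \<phi> u - \<phi> w"
proof -
  show "\<phi> \<zero>\<^bsub>U\<^esub> = 0"
    using linear_form_finsum[OF \<phi>, of "{}" "\<lambda>_. \<zero>\<^bsub>U\<^esub>"] by simp
  assume uw: "u \<in> carrier U" "w \<in> carrier U"
  then have "(u \<ominus>\<^bsub>U\<^esub> w) \<oplus>\<^bsub>U\<^esub> w = u" by (auto elim!: Uq_carrierE simp: Uq_minus Uq_fields(5))
  moreover have "\<phi> ((u \<ominus>\<^bsub>U\<^esub> w) \<oplus>\<^bsub>U\<^esub> w) = \<phi> (u \<ominus>\<^bsub>U\<^esub> w) + \<phi> w"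
    using \<phi> uw unfolding linear_form_def by (simp add: minus_closed)
  ultimately show "\<phi> (u \<ominus>\<^bsub>U\<^esub> w) = \<phi> u - \<phi> w" by simp
qed

text \<open>
  For central \<open>z\<close> the form \<open>Tr (z _)\<close> is symmetric:
  \<open>Tr (z y x) = Tr (y z x) = Tr (z x y)\<close>.
\<close>

lemma Tr_central_comm:
  assumes z: "z \<in> alg_center U" and c: "c \<in> comm"
  shows "Tr (z \<otimes>\<^bsub>U\<^esub> c) = 0"
proof -
  have zc: "z \<in> carrier U" and zz: "\<And>x. x \<in> carrier U \<Longrightarrow> z \<otimes>\<^bsub>U\<^esub> x = x \<otimes>\<^bsub>U\<^esub> z"
    using z by (auto simp: alg_center_def)
  have lin: "linear_form U (\<lambda>x. Tr (z \<otimes>\<^bsub>U\<^esub> x))"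
    using linear_form_Tr linear_map_mult(1)[OF zc] unfolding linear_form_def linear_map_def by simp
  have "submodule class_ring {x \<in> carrier U. Tr (z \<otimes>\<^bsub>U\<^esub> x) = 0} U"
  proof
    show "{x \<in> carrier U. Tr (z \<otimes>\<^bsub>U\<^esub> x) = 0} \<subseteq> carrier U" by blast
    show "\<zero>\<^bsub>U\<^esub> \<in> {x \<in> carrier U. Tr (z \<otimes>\<^bsub>U\<^esub> x) = 0}" using linear_form_zero_minus(1)[OF lin] by simp
  qed (use lin in \<open>auto simp: linear_form_def\<close>)
  moreover have "x \<otimes>\<^bsub>U\<^esub> y \<ominus>\<^bsub>U\<^esub> y \<otimes>\<^bsub>U\<^esub> x \<in> {x \<in> carrier U. Tr (z \<otimes>\<^bsub>U\<^esub> x) = 0}"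
    if xy: "x \<in> carrier U" "y \<in> carrier U" for x y
  proof -
    have "Tr (z \<otimes>\<^bsub>U\<^esub> (y \<otimes>\<^bsub>U\<^esub> x)) = Tr (y \<otimes>\<^bsub>U\<^esub> (z \<otimes>\<^bsub>U\<^esub> x))"
      using xy zc zz[of y] by (simp add: m_assoc[symmetric])
    also have "\<dots> = Tr ((z \<otimes>\<^bsub>U\<^esub> x) \<otimes>\<^bsub>U\<^esub> y)" using xy zc by (intro Tr_symmetric) auto
    finally have "Tr (z \<otimes>\<^bsub>U\<^esub> (x \<otimes>\<^bsub>U\<^esub> y)) = Tr (z \<otimes>\<^bsub>U\<^esub> (y \<otimes>\<^bsub>U\<^esub> x))" using xy zc by (simp add: m_assoc)
    then show ?thesis using linear_form_zero_minus(2)[OF lin] xy by (auto simp: minus_closed)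
  qed
  ultimately show ?thesis using comm_minimal c by blast
qed

lemma pairing_eq_Tr:
  assumes z: "z \<in> alg_center U" and u: "u \<in> carrier U"
  shows "center_HH0_pairing U Tr z (comm +>\<^bsub>U\<^esub> u) = Tr (z \<otimes>\<^bsub>U\<^esub> u)"
proof -
  have zc: "z \<in> carrier U" using z by (simp add: alg_center_def)
  have lin: "linear_form U (\<lambda>x. Tr (z \<otimes>\<^bsub>U\<^esub> x))"
    using linear_form_Tr linear_map_mult(1)[OF zc] unfolding linear_form_def linear_map_def by simp
  have coset: "comm +>\<^bsub>U\<^esub> u = (\<lambda>c. c \<oplus>\<^bsub>U\<^esub> u) ` comm" by (auto simp: a_r_coset_def')
  have "Tr (z \<otimes>\<^bsub>U\<^esub> w) = Tr (z \<otimes>\<^bsub>U\<^esub> u)" if "w \<in> comm +>\<^bsub>U\<^esub> u" for w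
    using that lin Tr_central_comm[OF z] comm_carrier u unfolding coset linear_form_def by auto
  moreover have "comm +>\<^bsub>U\<^esub> u \<noteq> {}"
    using submodule.zero_closed[OF submodule_comm] unfolding coset by blast
  ultimately show ?thesis unfolding center_HH0_pairing_def by (intro the_equality) auto
qed

text \<open>
  If \<open>u\<close> were not in the span of the commutators, some linear form would vanish on this span but not at
  \<open>u\<close>.  The form is \<open>Tr (z _)\<close> for some \<open>z\<close>, and its symmetry forces \<open>z\<close>
  to be central: \<open>Tr (z x y) = Tr (z y x) = Tr (x z y)\<close> for all \<open>y\<close>.
\<close>

lemma comm_eq_center_orthogonal:
  assumes u: "u \<in> carrier U" and zero: "\<And>z. z \<in> alg_center U \<Longrightarrow> Tr (z \<otimes>\<^bsub>U\<^esub> u) = 0"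
  shows "u \<in> comm"
proof (rule ccontr)
  assume nu: "u \<notin> comm"
  interpret C: submodule class_ring comm U by (rule submodule_comm)
  obtain a where a: "u = uq_proj p a" using u by (rule Uq_carrierE)
  define S where "S = {x. uq_proj p x \<in> comm}"
  have S0: "0 \<in> S" using C.zero_closed by (simp add: S_def Uq_fields(3))
  have S_add: "x + y \<in> S" if "x \<in> S" "y \<in> S" for x y
    using C.m_closed[of "uq_proj p x" "uq_proj p y"] that by (simp add: S_def Uq_fields(5))
  have S_scal: "scal c x \<in> S" if "x \<in> S" for c x
    using C.smult_closed[of c "uq_proj p x"] that by (simp add: S_def Uq_fields(6) class_ring_simps)
  have aS: "a \<notin> S" using nu a by (simp add: S_def)
  obtain g :: "free_elt \<Rightarrow> complex" where g: "\<forall>x y. g (x + y) = g x + g y" "\<forall>c x. g (scal c x) = c * g x"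
    "\<forall>x\<in>S. g x = 0" "g a = 1"
    using free_elt_separating_form[OF S0 S_add S_scal aS] by blast
  define \<phi> where "\<phi> w = g (SOME x. uq_proj p x = w)" for w
  \<comment> \<open>\<open>g\<close> descends to the quotient because \<open>S\<close> contains the relation ideal\<close>
  have \<phi>: "\<phi> (uq_proj p x) = g x" for x
  proof -
    define y where "y = (SOME y. uq_proj p y = uq_proj p x)"
    have "uq_proj p y = uq_proj p x" unfolding y_def by (rule someI) simp
    then have "y - x \<in> rel_ideal p" unfolding uq_proj_eq_iff .
    then have "uq_proj p (y - x) = uq_proj p 0" unfolding uq_proj_eq_iff by simp
    then have "y - x \<in> S" using C.zero_closed by (simp add: S_def Uq_fields(3))
    then have "g y = g x" using g(1)[rule_format, of "y - x" x] g(3) by simp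
    then show ?thesis by (simp add: \<phi>_def y_def)
  qed
  have lin: "linear_form U \<phi>"
    unfolding linear_form_def by (auto elim!: Uq_carrierE simp: Uq_fields(5,6) \<phi> g(1,2))
  have \<phi>0: "\<phi> c = 0" if "c \<in> comm" for c
  proof -
    have "c \<in> carrier U" using that comm_carrier by blast
    then obtain x where x: "c = uq_proj p x" by (rule Uq_carrierE)
    then show ?thesis using that g(3) by (simp add: \<phi> S_def)
  qed
  obtain z where z: "z \<in> carrier U" "\<And>w. w \<in> carrier U \<Longrightarrow> \<phi> w = Tr (z \<otimes>\<^bsub>U\<^esub> w)"
    using linear_form_representable[OF lin] by blast
  have "z \<in> alg_center U"
    unfolding alg_center_def
  proof (intro CollectI conjI ballI)
    fix x assume x: "x \<in> carrier U"
    have "(z \<otimes>\<^bsub>U\<^esub> x) \<ominus>\<^bsub>U\<^esub> (x \<otimes>\<^bsub>U\<^esub> z) = \<zero>\<^bsub>U\<^esub>"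
    proof (rule Tr_nondegenerate)
      fix y assume y: "y \<in> carrier U"
      have lin': "linear_form U (\<lambda>w. Tr (w \<otimes>\<^bsub>U\<^esub> y))"
        using linear_form_Tr linear_map_mult(2)[OF y] unfolding linear_form_def linear_map_def by simp
      have "Tr ((x \<otimes>\<^bsub>U\<^esub> z) \<otimes>\<^bsub>U\<^esub> y) = Tr (x \<otimes>\<^bsub>U\<^esub> (z \<otimes>\<^bsub>U\<^esub> y))" using x y z(1) by (simp add: m_assoc)
      also have "\<dots> = Tr ((z \<otimes>\<^bsub>U\<^esub> y) \<otimes>\<^bsub>U\<^esub> x)" using x y z(1) by (intro Tr_symmetric) auto
      also have "\<dots> = \<phi> (y \<otimes>\<^bsub>U\<^esub> x)" using x y z by (simp add: m_assoc)
      also have "\<dots> = \<phi> (x \<otimes>\<^bsub>U\<^esub> y)"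
        using linear_form_zero_minus(2)[OF lin, of "x \<otimes>\<^bsub>U\<^esub> y" "y \<otimes>\<^bsub>U\<^esub> x"] \<phi>0[OF commutator_in[OF x y]] x y by simp
      also have "\<dots> = Tr ((z \<otimes>\<^bsub>U\<^esub> x) \<otimes>\<^bsub>U\<^esub> y)" using x y z by (simp add: m_assoc)
      finally show "Tr ((z \<otimes>\<^bsub>U\<^esub> x \<ominus>\<^bsub>U\<^esub> x \<otimes>\<^bsub>U\<^esub> z) \<otimes>\<^bsub>U\<^esub> y) = 0"
        using linear_form_zero_minus(2)[OF lin'] x z(1) by simp
    qed (use x z(1) in simp)
    then show "z \<otimes>\<^bsub>U\<^esub> x = x \<otimes>\<^bsub>U\<^esub> z" using x z(1) by simp
  qed (rule z(1))
  then have "Tr (z \<otimes>\<^bsub>U\<^esub> u) = 0" by (rule zero)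
  moreover have "Tr (z \<otimes>\<^bsub>U\<^esub> u) = 1" using z(2)[OF u] \<phi> a g(4) by simp
  ultimately show False by simp
qed

lemma coset_comm:
  assumes "u \<in> comm"
  shows "comm +>\<^bsub>U\<^esub> u = comm"
proof -
  interpret C: submodule class_ring comm U by (rule submodule_comm)
  have coset: "comm +>\<^bsub>U\<^esub> u = (\<lambda>c. c \<oplus>\<^bsub>U\<^esub> u) ` comm" by (auto simp: a_r_coset_def')
  show ?thesis
  proof
    show "comm +>\<^bsub>U\<^esub> u \<subseteq> comm" unfolding coset using assms by auto
    show "comm \<subseteq> comm +>\<^bsub>U\<^esub> u"
    proof
      fix c assume c: "c \<in> comm"
      have "c \<oplus>\<^bsub>U\<^esub> (-1) \<odot>\<^bsub>U\<^esub> u \<in> comm" using c assms by (simp add: class_ring_simps)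
      moreover have "(c \<oplus>\<^bsub>U\<^esub> (-1) \<odot>\<^bsub>U\<^esub> u) \<oplus>\<^bsub>U\<^esub> u = c"
      proof -
        have "c \<in> carrier U" "u \<in> carrier U" using c assms comm_carrier by blast+
        then obtain x y where "c = uq_proj p x" "u = uq_proj p y" by (metis Uq_carrierE)
        moreover have "scal (-1) y + y = 0" using scal_add_left[of "-1" 1 y] by (simp add: scal_one scal_def)
        ultimately show ?thesis by (simp add: Uq_fields(5,6) add.assoc)
      qed
      ultimately show "c \<in> comm +>\<^bsub>U\<^esub> u" unfolding coset by (intro image_eqI[of c _ "c \<oplus>\<^bsub>U\<^esub> (-1) \<odot>\<^bsub>U\<^esub> u"]) auto
    qed
  qed
qed

lemma pairing_nondegenerate:
  "nondegenerate_pairing (alg_center U) \<zero>\<^bsub>U\<^esub> (HH0 U) comm (center_HH0_pairing U Tr)"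
  unfolding nondegenerate_pairing_def
proof (intro conjI ballI impI)
  fix z assume z: "z \<in> alg_center U" and zero: "\<forall>c\<in>HH0 U. center_HH0_pairing U Tr z c = 0"
  show "z = \<zero>\<^bsub>U\<^esub>"
  proof (rule Tr_nondegenerate)
    show "z \<in> carrier U" using z by (simp add: alg_center_def)
    fix u assume u: "u \<in> carrier U"
    then have "comm +>\<^bsub>U\<^esub> u \<in> HH0 U" by (auto simp: HH0_def A_RCOSETS_def')
    then show "Tr (z \<otimes>\<^bsub>U\<^esub> u) = 0" using zero pairing_eq_Tr[OF z u] by simp
  qed
next
  fix c assume "c \<in> HH0 U" and zero: "\<forall>z\<in>alg_center U. center_HH0_pairing U Tr z c = 0"
  then obtain u where u: "u \<in> carrier U" "c = comm +>\<^bsub>U\<^esub> u" by (auto simp: HH0_def A_RCOSETS_def')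
  have "u \<in> comm"
    by (rule comm_eq_center_orthogonal[OF u(1)]) (use zero pairing_eq_Tr u in simp)
  then show "c = comm" using coset_comm u(2) by simp
qed

end

theorem theorem2:
  fixes p :: nat
    and t :: "umod \<Rightarrow> complex mat \<Rightarrow> complex"
    and bs :: "free_elt set list"
  assumes "p \<ge> 2"
    and "modified_trace p t"
    and "ordered_basis (Uq p) bs"
  shows "linear_form (Uq p) (Tr_U p t bs) \<and>
    (\<forall>x\<in>carrier (Uq p). \<forall>y\<in>carrier (Uq p).
       Tr_U p t bs (x \<otimes>\<^bsub>Uq p\<^esub> y) = Tr_U p t bs (y \<otimes>\<^bsub>Uq p\<^esub> x)) \<and>
    (\<forall>f\<in>uend (utensor_power (regular_umod p bs) 2).
       Tr_End p t bs 2 f = Tr_End p t bs 1 (ptr_right p (regular_umod p bs) (regular_umod p bs) f) \<and>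
       Tr_End p t bs 2 f = Tr_End p t bs 1 (ptr_left p (regular_umod p bs) (regular_umod p bs) f)) \<and>
    (\<forall>z\<in>alg_center (Uq p). \<forall>u\<in>carrier (Uq p).
       center_HH0_pairing (Uq p) (Tr_U p t bs) z (commutator_span (Uq p) +>\<^bsub>Uq p\<^esub> u) =
         Tr_U p t bs (z \<otimes>\<^bsub>Uq p\<^esub> u)) \<and>
    nondegenerate_pairing (alg_center (Uq p)) \<zero>\<^bsub>Uq p\<^esub> (HH0 (Uq p)) (commutator_span (Uq p))
      (center_HH0_pairing (Uq p) (Tr_U p t bs))"
proof -
  interpret modified_trace_regular p bs t
    by unfold_locales (use assms in auto)
  show ?thesis
    using linear_form_Tr Tr_symmetric Tr_partial_trace pairing_eq_Tr pairing_nondegenerate by blast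
qed

end
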